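(* Let $f:[0,T]\times\mathbb R\times \mathbb L^2(\nu)\to\mathbb R$ satisfy, for all $t\in[0,T]$, $y,y'\in\mathbb R$, $z,z'\in\mathbb L^2(\nu)$, $$|f(t,y,z(\cdot))-f(t,y',z'(\cdot))|\le L_f\Big[|y-y'|+\Big(\int_{\mathbb R^d}|z(x)-z'(x)|^2\,\nu(\mathrm dx)\Big)^{1/2}\Big],$$ and let $g:\mathbb R^d\to\mathbb R$ satisfy $|g(x)-g(x')|\le L_g\|x-x'\|$ for all $x,x'$. Let $(Y,U)$ be the solution of $$Y_t=g(X_T)+\int_t^T f(s,Y_s,U_s(\cdot))\,\mathrm ds-\int_t^T\int_{\mathbb R^d}U_s(x)\,\widetilde\mu(\mathrm ds,\mathrm dx),$$ and, for $n\in\mathbb N$, let $(Y^n,U^n)$ be the solution of $$Y^n_t=g(X^n_T)+\int_t^T f(s,Y^n_s,U^n_s(\cdot))\,\mathrm ds-\int_t^T\int_{\mathbb R^d}U^n_s(x)\,\widetilde\mu^n(\mathrm ds,\mathrm dx).$$ Assume that the Blumenthal--Getoor index of $X$ satisfies $\beta_*<2$. Then for any $\beta\in(\beta_*,2)$ there exists a constant $C'=C_{L_f,T}L_g$, where $C_{L_f,T}$ is the stability constant described in the context (depending only on $L_f$ and $T$), such that for every $n\in\mathbb N$ $$\mathcal W_\rho(Y^n,Y)\le C'\,\frac{C_\beta\sqrt T}{n^{1-\beta/2}},\qquad \mathcal W_{\widetilde\rho}(U^n,U)\le C'\,\frac{C_\beta\sqrt T}{n^{1-\beta/2}},$$ where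 $C_\beta=2\big(\int_{\mathbb R^d}\|x\|^\beta\nu(\mathrm dx)\big)^{1/2}$.
   Context: Fix $T>0$ and a complete stochastic basis $(\Omega,\mathcal G,\mathbb G=(\mathcal G_t)_{t\in[0,T]},\mathbb P)$ satisfying the usual conditions. $X=(X_t)_{t\in[0,T]}$ is an $\mathbb R^d$-valued pure-jump square-integrable Lévy martingale with triplet $(0,0,\nu)$, i.e. $\nu$ is a Lévy measure with $\int_{\|x\|\ge1}\|x\|^2\nu(\mathrm dx)<\infty$ and $X_t=\int_0^t\int_{\mathbb R^d}x\,\widetilde\mu(\mathrm ds,\mathrm dx)$, where $\mu$ is the Poisson random measure of the jumps $(\Delta X_t)$ and $\widetilde\mu(\mathrm ds,\mathrm dx)=\mu(\mathrm ds,\mathrm dx)-\nu(\mathrm dx)\mathrm ds$. $\mathbb G$ is the usual augmentation of the natural filtration of $X$. For $n\in\mathbb N$, put $\mu^n(\mathrm ds,\mathrm dx)=\mathbf 1_{\{\|x\|\ge1/n\}}\mu(\mathrm ds,\mathrm dx)$, $\nu^n(\mathrm dx)=\mathbf 1_{\{\|x\|\ge1/n\}}\nu(\mathrm dx)$, $\widetilde\mu^n(\mathrm ds,\mathrm dx)=\mu^n(\mathrm ds,\mathrm dx)-\nu^n(\mathrm dx)\mathrm ds$, and $X^n_t=\int_0^t\int_{\mathbb R^d}x\,\widetilde\mu^n(\mathrm ds,\mathrm dx)$. $\mathbb G^n=(\mathcal G^n_t)$ is the filtration generated by $X^n$. The Blumenthal--Getoor index of $X$ is $\beta_*=\inf\{\beta>0:\int_{\|x\|\le1}\|x\|^\beta\nu(\mathrm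 dx)<\infty\}$. For $h\in\mathbb L^2(\nu^n)$ one has $h\mathbf 1_{\{\|x\|\ge1/n\}}\in\mathbb L^2(\nu)$, and $f(t,y,h(\cdot))$ is understood as $f(t,y,h\mathbf 1_{\{\|x\|\ge1/n\}})$. It is a standing assumption that $\int_0^T|f(t,0,0)|^2\mathrm dt<\infty$. Solutions are the unique square-integrable ones: $Y$ is real-valued, càdlàg and $\mathbb G$-adapted with $\mathbb E[\sup_t|Y_t|^2]<\infty$, $U$ is $\mathbb G$-predictable with $\mathbb E[\int_0^T\int|U_t(x)|^2\nu(\mathrm dx)\mathrm dt]<\infty$; and analogously for $(Y^n,U^n)$ with $\mathbb G^n$, $\nu^n$. Stability constant: $C_{L_f,T}$ denotes a constant, depending only on $L_f$ and $T$, such that whenever the terminal values $g(X_T)$, $g(X^n_T)$ in the two BSDEs are replaced by arbitrary square-integrable $\xi$ ($\mathcal G_T$-measurable) and $\xi^n$ ($\mathcal G^n_T$-measurable), both $\mathbb E[\sup_t|Y^n_t-Y_t|^2]^{1/2}$ and $(\int_0^T\int\mathbb E[|\overline U^n_t(x)-U_t(x)|^2]\nu(\mathrm dx)\mathrm dt)^{1/2}$, with $\overline U^n_t(x)=U^n_t(x)\mathbf 1_{\{\|x\|\ge1/n\}}$, are bounded by $C_{L_f,T}\,\mathbb E[|\xi^n-\xi|^2]^{1/2}$. Wasserstein distances. $D([0,T])$ is the space of real-valued càdlàg paths on $[0,T]$ with its Borel $\sigma$-algebra (Skorokhod topology), $\rho(y,y')=\sup_{t\in[0,T]}|y_t-y'_t|$,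 and for probability measures $v,v'$ on $D([0,T])$ $$\mathcal W_\rho(v,v')=\inf_{\Gamma}\Big(\int\rho^2(y,y')\,\Gamma(\mathrm dy,\mathrm dy')\Big)^{1/2},$$ the infimum being over all couplings $\Gamma$ of $v$ and $v'$ (probability measures on $D([0,T])\times D([0,T])$ with marginals $v,v'$). Similarly, with $\widetilde D=\mathbb L^2(\nu(\mathrm dx)\times\mathrm dt)$ and $\widetilde\rho^2(y,y')=\int_0^T\int_{\mathbb R^d}|y'_t(x)-y_t(x)|^2\nu(\mathrm dx)\mathrm dt$, for probability measures $u,u'$ on $\widetilde D$, $\mathcal W_{\widetilde\rho}(u,u')=\inf_{\widetilde\Gamma}(\int\widetilde\rho^2\,\mathrm d\widetilde\Gamma)^{1/2}$ over couplings $\widetilde\Gamma$ of $u,u'$. $\mathcal W_\rho(Y^n,Y)$ and $\mathcal W_{\widetilde\rho}(U^n,U)$ denote the distances between the laws of the respective random elements, where $U^n$ is regarded as an element of $\widetilde D$ via $\overline U^n_t(x)=U^n_t(x)\mathbf 1_{\{\|x\|\ge1/n\}}$. *)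

theory Defs
  imports "HOL-Probability.Probability"
begin

section \<open>Square-integrable functions, Borel sets, Wasserstein distance\<close>

text \<open>Elements of an L2 space are represented by square-integrable functions instead of classes
  modulo a.e. equality. \<open>l2_dist\<close> is then a pseudometric, and \<open>borel_of_dist\<close> of it is the
  preimage of the Borel sigma-algebra of the quotient.\<close>

definition L2_space :: "'e measure \<Rightarrow> ('e \<Rightarrow> real) set" where
  "L2_space N = {h. h \<in> borel_measurable N \<and> integrable N (\<lambda>x. (h x)\<^sup>2)}"

definition l2_dist :: "'e measure \<Rightarrow> ('e \<Rightarrow> real) \<Rightarrow> ('e \<Rightarrow> real) \<Rightarrow> real" where
  "l2_dist N h h' = sqrt (LINT x|N. \<bar>h x - h' x\<bar>\<^sup>2)"

definition borel_of_dist :: "'s set \<Rightarrow> ('s \<Rightarrow> 's \<Rightarrow> real) \<Rightarrow> 's measure" where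
  "borel_of_dist S d = sigma S {V. V \<subseteq> S \<and> (\<forall>x\<in>V. \<exists>e>0. \<forall>y\<in>S. d x y < e \<longrightarrow> y \<in> V)}"

definition ennreal_sqrt :: "ennreal \<Rightarrow> ennreal" where
  "ennreal_sqrt x = (if x = \<top> then \<top> else ennreal (sqrt (enn2real x)))"

definition couplings :: "'s measure \<Rightarrow> 's measure \<Rightarrow> ('s \<times> 's) measure set" where
  "couplings u v = {\<Gamma>. prob_space \<Gamma> \<and> sets \<Gamma> = sets (u \<Otimes>\<^sub>M v) \<and>
     distr \<Gamma> u fst = u \<and> distr \<Gamma> v snd = v}"

definition wasserstein :: "('s \<Rightarrow> 's \<Rightarrow> ennreal) \<Rightarrow> 's measure \<Rightarrow> 's measure \<Rightarrow> ennreal" where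
  "wasserstein \<rho> u v =
     (INF \<Gamma>\<in>couplings u v. ennreal_sqrt (\<integral>\<^sup>+ p. (\<rho> (fst p) (snd p))\<^sup>2 \<partial>\<Gamma>))"

section \<open>Cadlag paths and the Skorokhod space\<close>

definition cadlag :: "real \<Rightarrow> (real \<Rightarrow> 'b::topological_space) \<Rightarrow> bool" where
  "cadlag T x \<longleftrightarrow> (\<forall>t\<in>{0..<T}. (x \<longlongrightarrow> x t) (at_right t)) \<and>
     (\<forall>t\<in>{0<..T}. \<exists>l. (x \<longlongrightarrow> l) (at_left t))"

definition path_jump :: "(real \<Rightarrow> 'b::real_normed_vector) \<Rightarrow> real \<Rightarrow> 'b" where
  "path_jump x s = x s - Lim (at_left s) x"

text \<open>Paths are normalised to be undefined outside [0,T], so that equality of paths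
  means equality on [0,T].\<close>

definition cadlag_paths :: "real \<Rightarrow> (real \<Rightarrow> real) set" where
  "cadlag_paths T = {y \<in> extensional {0..T}. cadlag T y}"

definition time_change :: "real \<Rightarrow> (real \<Rightarrow> real) \<Rightarrow> bool" where
  "time_change T l \<longleftrightarrow> strict_mono_on {0..T} l \<and> l ` {0..T} = {0..T}"

definition skorokhod_dist :: "real \<Rightarrow> (real \<Rightarrow> real) \<Rightarrow> (real \<Rightarrow> real) \<Rightarrow> real" where
  "skorokhod_dist T x y = Inf {e. 0 < e \<and> (\<exists>l. time_change T l \<and>
     (\<forall>t\<in>{0..T}. \<bar>l t - t\<bar> \<le> e \<and> \<bar>x t - y (l t)\<bar> \<le> e))}"

definition skorokhod_borel :: "real \<Rightarrow> (real \<Rightarrow> real) measure" where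
  "skorokhod_borel T = borel_of_dist (cadlag_paths T) (skorokhod_dist T)"

definition sup_dist :: "real \<Rightarrow> (real \<Rightarrow> real) \<Rightarrow> (real \<Rightarrow> real) \<Rightarrow> ennreal" where
  "sup_dist T y y' = (SUP t\<in>{0..T}. ennreal \<bar>y t - y' t\<bar>)"

definition path_law :: "'w measure \<Rightarrow> real \<Rightarrow> (real \<Rightarrow> 'w \<Rightarrow> real) \<Rightarrow> (real \<Rightarrow> real) measure" where
  "path_law M T Y = distr M (skorokhod_borel T) (\<lambda>\<omega>. restrict (\<lambda>t. Y t \<omega>) {0..T})"

section \<open>Random fields as elements of L2\<close>

definition time_measure :: "real \<Rightarrow> real measure" where
  "time_measure T = density lborel (indicator {0..T})"

definition l2_edist :: "'e measure \<Rightarrow> ('e \<Rightarrow> real) \<Rightarrow> ('e \<Rightarrow> real) \<Rightarrow> ennreal" where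
  "l2_edist N h h' = ennreal_sqrt (\<integral>\<^sup>+ p. ennreal (\<bar>h' p - h p\<bar>\<^sup>2) \<partial>N)"

text \<open>A random field with finite expected squared norm lies in L2 only almost surely;
  on the exceptional null event its value is replaced by 0.\<close>

definition field_path ::
  "real \<Rightarrow> 'a measure \<Rightarrow> (real \<Rightarrow> 'w \<Rightarrow> 'a \<Rightarrow> real) \<Rightarrow> 'w \<Rightarrow> (real \<times> 'a \<Rightarrow> real)" where
  "field_path T \<nu> U \<omega> = (let h = (\<lambda>(t, x). if t \<in> {0..T} then U t \<omega> x else 0) in
     if h \<in> L2_space (time_measure T \<Otimes>\<^sub>M \<nu>) then h else (\<lambda>_. 0))"

definition field_law ::
  "'w measure \<Rightarrow> real \<Rightarrow> 'a measure \<Rightarrow> (real \<Rightarrow> 'w \<Rightarrow> 'a \<Rightarrow> real) \<Rightarrow> (real \<times> 'a \<Rightarrow> real) measure" where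
  "field_law M T \<nu> U =
     distr M (borel_of_dist (L2_space (time_measure T \<Otimes>\<^sub>M \<nu>)) (l2_dist (time_measure T \<Otimes>\<^sub>M \<nu>)))
       (field_path T \<nu> U)"

section \<open>Filtrations\<close>

definition natural_filtration ::
  "'w measure \<Rightarrow> (real \<Rightarrow> 'w \<Rightarrow> 'b::topological_space) \<Rightarrow> real \<Rightarrow> 'w measure" where
  "natural_filtration M X t =
     sigma (space M) (\<Union>s\<in>{0..t}. {X s -` A \<inter> space M | A. A \<in> sets borel})"

text \<open>Null sets are added and right limits are taken; at the terminal time T, where there is
  no right limit, only null sets are added.\<close>

definition usual_augmentation ::
  "'w measure \<Rightarrow> real \<Rightarrow> (real \<Rightarrow> 'w measure) \<Rightarrow> real \<Rightarrow> 'w measure" where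
  "usual_augmentation M T F t =
     sigma (space M) (\<Inter>s\<in>insert T {t<..<T}. sigma_sets (space M) (sets (F s) \<union> null_sets M))"

definition predictable_sigma ::
  "'w measure \<Rightarrow> real \<Rightarrow> (real \<Rightarrow> 'w measure) \<Rightarrow> (real \<times> 'w) measure" where
  "predictable_sigma M T F = sigma ({0..T} \<times> space M)
     ({{0} \<times> A | A. A \<in> sets (F 0)} \<union>
      {{s<..t} \<times> A | s t A. 0 \<le> s \<and> s < t \<and> t \<le> T \<and> A \<in> sets (F s)})"

definition predictable_field ::
  "'w measure \<Rightarrow> real \<Rightarrow> (real \<Rightarrow> 'w measure) \<Rightarrow> (real \<Rightarrow> 'w \<Rightarrow> 'a::topological_space \<Rightarrow> real) \<Rightarrow> bool"
where
  "predictable_field M T F U \<longleftrightarrow>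
     (\<lambda>((t, \<omega>), x). U t \<omega> x) \<in> borel_measurable (predictable_sigma M T F \<Otimes>\<^sub>M borel)"

section \<open>Jump measures and compensated integrals\<close>

definition jump_measure ::
  "real \<Rightarrow> (real \<Rightarrow> 'a::real_normed_vector) \<Rightarrow> (real \<times> 'a) measure" where
  "jump_measure T x =
     distr (count_space {s \<in> {0<..T}. path_jump x s \<noteq> 0}) borel (\<lambda>s. (s, path_jump x s))"

definition cut_levy :: "real \<Rightarrow> 'a::real_normed_vector measure \<Rightarrow> 'a measure" where
  "cut_levy \<epsilon> \<nu> = density \<nu> (indicator {x. \<epsilon> \<le> norm x})"

definition cut_jumps :: "real \<Rightarrow> (real \<times> 'a::real_normed_vector) measure \<Rightarrow> (real \<times> 'a) measure" where
  "cut_jumps \<epsilon> m = density m (indicator {p. \<epsilon> \<le> norm (snd p)})"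

definition cut_fun :: "real \<Rightarrow> ('a::real_normed_vector \<Rightarrow> real) \<Rightarrow> 'a \<Rightarrow> real" where
  "cut_fun \<epsilon> h = (\<lambda>x. h x * indicator {x. \<epsilon> \<le> norm x} x)"

definition poisson_random_measure ::
  "'w measure \<Rightarrow> ('w \<Rightarrow> 'e measure) \<Rightarrow> 'e measure \<Rightarrow> bool" where
  "poisson_random_measure M N \<Lambda> \<longleftrightarrow>
     (\<forall>\<omega>\<in>space M. sets (N \<omega>) = sets \<Lambda>) \<and>
     (\<forall>A\<in>sets \<Lambda>. (\<lambda>\<omega>. emeasure (N \<omega>) A) \<in> borel_measurable M) \<and>
     (\<forall>A\<in>sets \<Lambda>. emeasure \<Lambda> A < \<infinity> \<longrightarrow> (\<forall>k::nat.
        measure M {\<omega>\<in>space M. emeasure (N \<omega>) A = of_nat k} =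
          measure \<Lambda> A ^ k / fact k * exp (- measure \<Lambda> A))) \<and>
     (\<forall>(A :: nat \<Rightarrow> 'e set) k. range A \<subseteq> sets \<Lambda> \<longrightarrow> disjoint_family_on A {..<k} \<longrightarrow>
        prob_space.indep_vars M (\<lambda>_. borel) (\<lambda>i \<omega>. emeasure (N \<omega>) (A i)) {..<k})"

text \<open>The integral over (a,b] of u against m - ds k(dx), defined pathwise; meaningful
  when both integrals converge absolutely.\<close>

definition pathwise_compensated_integral ::
  "(real \<times> 'a) measure \<Rightarrow> 'a measure \<Rightarrow> (real \<Rightarrow> 'a \<Rightarrow> 'b::euclidean_space) \<Rightarrow> real \<Rightarrow> real \<Rightarrow> 'b"
where
  "pathwise_compensated_integral m k u a b =
     (LINT p:{a<..b} \<times> UNIV|m. u (fst p) (snd p)) -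
     (LINT p:{a<..b} \<times> UNIV|(lborel \<Otimes>\<^sub>M k). u (fst p) (snd p))"

text \<open>Z is (a version of) the stochastic integral of the predictable field U over (a,b]
  against the compensated random measure m - ds k(dx): the L2 limit, as \<epsilon> = 1/(j+1) tends to 0,
  of the integrals over the jumps of size at least \<epsilon>. These are pathwise
  integrals, as a path has finitely many such jumps and k gives them finite mass; the limit exists
  by the isometry whenever U is square integrable for P(d\<omega>) ds k(dx).\<close>

definition has_compensated_integral ::
  "'w measure \<Rightarrow> ('w \<Rightarrow> (real \<times> 'a::euclidean_space) measure) \<Rightarrow> 'a measure \<Rightarrow>
   (real \<Rightarrow> 'w \<Rightarrow> 'a \<Rightarrow> 'b::euclidean_space) \<Rightarrow> real \<Rightarrow> real \<Rightarrow> ('w \<Rightarrow> 'b) \<Rightarrow> bool" where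
  "has_compensated_integral M m k U a b Z \<longleftrightarrow>
     Z \<in> borel_measurable M \<and>
     (\<lambda>j::nat. let \<epsilon> = 1 / real (Suc j) in
        \<integral>\<^sup>+ \<omega>. ennreal ((norm (Z \<omega> - pathwise_compensated_integral
           (cut_jumps \<epsilon> (m \<omega>)) (cut_levy \<epsilon> k) (\<lambda>s. U s \<omega>) a b))\<^sup>2) \<partial>M)
       \<longlonglongrightarrow> 0"

section \<open>The Levy process and its truncations\<close>

definition levy_measure :: "'a::euclidean_space measure \<Rightarrow> bool" where
  "levy_measure \<nu> \<longleftrightarrow> sets \<nu> = sets borel \<and> emeasure \<nu> {0} = 0 \<and>
     (\<integral>\<^sup>+ x. ennreal (min 1 ((norm x)\<^sup>2)) \<partial>\<nu>) < \<infinity>"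

definition levy_process ::
  "'w measure \<Rightarrow> real \<Rightarrow> (real \<Rightarrow> 'w \<Rightarrow> 'a::euclidean_space) \<Rightarrow> bool" where
  "levy_process M T X \<longleftrightarrow>
     (\<forall>t\<in>{0..T}. X t \<in> borel_measurable M) \<and>
     (AE \<omega> in M. X 0 \<omega> = 0) \<and>
     (\<forall>\<omega>\<in>space M. cadlag T (\<lambda>t. X t \<omega>)) \<and>
     (\<forall>(t :: nat \<Rightarrow> real) k. t ` {..k} \<subseteq> {0..T} \<longrightarrow> strict_mono_on {..k} t \<longrightarrow>
        prob_space.indep_vars M (\<lambda>_. borel) (\<lambda>i \<omega>. X (t (Suc i)) \<omega> - X (t i) \<omega>) {..<k}) \<and>
     (\<forall>s t. 0 \<le> s \<longrightarrow> s \<le> t \<longrightarrow> t \<le> T \<longrightarrow>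
        distr M borel (\<lambda>\<omega>. X t \<omega> - X s \<omega>) = distr M borel (X (t - s)))"

definition jumps_of ::
  "real \<Rightarrow> (real \<Rightarrow> 'w \<Rightarrow> 'a::real_normed_vector) \<Rightarrow> 'w \<Rightarrow> (real \<times> 'a) measure" where
  "jumps_of T X \<omega> = jump_measure T (\<lambda>t. X t \<omega>)"

text \<open>X is a pure-jump square-integrable Levy martingale on [0,T] with triplet (0,0,\<nu>).\<close>

definition levy_setting ::
  "'w measure \<Rightarrow> real \<Rightarrow> (real \<Rightarrow> 'w \<Rightarrow> 'a::euclidean_space) \<Rightarrow> 'a measure \<Rightarrow> bool" where
  "levy_setting M T X \<nu> \<longleftrightarrow>
     prob_space M \<and> complete_measure M \<and> levy_process M T X \<and> levy_measure \<nu> \<and>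
     (\<integral>\<^sup>+ x\<in>{x. 1 \<le> norm x}. ennreal ((norm x)\<^sup>2) \<partial>\<nu>) < \<infinity> \<and>
     poisson_random_measure M (jumps_of T X) (time_measure T \<Otimes>\<^sub>M \<nu>) \<and>
     (\<forall>t\<in>{0..T}. has_compensated_integral M (jumps_of T X) \<nu> (\<lambda>s \<omega> x. x) 0 t (X t))"

definition levy_filtration ::
  "'w measure \<Rightarrow> real \<Rightarrow> (real \<Rightarrow> 'w \<Rightarrow> 'a::euclidean_space) \<Rightarrow> real \<Rightarrow> 'w measure" where
  "levy_filtration M T X = usual_augmentation M T (natural_filtration M X)"

definition truncated_levy ::
  "real \<Rightarrow> (real \<Rightarrow> 'w \<Rightarrow> 'a::euclidean_space) \<Rightarrow> 'a measure \<Rightarrow> nat \<Rightarrow> real \<Rightarrow> 'w \<Rightarrow> 'a" where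
  "truncated_levy T X \<nu> n t \<omega> = pathwise_compensated_integral
     (cut_jumps (1 / real n) (jumps_of T X \<omega>)) (cut_levy (1 / real n) \<nu>) (\<lambda>s x. x) 0 t"

definition blumenthal_getoor :: "'a::euclidean_space measure \<Rightarrow> real" where
  "blumenthal_getoor \<nu> =
     Inf {\<beta>. 0 < \<beta> \<and> (\<integral>\<^sup>+ x\<in>{x. norm x \<le> 1}. ennreal (norm x powr \<beta>) \<partial>\<nu>) < \<infinity>}"

section \<open>BSDEs\<close>

text \<open>The driver F of the BSDE is only ever evaluated at square-integrable functions, up to
  a null set of (t,\<omega>). Integrability of the driver is required explicitly, as the
  integral of a non-integrable function is 0 by convention. Since Y is cadlag, the identity for
  each t almost surely is the same as the identity almost surely for all t.\<close>

definition bsde_solution ::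
  "'w measure \<Rightarrow> real \<Rightarrow> (real \<Rightarrow> 'w measure) \<Rightarrow> ('w \<Rightarrow> (real \<times> 'a::euclidean_space) measure) \<Rightarrow>
   'a measure \<Rightarrow> (real \<Rightarrow> real \<Rightarrow> ('a \<Rightarrow> real) \<Rightarrow> real) \<Rightarrow> ('w \<Rightarrow> real) \<Rightarrow>
   (real \<Rightarrow> 'w \<Rightarrow> real) \<Rightarrow> (real \<Rightarrow> 'w \<Rightarrow> 'a \<Rightarrow> real) \<Rightarrow> bool" where
  "bsde_solution M T \<F> m k F \<xi> Y U \<longleftrightarrow>
     (\<forall>\<omega>\<in>space M. cadlag T (\<lambda>t. Y t \<omega>)) \<and>
     (\<forall>t\<in>{0..T}. Y t \<in> borel_measurable (\<F> t)) \<and>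
     (\<integral>\<^sup>+ \<omega>. (SUP t\<in>{0..T}. ennreal (\<bar>Y t \<omega>\<bar>\<^sup>2)) \<partial>M) < \<infinity> \<and>
     predictable_field M T \<F> U \<and>
     (\<integral>\<^sup>+ \<omega>. (\<integral>\<^sup>+ t\<in>{0..T}. (\<integral>\<^sup>+ x. ennreal (\<bar>U t \<omega> x\<bar>\<^sup>2) \<partial>k) \<partial>lborel) \<partial>M) < \<infinity> \<and>
     (AE \<omega> in M. set_integrable lborel {0..T} (\<lambda>s. F s (Y s \<omega>) (U s \<omega>))) \<and>
     (\<forall>t\<in>{0..T}. \<exists>Z. has_compensated_integral M m k U t T Z \<and>
        (AE \<omega> in M. Y t \<omega> = \<xi> \<omega> + (LINT s:{t..T}|lborel. F s (Y s \<omega>) (U s \<omega>)) - Z \<omega>))"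

definition lipschitz_driver ::
  "real \<Rightarrow> 'a measure \<Rightarrow> real \<Rightarrow> (real \<Rightarrow> real \<Rightarrow> ('a \<Rightarrow> real) \<Rightarrow> real) \<Rightarrow> bool" where
  "lipschitz_driver T \<nu> Lf f \<longleftrightarrow>
     (\<forall>t\<in>{0..T}. \<forall>y y'. \<forall>z\<in>L2_space \<nu>. \<forall>z'\<in>L2_space \<nu>.
        \<bar>f t y z - f t y' z'\<bar> \<le> Lf * (\<bar>y - y'\<bar> + l2_dist \<nu> z z'))"

definition square_integrable_at_zero ::
  "real \<Rightarrow> (real \<Rightarrow> real \<Rightarrow> ('a \<Rightarrow> real) \<Rightarrow> real) \<Rightarrow> bool" where
  "square_integrable_at_zero T f \<longleftrightarrow>
     set_integrable lborel {0..T} (\<lambda>t. \<bar>f t 0 (\<lambda>_. 0)\<bar>\<^sup>2)"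

definition bsde ::
  "'w measure \<Rightarrow> real \<Rightarrow> (real \<Rightarrow> 'w \<Rightarrow> 'a::euclidean_space) \<Rightarrow> 'a measure \<Rightarrow>
   (real \<Rightarrow> real \<Rightarrow> ('a \<Rightarrow> real) \<Rightarrow> real) \<Rightarrow> ('w \<Rightarrow> real) \<Rightarrow>
   (real \<Rightarrow> 'w \<Rightarrow> real) \<Rightarrow> (real \<Rightarrow> 'w \<Rightarrow> 'a \<Rightarrow> real) \<Rightarrow> bool" where
  "bsde M T X \<nu> f \<xi> Y U \<longleftrightarrow>
     bsde_solution M T (levy_filtration M T X) (jumps_of T X) \<nu> f \<xi> Y U"

definition truncated_filtration ::
  "'w measure \<Rightarrow> real \<Rightarrow> (real \<Rightarrow> 'w \<Rightarrow> 'a::euclidean_space) \<Rightarrow> 'a measure \<Rightarrow> nat \<Rightarrow> real \<Rightarrow> 'w measure"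
where
  "truncated_filtration M T X \<nu> n = natural_filtration M (truncated_levy T X \<nu> n)"

definition truncated_bsde ::
  "'w measure \<Rightarrow> real \<Rightarrow> (real \<Rightarrow> 'w \<Rightarrow> 'a::euclidean_space) \<Rightarrow> 'a measure \<Rightarrow>
   (real \<Rightarrow> real \<Rightarrow> ('a \<Rightarrow> real) \<Rightarrow> real) \<Rightarrow> nat \<Rightarrow> ('w \<Rightarrow> real) \<Rightarrow>
   (real \<Rightarrow> 'w \<Rightarrow> real) \<Rightarrow> (real \<Rightarrow> 'w \<Rightarrow> 'a \<Rightarrow> real) \<Rightarrow> bool" where
  "truncated_bsde M T X \<nu> f n \<xi> Y U \<longleftrightarrow>
     bsde_solution M T (truncated_filtration M T X \<nu> n)
       (\<lambda>\<omega>. cut_jumps (1 / real n) (jumps_of T X \<omega>)) (cut_levy (1 / real n) \<nu>)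
       (\<lambda>t y h. f t y (cut_fun (1 / real n) h)) \<xi> Y U"

text \<open>C is a stability constant for (Lf, T): it serves every Levy process and every driver with
  Lipschitz constant Lf, so it depends on Lf and T only. The type arguments fix the sample
  space and the dimension, over which a formula of HOL cannot quantify.\<close>

definition stability_constant ::
  "'w itself \<Rightarrow> 'd::finite itself \<Rightarrow> real \<Rightarrow> real \<Rightarrow> real \<Rightarrow> bool" where
  "stability_constant TW TD Lf T C \<longleftrightarrow> 0 \<le> C \<and>
     (\<forall>(M :: 'w measure) (X :: real \<Rightarrow> 'w \<Rightarrow> real ^ 'd) \<nu> f n \<xi> \<xi>' Y U Y' U'.
        levy_setting M T X \<nu> \<longrightarrow>
        lipschitz_driver T \<nu> Lf f \<longrightarrow>
        square_integrable_at_zero T f \<longrightarrow>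
        1 \<le> n \<longrightarrow>
        \<xi> \<in> borel_measurable (levy_filtration M T X T) \<longrightarrow>
        integrable M (\<lambda>\<omega>. (\<xi> \<omega>)\<^sup>2) \<longrightarrow>
        \<xi>' \<in> borel_measurable (truncated_filtration M T X \<nu> n T) \<longrightarrow>
        integrable M (\<lambda>\<omega>. (\<xi>' \<omega>)\<^sup>2) \<longrightarrow>
        bsde M T X \<nu> f \<xi> Y U \<longrightarrow>
        truncated_bsde M T X \<nu> f n \<xi>' Y' U' \<longrightarrow>
        ennreal_sqrt (\<integral>\<^sup>+ \<omega>. (SUP t\<in>{0..T}. ennreal (\<bar>Y' t \<omega> - Y t \<omega>\<bar>\<^sup>2)) \<partial>M)
          \<le> ennreal C * ennreal_sqrt (\<integral>\<^sup>+ \<omega>. ennreal (\<bar>\<xi>' \<omega> - \<xi> \<omega>\<bar>\<^sup>2) \<partial>M) \<and>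
        ennreal_sqrt (\<integral>\<^sup>+ t\<in>{0..T}. (\<integral>\<^sup>+ x. (\<integral>\<^sup>+ \<omega>.
            ennreal (\<bar>cut_fun (1 / real n) (U' t \<omega>) x - U t \<omega> x\<bar>\<^sup>2) \<partial>M) \<partial>\<nu>) \<partial>lborel)
          \<le> ennreal C * ennreal_sqrt (\<integral>\<^sup>+ \<omega>. ennreal (\<bar>\<xi>' \<omega> - \<xi> \<omega>\<bar>\<^sup>2) \<partial>M))"

end

theory Submission
  imports Defs
begin

text \<open>The laws of the two solutions are coupled by their joint law, so both Wasserstein distances
  are at most the corresponding L2 distances of the random elements, which the stability constant
  bounds by Lg times the L2 distance of X(T) and X^n(T). The latter difference is the compensated
  integral of the jumps smaller than 1/n; by the isometry its second moment is at most T times the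
  integral of |x|^2 over |x| < 1/n, and there |x|^2 <= n^(b-2) |x|^b. A coupling of laws exists only
  when the path maps are measurable, which is the other half of the work: a path is the Skorokhod
  limit of its grid approximations, and a random field is an L2 limit of elementary fields.\<close>

section \<open>Measurability and couplings for Borel sets of a pseudometric\<close>

text \<open>Neither target sigma-algebra is shown to be generated by evaluations or by countably
  many balls, so measurability of the path maps is not tested on coordinates. Both are limits of
  maps whose preimages of open sets are measurable for elementary reasons: a grid path depends
  continuously on finitely many values of the process, and the section of an elementary field takes
  finitely many values. One limit lemma serves both; it tolerates a null set of divergence because
  the probability space is complete. Nor are the transport costs shown to be measurable on the
  product; one inequality of the change of variables is enough, and it holds for every nonnegative
  integrand. \<open>X T\<close> is not given as a pathwise integral, since the small jumps need not
  be summable, but only as a mean-square limit of truncations. So the isometry is applied to the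
  difference of two truncations. The Blumenthal-Getoor index is an infimum that need not be
  attained, hence the moment of order \<beta> is derived from a smaller exponent in the defining
  set.\<close>

lemma ennreal_sqrt_power2 [simp]: "(ennreal_sqrt x)\<^sup>2 = x"
proof (cases "x = \<top>")
  case False
  then obtain r where "x = ennreal r" "0 \<le> r" by (cases x) auto
  then show ?thesis by (simp add: ennreal_sqrt_def ennreal_power)
qed (simp add: ennreal_sqrt_def power2_eq_square)

lemma ennreal_sqrt_mono: "x \<le> y \<Longrightarrow> ennreal_sqrt x \<le> ennreal_sqrt y"
  by (cases x; cases y) (auto simp: ennreal_sqrt_def ennreal_leI top_unique)

lemma ennreal_sqrt_ennreal: "0 \<le> r \<Longrightarrow> ennreal_sqrt (ennreal r) = ennreal (sqrt r)"
  by (simp add: ennreal_sqrt_def)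

text \<open>Without measurability of \<open>g\<close> one inequality survives: the integral is a
  supremum over simple functions below \<open>g\<close>, and each of them pulls back along
  \<open>f\<close> to a function below the composition. It is applied to transport costs.\<close>

lemma nn_integral_distr_le:
  assumes f: "f \<in> measurable M N"
  shows "(\<integral>\<^sup>+ x. g x \<partial>distr M N f) \<le> (\<integral>\<^sup>+ x. g (f x) \<partial>M)"
  unfolding nn_integral_def[of "distr M N f"]
proof (rule SUP_least)
  fix s assume "s \<in> {s. simple_function (distr M N f) s \<and> s \<le> g}"
  then have s: "simple_function (distr M N f) s" and le: "s \<le> g" by auto
  have "integral\<^sup>S (distr M N f) s = (\<integral>\<^sup>+ x. s x \<partial>distr M N f)"
    using s by (rule nn_integral_eq_simple_integral[symmetric])
  also have "\<dots> = (\<integral>\<^sup>+ x. s (f x) \<partial>M)"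
    using f borel_measurable_simple_function[OF s] by (intro nn_integral_distr) auto
  also have "\<dots> \<le> (\<integral>\<^sup>+ x. g (f x) \<partial>M)"
    using le by (intro nn_integral_mono) (auto simp: le_fun_def)
  finally show "integral\<^sup>S (distr M N f) s \<le> (\<integral>\<^sup>+ x. g (f x) \<partial>M)" .
qed

lemma wasserstein_distr_le:
  assumes "prob_space M" and a: "a \<in> measurable M S" and b: "b \<in> measurable M S"
  shows "wasserstein \<rho> (distr M S a) (distr M S b) \<le>
    ennreal_sqrt (\<integral>\<^sup>+ \<omega>. (\<rho> (a \<omega>) (b \<omega>))\<^sup>2 \<partial>M)"
proof -
  define \<Gamma> where "\<Gamma> = distr M (S \<Otimes>\<^sub>M S) (\<lambda>\<omega>. (a \<omega>, b \<omega>))"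
  have m: "(\<lambda>\<omega>. (a \<omega>, b \<omega>)) \<in> measurable M (S \<Otimes>\<^sub>M S)" using a b by measurable
  have "distr \<Gamma> (distr M S a) fst = distr M S a"
    unfolding \<Gamma>_def by (subst distr_distr) (use m in \<open>auto simp: comp_def intro!: distr_cong\<close>)
  moreover have "distr \<Gamma> (distr M S b) snd = distr M S b"
    unfolding \<Gamma>_def by (subst distr_distr) (use m in \<open>auto simp: comp_def intro!: distr_cong\<close>)
  moreover have "sets \<Gamma> = sets (distr M S a \<Otimes>\<^sub>M distr M S b)"
    unfolding \<Gamma>_def sets_distr by (intro sets_pair_measure_cong) auto
  ultimately have "\<Gamma> \<in> couplings (distr M S a) (distr M S b)"
    using assms(1) m unfolding couplings_def \<Gamma>_def by (auto intro: prob_space.prob_space_distr)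
  then have "wasserstein \<rho> (distr M S a) (distr M S b) \<le>
      ennreal_sqrt (\<integral>\<^sup>+ p. (\<rho> (fst p) (snd p))\<^sup>2 \<partial>\<Gamma>)"
    unfolding wasserstein_def by (rule INF_lower)
  also have "\<dots> \<le> ennreal_sqrt (\<integral>\<^sup>+ \<omega>. (\<rho> (a \<omega>) (b \<omega>))\<^sup>2 \<partial>M)"
    unfolding \<Gamma>_def
    using nn_integral_distr_le[OF m, of "\<lambda>p. (\<rho> (fst p) (snd p))\<^sup>2"] by (intro ennreal_sqrt_mono) simp
  finally show ?thesis .
qed

definition dist_open :: "'s set \<Rightarrow> ('s \<Rightarrow> 's \<Rightarrow> real) \<Rightarrow> 's set \<Rightarrow> bool" where
  "dist_open S d V \<longleftrightarrow> V \<subseteq> S \<and> (\<forall>x\<in>V. \<exists>e>0. \<forall>y\<in>S. d x y < e \<longrightarrow> y \<in> V)"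

lemma space_borel_of_dist [simp]: "space (borel_of_dist S d) = S"
  unfolding borel_of_dist_def by (rule space_measure_of) auto

lemma sets_borel_of_dist: "sets (borel_of_dist S d) = sigma_sets S {V. dist_open S d V}"
  unfolding borel_of_dist_def dist_open_def by (rule sets_measure_of) auto

lemma measurable_borel_of_distI:
  assumes "\<And>\<omega>. \<omega> \<in> space M \<Longrightarrow> G \<omega> \<in> S"
    and "\<And>V. dist_open S d V \<Longrightarrow> G -` V \<inter> space M \<in> sets M"
  shows "G \<in> measurable M (borel_of_dist S d)"
  unfolding borel_of_dist_def
  using assms by (intro measurable_measure_of) (auto simp: dist_open_def)

text \<open>The preimage of an open set V is the limit inferior of the preimages of its inner
  neighbourhoods, those points with a ball of radius more than 1/(j+1) inside V.\<close>

lemma measurable_borel_of_dist_limit: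
  fixes d :: "'s \<Rightarrow> 's \<Rightarrow> real"
  assumes M: "complete_measure M"
    and tri: "\<And>x y z. x \<in> S \<Longrightarrow> y \<in> S \<Longrightarrow> z \<in> S \<Longrightarrow> d x z \<le> d x y + d y z"
    and sym: "\<And>x y. x \<in> S \<Longrightarrow> y \<in> S \<Longrightarrow> d x y = d y x"
    and refl: "\<And>x. x \<in> S \<Longrightarrow> d x x = 0"
    and F: "\<And>k. F k \<in> measurable M (borel_of_dist S d)"
    and G: "\<And>\<omega>. \<omega> \<in> space M \<Longrightarrow> G \<omega> \<in> S"
    and lim: "AE \<omega> in M. (\<lambda>k. d (F k \<omega>) (G \<omega>)) \<longlonglongrightarrow> 0"
  shows "G \<in> measurable M (borel_of_dist S d)"
proof (rule measurable_borel_of_distI[OF G])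
  interpret complete_measure M by fact
  fix V assume V: "dist_open S d V"
  define W where "W j = {x\<in>S. \<exists>e>1 / real (Suc j). \<forall>y\<in>S. d x y < e \<longrightarrow> y \<in> V}" for j :: nat
  have FS: "F k \<omega> \<in> S" if "\<omega> \<in> space M" for k \<omega>
    using measurable_space[OF F that] by simp
  have W: "dist_open S d (W j)" for j
    unfolding dist_open_def
  proof (intro conjI ballI)
    show "W j \<subseteq> S" by (auto simp: W_def)
    fix x assume "x \<in> W j"
    then obtain e where x: "x \<in> S" and e: "e > 1 / real (Suc j)" "\<And>y. y \<in> S \<Longrightarrow> d x y < e \<Longrightarrow> y \<in> V"
      by (auto simp: W_def)
    \<comment> \<open>Half of the excess of \<open>e\<close> over 1/(j+1) can be given away: the
      ball around \<open>y\<close> of radius \<open>e - d x y\<close> lies in the ball around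
      \<open>x\<close>, and its radius still exceeds 1/(j+1).\<close>
    show "\<exists>r>0. \<forall>y\<in>S. d x y < r \<longrightarrow> y \<in> W j"
    proof (intro exI[of _ "(e - 1 / real (Suc j)) / 2"] conjI ballI impI)
      show "0 < (e - 1 / real (Suc j)) / 2" using e(1) by simp
      fix y assume y: "y \<in> S" "d x y < (e - 1 / real (Suc j)) / 2"
      have "z \<in> V" if "z \<in> S" "d y z < e - d x y" for z
        using e(2)[OF that(1)] tri[OF x y(1) that(1)] that(2) by linarith
      moreover have "e - d x y > 1 / real (Suc j)" using y(2) e(1) by argo
      ultimately show "y \<in> W j" using y(1) by (auto simp: W_def)
    qed
  qed
  have meas: "F k -` W j \<inter> space M \<in> sets M" for k j
    using F W by (intro measurable_sets[OF F]) (auto simp: sets_borel_of_dist)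
  define B where "B = (\<Union>j. \<Union>K. \<Inter>k\<in>{K..}. F k -` W j \<inter> space M)"
  have "(\<Inter>k\<in>{K..}. F k -` W j \<inter> space M) \<in> sets M" for j K
    using meas by (intro sets.countable_INT') (auto simp: image_subset_iff)
  then have "(\<Union>K. \<Inter>k\<in>{K..}. F k -` W j \<inter> space M) \<in> sets M" for j
    by (intro sets.countable_UN) blast
  then have B: "B \<in> sets M" unfolding B_def by (intro sets.countable_UN) blast
  have iff: "G \<omega> \<in> V \<longleftrightarrow> \<omega> \<in> B" if \<omega>: "\<omega> \<in> space M" and l: "(\<lambda>k. d (F k \<omega>) (G \<omega>)) \<longlonglongrightarrow> 0" for \<omega>
  proof
    assume "G \<omega> \<in> V"
    then obtain e where e: "e > 0" "\<And>y. y \<in> S \<Longrightarrow> d (G \<omega>) y < e \<Longrightarrow> y \<in> V"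
      using V unfolding dist_open_def by meson
    \<comment> \<open>With 1/(j+1) below e/2, an approximant within e/2 of the limit keeps a ball of
      radius e/2 inside \<open>V\<close>, hence lies in \<open>W j\<close>.\<close>
    obtain j where j: "1 / real (Suc j) < e / 2" using nat_approx_posE[of "e / 2"] e(1) by auto
    have "eventually (\<lambda>k. d (F k \<omega>) (G \<omega>) < e / 2) sequentially"
      using e(1) l by (intro order_tendstoD(2)) auto
    then obtain K where K: "\<And>k. k \<ge> K \<Longrightarrow> d (F k \<omega>) (G \<omega>) < e / 2"
      unfolding eventually_sequentially by blast
    have "F k \<omega> \<in> W j" if "k \<ge> K" for k
    proof -
      have "y \<in> V" if y: "y \<in> S" "d (F k \<omega>) y < e / 2" for y
        using e(2)[OF y(1)] tri[OF G[OF \<omega>] FS[OF \<omega>, of k] y(1)] y(2) K[OF \<open>k \<ge> K\<close>]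
          sym[OF G[OF \<omega>] FS[OF \<omega>, of k]] by linarith
      then show ?thesis using j FS[OF \<omega>, of k] unfolding W_def by blast
    qed
    then show "\<omega> \<in> B" using \<omega> by (auto simp: B_def)
  next
    assume "\<omega> \<in> B"
    then obtain j K where K: "\<And>k. k \<ge> K \<Longrightarrow> F k \<omega> \<in> W j" by (auto simp: B_def)
    have "eventually (\<lambda>k. d (F k \<omega>) (G \<omega>) < 1 / real (Suc j)) sequentially"
      using l by (intro order_tendstoD(2)) auto
    then have "eventually (\<lambda>k. k \<ge> K \<and> d (F k \<omega>) (G \<omega>) < 1 / real (Suc j)) sequentially"
      using eventually_ge_at_top[of K] by eventually_elim auto
    then obtain k where "k \<ge> K" "d (F k \<omega>) (G \<omega>) < 1 / real (Suc j)"
      using eventually_happens[of _ sequentially] by auto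
    moreover obtain e where "e > 1 / real (Suc j)" "\<forall>y\<in>S. d (F k \<omega>) y < e \<longrightarrow> y \<in> V"
      using K[OF \<open>k \<ge> K\<close>] unfolding W_def by blast
    ultimately show "G \<omega> \<in> V" using G[OF \<omega>] by fastforce
  qed
  \<comment> \<open>Convergence is only almost sure, so the preimage of \<open>V\<close> agrees with
    \<open>B\<close> up to a null set; completeness of \<open>M\<close> makes the preimage itself
    measurable.\<close>
  show "G -` V \<inter> space M \<in> sets M"
  proof (rule in_sets_AE[OF _ B])
    show "AE \<omega> in M. \<omega> \<in> B \<longleftrightarrow> \<omega> \<in> G -` V \<inter> space M"
      using lim AE_space by eventually_elim (simp add: iff)
  qed auto
qed

section \<open>Poisson random measures\<close>

text \<open>The recursion \<open>step\<close> reduces each factorial moment to the one of lower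
  order, and (k - l)^2 = k(k - 1) + (1 - 2l) k + l^2 turns the first two into the variance.\<close>

lemma poisson_weights_sums:
  fixes l :: real
  defines "p \<equiv> \<lambda>k::nat. l ^ k / fact k * exp (- l)"
  shows "p sums 1" "(\<lambda>k. real k * p k) sums l" "(\<lambda>k. (real k - l)\<^sup>2 * p k) sums l"
proof -
  have "(\<lambda>k. l ^ k /\<^sub>R fact k * exp (- l)) sums (exp l * exp (- l))"
    by (intro sums_mult2 exp_converges)
  then show p: "p sums 1"
    by (simp add: p_def divide_inverse mult.commute mult_exp_exp)
  have step: "real (Suc k) * p (Suc k) = l * p k" for k
    by (simp add: p_def del: of_nat_Suc)
  have "(\<lambda>k. real (Suc k) * p (Suc k)) sums (l * 1)"
    unfolding step using p by (rule sums_mult)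
  then show m1: "(\<lambda>k. real k * p k) sums l"
    using sums_Suc[of "\<lambda>k. real k * p k" l] by simp
  have "(\<lambda>k. real (Suc k) * (real (Suc k) - 1) * p (Suc k)) = (\<lambda>k. l * (real k * p k))"
    using step by (auto simp: fun_eq_iff mult_ac)
  then have "(\<lambda>k. real (Suc k) * (real (Suc k) - 1) * p (Suc k)) sums (l * l)"
    using sums_mult[OF m1, of l] by simp
  then have m2: "(\<lambda>k. real k * (real k - 1) * p k) sums (l * l)"
    using sums_Suc[of "\<lambda>k. real k * (real k - 1) * p k" "l * l"] by simp
  have "(\<lambda>k. real k * (real k - 1) * p k + (1 - 2 * l) * (real k * p k) + l\<^sup>2 * p k)
      sums (l * l + (1 - 2 * l) * l + l\<^sup>2 * 1)"
    by (intro sums_add sums_mult m2 m1 p)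
  moreover have "real k * (real k - 1) * p k + (1 - 2 * l) * (real k * p k) + l\<^sup>2 * p k
      = (real k - l)\<^sup>2 * p k" for k
    by (simp add: power2_eq_square algebra_simps)
  ultimately show "(\<lambda>k. (real k - l)\<^sup>2 * p k) sums l"
    by (simp add: power2_eq_square algebra_simps)
qed

locale poisson_measure = prob_space M for M :: "'w measure" +
  fixes N :: "'w \<Rightarrow> 'e measure" and \<Lambda> :: "'e measure"
  assumes poisson: "poisson_random_measure M N \<Lambda>"
begin

lemma sets_N: "\<omega> \<in> space M \<Longrightarrow> sets (N \<omega>) = sets \<Lambda>"
  using poisson by (simp add: poisson_random_measure_def)

lemma space_N: "\<omega> \<in> space M \<Longrightarrow> space (N \<omega>) = space \<Lambda>"
  using sets_N by (rule sets_eq_imp_space_eq)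

lemma measurable_N: "\<omega> \<in> space M \<Longrightarrow> borel_measurable (N \<omega>) = borel_measurable \<Lambda>"
  by (intro measurable_cong_sets sets_N refl)

lemma emeasure_N [measurable]: "A \<in> sets \<Lambda> \<Longrightarrow> (\<lambda>\<omega>. emeasure (N \<omega>) A) \<in> borel_measurable M"
  using poisson by (simp add: poisson_random_measure_def)

lemma measure_N [measurable]: "A \<in> sets \<Lambda> \<Longrightarrow> (\<lambda>\<omega>. measure (N \<omega>) A) \<in> borel_measurable M"
  unfolding measure_def by measurable

section \<open>Moments of Poisson counts\<close>

context
  fixes A assumes A: "A \<in> sets \<Lambda>" "emeasure \<Lambda> A < \<infinity>"
begin

text \<open>The Poisson weights sum to one, so the events that the count equals k leave no
  probability for an infinite or non-integral count.\<close>

lemma AE_N_nat: "AE \<omega> in M. \<exists>k::nat. emeasure (N \<omega>) A = of_nat k"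
proof -
  define P where "P k = {\<omega>\<in>space M. emeasure (N \<omega>) A = of_nat k}" for k :: nat
  have P: "range P \<subseteq> sets M" using A(1) by (auto simp: P_def)
  have "disjoint_family P" by (auto simp: disjoint_family_on_def P_def)
  then have "(\<lambda>k. measure M (P k)) sums measure M (\<Union>k. P k)"
    using P by (intro finite_measure_UNION)
  moreover have "measure M (P k) = measure \<Lambda> A ^ k / fact k * exp (- measure \<Lambda> A)" for k
    using poisson A unfolding P_def poisson_random_measure_def by blast
  ultimately have "measure M (\<Union>k. P k) = 1"
    using poisson_weights_sums(1)[of "measure \<Lambda> A"] by (simp add: sums_unique2)
  moreover have "(\<Union>k. P k) \<in> sets M" using P by blast
  ultimately have "AE \<omega> in M. \<omega> \<in> (\<Union>k. P k)" by (simp add: prob_eq_1)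
  then show ?thesis by eventually_elim (auto simp: P_def)
qed

lemma AE_N_finite: "AE \<omega> in M. emeasure (N \<omega>) A < \<infinity>"
  using AE_N_nat by eventually_elim (auto simp: ennreal_of_nat_eq_real_of_nat)

text \<open>Splitting along the events that the count is k, which have total probability one, turns
  the expectation into a Poisson series. Nonnegativity of \<open>h\<close> justifies exchanging sum
  and integral before integrability is known.\<close>

lemma nn_integral_N:
  fixes h :: "real \<Rightarrow> real"
  assumes h: "\<And>x. 0 \<le> h x" and [measurable]: "h \<in> borel_measurable borel"
    and s: "(\<lambda>k. h (real k) * (measure \<Lambda> A ^ k / fact k * exp (- measure \<Lambda> A))) sums c"
  shows "(\<integral>\<^sup>+ \<omega>. ennreal (h (measure (N \<omega>) A)) \<partial>M) = ennreal c"
proof -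
  define p where "p k = measure \<Lambda> A ^ k / fact k * exp (- measure \<Lambda> A)" for k :: nat
  define P where "P k = {\<omega>\<in>space M. emeasure (N \<omega>) A = of_nat k}" for k :: nat
  have P [measurable]: "P k \<in> sets M" for k using A(1) by (auto simp: P_def)
  have "measure M (P k) = p k" for k
    using poisson A unfolding P_def p_def poisson_random_measure_def by blast
  then have em: "emeasure M (P k) = ennreal (p k)" for k by (simp add: emeasure_eq_measure)
  have "(\<integral>\<^sup>+ \<omega>. ennreal (h (measure (N \<omega>) A)) \<partial>M)
      = (\<integral>\<^sup>+ \<omega>. (\<Sum>k. ennreal (h (real k)) * indicator (P k) \<omega>) \<partial>M)"
  proof (rule nn_integral_cong_AE)
    show "AE \<omega> in M. ennreal (h (measure (N \<omega>) A)) = (\<Sum>k. ennreal (h (real k)) * indicator (P k) \<omega>)"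
      using AE_N_nat AE_space
    proof eventually_elim
      case (elim \<omega>)
      then obtain k :: nat where k: "emeasure (N \<omega>) A = of_nat k" by blast
      have "(\<Sum>j. ennreal (h (real j)) * indicator (P j) \<omega>)
          = (\<Sum>j\<in>{k}. ennreal (h (real j)) * indicator (P j) \<omega>)"
        using k by (intro suminf_finite) (auto simp: P_def indicator_def)
      then show ?case using k elim
        by (simp add: P_def measure_def ennreal_of_nat_eq_real_of_nat)
    qed
  qed
  also have "\<dots> = (\<Sum>k. ennreal (h (real k) * p k))"
    by (subst nn_integral_suminf) (auto simp: nn_integral_cmult em ennreal_mult'[OF h])
  also have "\<dots> = ennreal c"
    using s unfolding p_def[symmetric]
    by (intro suminf_ennreal_eq) (auto simp: h p_def)
  finally show ?thesis .
qed

lemma nn_integral_emeasure_N: "(\<integral>\<^sup>+ \<omega>. emeasure (N \<omega>) A \<partial>M) = emeasure \<Lambda> A"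
proof -
  have "(\<integral>\<^sup>+ \<omega>. emeasure (N \<omega>) A \<partial>M) = (\<integral>\<^sup>+ \<omega>. ennreal \<bar>measure (N \<omega>) A\<bar> \<partial>M)"
  proof (rule nn_integral_cong_AE)
    show "AE \<omega> in M. emeasure (N \<omega>) A = ennreal \<bar>measure (N \<omega>) A\<bar>"
      using AE_N_finite by eventually_elim (simp add: emeasure_eq_ennreal_measure)
  qed
  \<comment> \<open>The absolute value is the identity on measures, but makes the test function
    nonnegative on the whole line, as \<open>nn_integral_N\<close> asks.\<close>
  also have "\<dots> = ennreal (measure \<Lambda> A)"
    using poisson_weights_sums(2) by (intro nn_integral_N) auto
  also have "\<dots> = emeasure \<Lambda> A" using A by (simp add: emeasure_eq_ennreal_measure)
  finally show ?thesis .
qed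

lemma N_second_moment:
  shows "integrable M (\<lambda>\<omega>. (measure (N \<omega>) A - measure \<Lambda> A)\<^sup>2)"
    and "expectation (\<lambda>\<omega>. (measure (N \<omega>) A - measure \<Lambda> A)\<^sup>2) = measure \<Lambda> A"
proof -
  have *: "(\<integral>\<^sup>+ \<omega>. ennreal ((measure (N \<omega>) A - measure \<Lambda> A)\<^sup>2) \<partial>M) = ennreal (measure \<Lambda> A)"
    using poisson_weights_sums(3) by (intro nn_integral_N) auto
  show int: "integrable M (\<lambda>\<omega>. (measure (N \<omega>) A - measure \<Lambda> A)\<^sup>2)"
    using A(1) * by (intro integrableI_nonneg) auto
  show "expectation (\<lambda>\<omega>. (measure (N \<omega>) A - measure \<Lambda> A)\<^sup>2) = measure \<Lambda> A"
    using * A(1) by (subst integral_eq_nn_integral) auto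
qed

lemma N_first_moment:
  shows "integrable M (\<lambda>\<omega>. measure (N \<omega>) A - measure \<Lambda> A)"
    and "expectation (\<lambda>\<omega>. measure (N \<omega>) A - measure \<Lambda> A) = 0"
proof -
  have *: "(\<integral>\<^sup>+ \<omega>. ennreal \<bar>measure (N \<omega>) A\<bar> \<partial>M) = ennreal (measure \<Lambda> A)"
    using poisson_weights_sums(2) by (intro nn_integral_N) auto
  then have int: "integrable M (\<lambda>\<omega>. measure (N \<omega>) A)"
    using A(1) by (intro integrableI_nonneg) auto
  then show "integrable M (\<lambda>\<omega>. measure (N \<omega>) A - measure \<Lambda> A)" by simp
  have "expectation (\<lambda>\<omega>. measure (N \<omega>) A) = measure \<Lambda> A"
    using * A(1) by (subst integral_eq_nn_integral) auto
  then show "expectation (\<lambda>\<omega>. measure (N \<omega>) A - measure \<Lambda> A) = 0"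
    using int by (simp add: prob_space)
qed

end

text \<open>Centred counts of disjoint sets are independent, so the mixed products have mean zero
  and only the variances remain, which for Poisson counts equal the intensities.\<close>

lemma expectation_simple_square:
  fixes A :: "nat \<Rightarrow> 'e set" and c :: "nat \<Rightarrow> real"
  assumes A: "\<And>i. i < k \<Longrightarrow> A i \<in> sets \<Lambda>" "\<And>i. i < k \<Longrightarrow> emeasure \<Lambda> (A i) < \<infinity>"
    and disj: "disjoint_family_on A {..<k}"
  shows "integrable M (\<lambda>\<omega>. (\<Sum>i<k. c i * (measure (N \<omega>) (A i) - measure \<Lambda> (A i)))\<^sup>2)"
    and "expectation (\<lambda>\<omega>. (\<Sum>i<k. c i * (measure (N \<omega>) (A i) - measure \<Lambda> (A i)))\<^sup>2)
      = (\<Sum>i<k. (c i)\<^sup>2 * measure \<Lambda> (A i))"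
proof -
  define X where "X i \<omega> = measure (N \<omega>) (A i) - measure \<Lambda> (A i)" for i \<omega>
  \<comment> \<open>\<open>poisson_random_measure\<close> speaks of sequences all of whose members
    are measurable, so \<open>A\<close> is continued by empty sets from index k on.\<close>
  define B where "B i = (if i < k then A i else {})" for i
  have B: "range B \<subseteq> sets \<Lambda>" "disjoint_family_on B {..<k}"
    using A(1) disj by (auto simp: B_def disjoint_family_on_def)
  have "\<forall>(A :: nat \<Rightarrow> 'e set) k. range A \<subseteq> sets \<Lambda> \<longrightarrow> disjoint_family_on A {..<k} \<longrightarrow>
      indep_vars (\<lambda>_. borel) (\<lambda>i \<omega>. emeasure (N \<omega>) (A i)) {..<k}"
    using poisson by (simp add: poisson_random_measure_def)
  from this[rule_format, OF B]
  have "indep_vars (\<lambda>_. borel) (\<lambda>i \<omega>. emeasure (N \<omega>) (B i)) {..<k}" .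
  moreover have "indep_vars (\<lambda>_. borel) (\<lambda>i \<omega>. emeasure (N \<omega>) (B i)) {..<k} \<longleftrightarrow>
      indep_vars (\<lambda>_. borel) (\<lambda>i \<omega>. emeasure (N \<omega>) (A i)) {..<k}"
    by (intro indep_vars_cong) (auto simp: B_def)
  ultimately have "indep_vars (\<lambda>_. borel) (\<lambda>i \<omega>. emeasure (N \<omega>) (A i)) {..<k}"
    by simp
  then have ind: "indep_vars (\<lambda>_. borel) X {..<k}"
    unfolding X_def measure_def
    by (rule indep_vars_compose2[where Y = "\<lambda>i x. enn2real x - enn2real (emeasure \<Lambda> (A i))"]) auto
  note m1 = N_first_moment[OF A, folded X_def] and m2 = N_second_moment[OF A, folded X_def]
  have XX: "integrable M (\<lambda>\<omega>. X i \<omega> * X j \<omega>) \<and>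
      expectation (\<lambda>\<omega>. X i \<omega> * X j \<omega>) = (if i = j then measure \<Lambda> (A i) else 0)"
    if "i < k" "j < k" for i j
  proof (cases "i = j")
    case True
    then show ?thesis using m2[OF that(1) that(1)] by (simp add: power2_eq_square)
  next
    case False
    have "indep_vars (\<lambda>_. borel) X {i, j}" using that by (intro indep_vars_subset[OF ind]) auto
    then show ?thesis
      using indep_vars_integrable[of "{i, j}" X] indep_vars_lebesgue_integral[of "{i, j}" X]
        m1 that False by auto
  qed
  have sq: "(\<Sum>i<k. c i * X i \<omega>)\<^sup>2 = (\<Sum>i<k. \<Sum>j<k. (c i * c j) * (X i \<omega> * X j \<omega>))" for \<omega>
    by (simp add: power2_eq_square sum_product mult_ac)
  show "integrable M (\<lambda>\<omega>. (\<Sum>i<k. c i * (measure (N \<omega>) (A i) - measure \<Lambda> (A i)))\<^sup>2)"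
    unfolding X_def[symmetric] sq using XX
    by (intro Bochner_Integration.integrable_sum integrable_mult_right) auto
  have "expectation (\<lambda>\<omega>. (\<Sum>i<k. c i * X i \<omega>)\<^sup>2)
      = (\<Sum>i<k. \<Sum>j<k. (c i * c j) * expectation (\<lambda>\<omega>. X i \<omega> * X j \<omega>))"
    unfolding sq using XX
    by (subst Bochner_Integration.integral_sum, fastforce)
      (intro sum.cong refl, subst Bochner_Integration.integral_sum, auto)
  also have "\<dots> = (\<Sum>i<k. \<Sum>j<k. if i = j then (c i)\<^sup>2 * measure \<Lambda> (A i) else 0)"
    using XX by (intro sum.cong refl) (auto simp: power2_eq_square)
  also have "\<dots> = (\<Sum>i<k. (c i)\<^sup>2 * measure \<Lambda> (A i))"
    by (intro sum.cong refl) simp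
  finally show "expectation (\<lambda>\<omega>. (\<Sum>i<k. c i * (measure (N \<omega>) (A i) - measure \<Lambda> (A i)))\<^sup>2)
      = (\<Sum>i<k. (c i)\<^sup>2 * measure \<Lambda> (A i))"
    unfolding X_def .
qed


section \<open>Integration against a Poisson random measure\<close>

lemma measurable_nn_integral_N:
  assumes "u \<in> borel_measurable \<Lambda>"
  shows "(\<lambda>\<omega>. \<integral>\<^sup>+ p. u p \<partial>N \<omega>) \<in> borel_measurable M"
  using assms
proof (induction rule: borel_measurable_induct)
  case (cong f g)
  have "(\<integral>\<^sup>+ p. f p \<partial>N \<omega>) = (\<integral>\<^sup>+ p. g p \<partial>N \<omega>)" if "\<omega> \<in> space M" for \<omega>
    using cong(3) that by (intro nn_integral_cong) (simp add: space_N)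
  then show ?case using cong(4) by (simp cong: measurable_cong)
next
  case (set A)
  have "(\<integral>\<^sup>+ p. indicator A p \<partial>N \<omega>) = emeasure (N \<omega>) A" if "\<omega> \<in> space M" for \<omega>
    using set that by (simp add: sets_N)
  then show ?case using set by (simp cong: measurable_cong)
next
  case (mult u c)
  have "(\<integral>\<^sup>+ p. c * u p \<partial>N \<omega>) = c * (\<integral>\<^sup>+ p. u p \<partial>N \<omega>)" if "\<omega> \<in> space M" for \<omega>
    using mult that by (intro nn_integral_cmult) (simp add: measurable_N)
  then show ?case using mult by (simp cong: measurable_cong)
next
  case (add u v)
  have "(\<integral>\<^sup>+ p. v p + u p \<partial>N \<omega>) = (\<integral>\<^sup>+ p. v p \<partial>N \<omega>) + (\<integral>\<^sup>+ p. u p \<partial>N \<omega>)" if "\<omega> \<in> space M" for \<omega>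
    using add that by (intro nn_integral_add) (simp_all add: measurable_N)
  then show ?case using add by (simp cong: measurable_cong)
next
  case (seq U)
  have "(\<integral>\<^sup>+ p. (SUP i. U i) p \<partial>N \<omega>) = (SUP i. \<integral>\<^sup>+ p. U i p \<partial>N \<omega>)" if "\<omega> \<in> space M" for \<omega>
    using seq that unfolding SUP_apply
    by (intro nn_integral_monotone_convergence_SUP) (simp_all add: measurable_N)
  then show ?case using seq by (simp cong: measurable_cong)
qed

text \<open>For indicators this is the mean of a Poisson count; linearity and monotone limits do the
  rest. Finiteness of the integral travels through the induction because the distribution of the
  count is prescribed only for sets of finite intensity.\<close>

lemma campbell:
  assumes "u \<in> borel_measurable \<Lambda>" "(\<integral>\<^sup>+ p. u p \<partial>\<Lambda>) < \<infinity>"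
  shows "(\<integral>\<^sup>+ \<omega>. (\<integral>\<^sup>+ p. u p \<partial>N \<omega>) \<partial>M) = (\<integral>\<^sup>+ p. u p \<partial>\<Lambda>)"
  using assms
proof (induction rule: borel_measurable_induct)
  case (cong f g)
  have "(\<integral>\<^sup>+ p. f p \<partial>N \<omega>) = (\<integral>\<^sup>+ p. g p \<partial>N \<omega>)" if "\<omega> \<in> space M" for \<omega>
    using cong(3) that by (intro nn_integral_cong) (simp add: space_N)
  moreover have "(\<integral>\<^sup>+ p. f p \<partial>\<Lambda>) = (\<integral>\<^sup>+ p. g p \<partial>\<Lambda>)"
    using cong(3) by (rule nn_integral_cong)
  ultimately show ?case using cong(4,5) by (simp cong: nn_integral_cong)
next
  case (set A)
  have "(\<integral>\<^sup>+ p. indicator A p \<partial>N \<omega>) = emeasure (N \<omega>) A" if "\<omega> \<in> space M" for \<omega>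
    using set that by (simp add: sets_N)
  then show ?case using set by (simp add: nn_integral_emeasure_N cong: nn_integral_cong)
next
  case (mult u c)
  have "(\<integral>\<^sup>+ p. c * u p \<partial>N \<omega>) = c * (\<integral>\<^sup>+ p. u p \<partial>N \<omega>)" if "\<omega> \<in> space M" for \<omega>
    using mult that by (intro nn_integral_cmult) (simp add: measurable_N)
  \<comment> \<open>A finite integral of \<open>c * u\<close> says nothing about \<open>u\<close>
    when c = 0, so this case is separated before the induction hypothesis is used.\<close>
  moreover have "c = 0 \<or> (\<integral>\<^sup>+ p. u p \<partial>\<Lambda>) < \<infinity>"
    using mult by (auto simp: nn_integral_cmult ennreal_mult_less_top)
  ultimately show ?case using mult
    by (auto simp: nn_integral_cmult measurable_nn_integral_N cong: nn_integral_cong)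
next
  case (add u v)
  have "(\<integral>\<^sup>+ p. v p + u p \<partial>N \<omega>) = (\<integral>\<^sup>+ p. v p \<partial>N \<omega>) + (\<integral>\<^sup>+ p. u p \<partial>N \<omega>)" if "\<omega> \<in> space M" for \<omega>
    using add that by (intro nn_integral_add) (simp_all add: measurable_N)
  moreover have "(\<integral>\<^sup>+ p. u p \<partial>\<Lambda>) < \<infinity>" "(\<integral>\<^sup>+ p. v p \<partial>\<Lambda>) < \<infinity>"
    using add by (auto simp: nn_integral_add)
  ultimately show ?case using add
    by (simp add: nn_integral_add measurable_nn_integral_N cong: nn_integral_cong)
next
  case (seq U)
  have "(\<integral>\<^sup>+ p. (SUP i. U i) p \<partial>N \<omega>) = (SUP i. \<integral>\<^sup>+ p. U i p \<partial>N \<omega>)" if "\<omega> \<in> space M" for \<omega>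
    using seq that unfolding SUP_apply
    by (intro nn_integral_monotone_convergence_SUP) (simp_all add: measurable_N)
  then have "(\<integral>\<^sup>+ \<omega>. (\<integral>\<^sup>+ p. (SUP i. U i) p \<partial>N \<omega>) \<partial>M)
      = (\<integral>\<^sup>+ \<omega>. (SUP i. \<integral>\<^sup>+ p. U i p \<partial>N \<omega>) \<partial>M)"
    by (rule nn_integral_cong)
  also have "\<dots> = (SUP i. \<integral>\<^sup>+ \<omega>. (\<integral>\<^sup>+ p. U i p \<partial>N \<omega>) \<partial>M)"
    using seq by (intro nn_integral_monotone_convergence_SUP measurable_nn_integral_N)
      (auto simp: incseq_def le_fun_def intro!: nn_integral_mono)
  also have "\<dots> = (SUP i. \<integral>\<^sup>+ p. U i p \<partial>\<Lambda>)"
  proof (rule SUP_cong[OF refl])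
    fix i
    have "(\<integral>\<^sup>+ p. U i p \<partial>\<Lambda>) \<le> (\<integral>\<^sup>+ p. (SUP i. U i) p \<partial>\<Lambda>)"
      unfolding SUP_apply by (intro nn_integral_mono SUP_upper) simp
    then show "(\<integral>\<^sup>+ \<omega>. (\<integral>\<^sup>+ p. U i p \<partial>N \<omega>) \<partial>M) = (\<integral>\<^sup>+ p. U i p \<partial>\<Lambda>)"
      using seq.prems by (intro seq.IH) (auto intro: le_less_trans)
  qed
  also have "\<dots> = (\<integral>\<^sup>+ p. (SUP i. U i) p \<partial>\<Lambda>)"
    using seq unfolding SUP_apply by (intro nn_integral_monotone_convergence_SUP[symmetric]) auto
  finally show ?case .
qed

text \<open>Campbell's formula for the norm of \<open>\<phi>\<close>: a nonnegative variable with
  finite mean is finite almost surely.\<close>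

lemma AE_integrable_N:
  fixes \<phi> :: "'e \<Rightarrow> 'b :: {banach, second_countable_topology}"
  assumes "integrable \<Lambda> \<phi>"
  shows "AE \<omega> in M. integrable (N \<omega>) \<phi>"
proof -
  have [measurable]: "\<phi> \<in> borel_measurable \<Lambda>" using assms by simp
  have fin: "(\<integral>\<^sup>+ p. ennreal (norm (\<phi> p)) \<partial>\<Lambda>) < \<infinity>" using assms by (simp add: integrable_iff_bounded)
  have "(\<integral>\<^sup>+ \<omega>. (\<integral>\<^sup>+ p. ennreal (norm (\<phi> p)) \<partial>N \<omega>) \<partial>M) \<noteq> \<infinity>"
    using fin by (subst campbell) auto
  then have "AE \<omega> in M. (\<integral>\<^sup>+ p. ennreal (norm (\<phi> p)) \<partial>N \<omega>) \<noteq> \<infinity>"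
    by (intro nn_integral_noteq_infinite measurable_nn_integral_N) auto
  with AE_space show ?thesis
    by eventually_elim (auto simp: integrable_iff_bounded measurable_N top.not_eq_extremum)
qed

text \<open>The Bochner integral is 0 by convention where it does not converge, so the difference of
  positive and negative parts gives its coordinates only on the event \<open>D\<close>. This event
  is itself measurable, and off it the value is constant.\<close>

lemma measurable_integral_N:
  fixes \<phi> :: "'e \<Rightarrow> 'b :: euclidean_space"
  assumes [measurable]: "\<phi> \<in> borel_measurable \<Lambda>"
  shows "(\<lambda>\<omega>. \<integral>p. \<phi> p \<partial>N \<omega>) \<in> borel_measurable M"
proof -
  define D where "D \<omega> \<longleftrightarrow> (\<integral>\<^sup>+ p. ennreal (norm (\<phi> p)) \<partial>N \<omega>) < \<infinity>" for \<omega>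
  have D: "D \<omega> \<longleftrightarrow> integrable (N \<omega>) \<phi>" if "\<omega> \<in> space M" for \<omega>
    using that by (simp add: D_def integrable_iff_bounded measurable_N)
  note [measurable] = measurable_nn_integral_N
  have [measurable]: "Measurable.pred M D" unfolding D_def by measurable
  have "(\<lambda>\<omega>. (\<integral>p. \<phi> p \<partial>N \<omega>) \<bullet> b) \<in> borel_measurable M" for b :: 'b
  proof -
    have "(\<integral>p. \<phi> p \<partial>N \<omega>) \<bullet> b = (if D \<omega> then enn2real (\<integral>\<^sup>+ p. ennreal (\<phi> p \<bullet> b) \<partial>N \<omega>)
        - enn2real (\<integral>\<^sup>+ p. ennreal (- (\<phi> p \<bullet> b)) \<partial>N \<omega>) else 0)" if "\<omega> \<in> space M" for \<omega>
    proof (cases "D \<omega>")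
      case True
      then have "integrable (N \<omega>) \<phi>" using D[OF that] by simp
      then show ?thesis using True real_lebesgue_integral_def[of "N \<omega>" "\<lambda>p. \<phi> p \<bullet> b"] by simp
    next
      case False
      then show ?thesis using D[OF that] by (simp add: not_integrable_integral_eq)
    qed
    moreover have "(\<lambda>\<omega>. if D \<omega> then enn2real (\<integral>\<^sup>+ p. ennreal (\<phi> p \<bullet> b) \<partial>N \<omega>)
        - enn2real (\<integral>\<^sup>+ p. ennreal (- (\<phi> p \<bullet> b)) \<partial>N \<omega>) else 0) \<in> borel_measurable M"
      by measurable
    ultimately show ?thesis by (simp cong: measurable_cong)
  qed
  then show ?thesis by (subst borel_measurable_euclidean_space) auto
qed

text \<open>On the level sets of the nonzero values of \<open>s\<close> the compensated integral is
  a combination of centred counts, to which \<open>expectation_simple_square\<close> applies. The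
  level set of zero may have infinite intensity and is left out.\<close>

lemma simple_isometry:
  fixes s :: "'e \<Rightarrow> real"
  assumes s: "simple_function \<Lambda> s" "integrable \<Lambda> s"
  shows "(\<integral>\<^sup>+ \<omega>. ennreal (((\<integral>p. s p \<partial>N \<omega>) - (\<integral>p. s p \<partial>\<Lambda>))\<^sup>2) \<partial>M) = (\<integral>\<^sup>+ p. ennreal ((s p)\<^sup>2) \<partial>\<Lambda>)"
proof -
  have fin: "finite (s ` space \<Lambda> - {0})" using s(1) by (simp add: simple_function_def)
  obtain k :: nat and r where r: "bij_betw r {..<k} (s ` space \<Lambda> - {0})"
    using ex_bij_betw_nat_finite[OF fin] by (auto simp: atLeast0LessThan)
  have rinj: "inj_on r {..<k}" using r by (simp add: bij_betw_def)
  have r0: "r i \<noteq> 0" if "i < k" for i using bij_betwE[OF r] that by auto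
  define A where "A i = s -` {r i} \<inter> space \<Lambda>" for i
  have [measurable]: "A i \<in> sets \<Lambda>" for i
    using s(1) by (auto simp: A_def intro: simple_functionD)
  have A: "emeasure \<Lambda> (A i) < \<infinity>" if "i < k" for i
  proof -
    have "ennreal \<bar>r i\<bar> * emeasure \<Lambda> (A i) = (\<integral>\<^sup>+ p. ennreal \<bar>r i\<bar> * indicator (A i) p \<partial>\<Lambda>)"
      by (simp add: nn_integral_cmult_indicator)
    also have "\<dots> \<le> (\<integral>\<^sup>+ p. ennreal (norm (s p)) \<partial>\<Lambda>)"
      by (intro nn_integral_mono) (auto simp: A_def indicator_def)
    also have "\<dots> < \<infinity>" using s(2) by (simp add: integrable_iff_bounded)
    finally show ?thesis using r0[OF that] by (auto simp: ennreal_mult_less_top)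
  qed
  have disj: "disjoint_family_on A {..<k}"
    using rinj by (auto simp: disjoint_family_on_def A_def inj_on_def)
  \<comment> \<open>Stated for a general \<open>g\<close> vanishing at 0 because both
    \<open>s\<close> and its square are expanded over the same level sets.\<close>
  have rep: "g (s p) = (\<Sum>i<k. g (r i) * indicator (A i) p)" if g: "g 0 = 0" and p: "p \<in> space \<Lambda>" for g :: "real \<Rightarrow> real" and p
  proof (cases "s p = 0")
    case True
    then have "p \<notin> A i" if "i < k" for i using r0[OF that] by (auto simp: A_def)
    then show ?thesis using g True by simp
  next
    case False
    then have "s p \<in> r ` {..<k}" using r p by (auto simp: bij_betw_def)
    then obtain j where j: "j < k" "s p = r j" by auto
    have "(\<Sum>i<k. g (r i) * indicator (A i) p) = (\<Sum>i<k. if i = j then g (r j) else 0)"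
      using j p rinj by (intro sum.cong refl) (auto simp: A_def indicator_def inj_on_def)
    then show ?thesis using j by simp
  qed
  \<comment> \<open>\<open>K\<close> stands for \<open>\<Lambda>\<close> and for the random measure
    \<open>N \<omega>\<close>, so that both integrals become sums over the same sets.\<close>
  have int: "(\<integral>p. g (s p) \<partial>K) = (\<Sum>i<k. g (r i) * measure K (A i))"
    if K: "sets K = sets \<Lambda>" "\<And>i. i < k \<Longrightarrow> emeasure K (A i) < \<infinity>" and g: "g 0 = 0" for K and g :: "real \<Rightarrow> real"
  proof -
    have sp: "space K = space \<Lambda>" using K(1) by (rule sets_eq_imp_space_eq)
    have "(\<integral>p. g (s p) \<partial>K) = (\<integral>p. (\<Sum>i<k. g (r i) * indicator (A i) p) \<partial>K)"
      using rep[of g, OF g] sp by (intro Bochner_Integration.integral_cong) auto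
    also have "\<dots> = (\<Sum>i<k. \<integral>p. g (r i) * indicator (A i) p \<partial>K)"
      using K by (intro Bochner_Integration.integral_sum integrable_mult_right) (auto simp: integrable_indicator_iff)
    also have "\<dots> = (\<Sum>i<k. g (r i) * measure K (A i))"
      using sp sets.sets_into_space[of _ \<Lambda>] by (intro sum.cong refl) (simp add: A_def Int_absorb2)
    finally show ?thesis .
  qed
  have "AE \<omega> in M. \<forall>i\<in>{..<k}. emeasure (N \<omega>) (A i) < \<infinity>"
    using A by (intro AE_finite_allI AE_N_finite) auto
  then have "AE \<omega> in M. (\<integral>p. s p \<partial>N \<omega>) - (\<integral>p. s p \<partial>\<Lambda>) = (\<Sum>i<k. r i * (measure (N \<omega>) (A i) - measure \<Lambda> (A i)))"
    using AE_space
    by eventually_elim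
      (use int[of "\<Lambda>" "\<lambda>x. x"] int[of "N _" "\<lambda>x. x"] A in \<open>simp add: sets_N sum_subtractf right_diff_distrib\<close>)
  then have "(\<integral>\<^sup>+ \<omega>. ennreal (((\<integral>p. s p \<partial>N \<omega>) - (\<integral>p. s p \<partial>\<Lambda>))\<^sup>2) \<partial>M)
      = (\<integral>\<^sup>+ \<omega>. ennreal ((\<Sum>i<k. r i * (measure (N \<omega>) (A i) - measure \<Lambda> (A i)))\<^sup>2) \<partial>M)"
    by (intro nn_integral_cong_AE) (auto elim: eventually_mono)
  also have "\<dots> = ennreal (\<Sum>i<k. (r i)\<^sup>2 * measure \<Lambda> (A i))"
    using expectation_simple_square[OF _ A disj, of r] by (subst nn_integral_eq_integral) auto
  also have "\<dots> = ennreal (\<integral>p. (s p)\<^sup>2 \<partial>\<Lambda>)"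
    using int[of \<Lambda> "\<lambda>x. x\<^sup>2"] A by simp
  also have "\<dots> = (\<integral>\<^sup>+ p. ennreal ((s p)\<^sup>2) \<partial>\<Lambda>)"
  proof (rule nn_integral_eq_integral[symmetric])
    have "integrable \<Lambda> (\<lambda>p. \<Sum>i<k. (r i)\<^sup>2 * indicator (A i) p)"
      using A by (intro Bochner_Integration.integrable_sum integrable_mult_right) (auto simp: integrable_indicator_iff)
    then show "integrable \<Lambda> (\<lambda>p. (s p)\<^sup>2)"
      by (rule iffD2[OF Bochner_Integration.integrable_cong[OF refl], rotated]) (use rep[of "\<lambda>x. x\<^sup>2"] in simp)
  qed simp
  finally show ?thesis .
qed

text \<open>Only the upper bound of the isometry is needed, so Fatou's lemma suffices to pass from
  simple functions to the limit.\<close>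

lemma compensated_isometry_le:
  fixes \<phi> :: "'e \<Rightarrow> real"
  assumes \<phi>: "integrable \<Lambda> \<phi>" "integrable \<Lambda> (\<lambda>p. (\<phi> p)\<^sup>2)"
  shows "(\<integral>\<^sup>+ \<omega>. ennreal (((\<integral>p. \<phi> p \<partial>N \<omega>) - (\<integral>p. \<phi> p \<partial>\<Lambda>))\<^sup>2) \<partial>M) \<le> (\<integral>\<^sup>+ p. ennreal ((\<phi> p)\<^sup>2) \<partial>\<Lambda>)"
proof -
  have [measurable]: "\<phi> \<in> borel_measurable \<Lambda>" using \<phi>(1) by simp
  \<comment> \<open>The factor 2 comes from approximating by simple functions around the centre 0;
    it supplies the dominating functions, 2 |\<open>\<phi>\<close>| here and 4 times the square of
    \<open>\<phi>\<close> for the second moments.\<close>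
  obtain s where s: "\<And>i. simple_function \<Lambda> (s i)"
    and lim: "\<And>p. p \<in> space \<Lambda> \<Longrightarrow> (\<lambda>i. s i p) \<longlonglongrightarrow> \<phi> p"
    and bd: "\<And>i p. p \<in> space \<Lambda> \<Longrightarrow> \<bar>s i p\<bar> \<le> 2 * \<bar>\<phi> p\<bar>"
    using borel_measurable_implies_sequence_metric[of \<phi> \<Lambda> 0] by simp metis
  have [measurable]: "s i \<in> borel_measurable \<Lambda>" for i using s by (rule borel_measurable_simple_function)
  have int: "integrable \<Lambda> (s i)" for i
    by (rule Bochner_Integration.integrable_bound[OF integrable_mult_right[OF \<phi>(1), of 2]])
      (use bd[of _ i] in \<open>auto intro!: AE_I2 simp: abs_mult\<close>)
  define J where "J i \<omega> = (\<integral>p. s i p \<partial>N \<omega>) - (\<integral>p. s i p \<partial>\<Lambda>)" for i \<omega>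
  have [measurable]: "J i \<in> borel_measurable M" for i
    unfolding J_def by (intro borel_measurable_diff measurable_integral_N) auto
  have lim\<Lambda>: "(\<lambda>i. \<integral>p. s i p \<partial>\<Lambda>) \<longlonglongrightarrow> (\<integral>p. \<phi> p \<partial>\<Lambda>)"
    by (rule integral_dominated_convergence[where w="\<lambda>p. 2 * \<bar>\<phi> p\<bar>"])
      (use \<phi>(1) lim bd in \<open>auto intro!: AE_I2\<close>)
  have "AE \<omega> in M. (\<lambda>i. J i \<omega>) \<longlonglongrightarrow> (\<integral>p. \<phi> p \<partial>N \<omega>) - (\<integral>p. \<phi> p \<partial>\<Lambda>)"
    using AE_integrable_N[OF \<phi>(1)] AE_space
  proof eventually_elim
    case (elim \<omega>)
    have "(\<lambda>i. \<integral>p. s i p \<partial>N \<omega>) \<longlonglongrightarrow> (\<integral>p. \<phi> p \<partial>N \<omega>)"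
      by (rule integral_dominated_convergence[where w="\<lambda>p. 2 * \<bar>\<phi> p\<bar>"])
        (use elim lim bd in \<open>auto intro!: AE_I2 simp: measurable_N space_N\<close>)
    then show ?case unfolding J_def using lim\<Lambda> by (rule tendsto_diff)
  qed
  then have "AE \<omega> in M. ennreal (((\<integral>p. \<phi> p \<partial>N \<omega>) - (\<integral>p. \<phi> p \<partial>\<Lambda>))\<^sup>2) = liminf (\<lambda>i. ennreal ((J i \<omega>)\<^sup>2))"
    by eventually_elim (intro lim_imp_Liminf[symmetric] tendsto_ennrealI tendsto_power; simp)
  then have "(\<integral>\<^sup>+ \<omega>. ennreal (((\<integral>p. \<phi> p \<partial>N \<omega>) - (\<integral>p. \<phi> p \<partial>\<Lambda>))\<^sup>2) \<partial>M)
      = (\<integral>\<^sup>+ \<omega>. liminf (\<lambda>i. ennreal ((J i \<omega>)\<^sup>2)) \<partial>M)"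
    by (rule nn_integral_cong_AE)
  also have "\<dots> \<le> liminf (\<lambda>i. \<integral>\<^sup>+ \<omega>. ennreal ((J i \<omega>)\<^sup>2) \<partial>M)"
    by (intro nn_integral_liminf) auto
  also have "(\<lambda>i. \<integral>\<^sup>+ \<omega>. ennreal ((J i \<omega>)\<^sup>2) \<partial>M) = (\<lambda>i. \<integral>\<^sup>+ p. ennreal ((s i p)\<^sup>2) \<partial>\<Lambda>)"
    unfolding J_def using simple_isometry[OF s int] by auto
  also have "(\<lambda>i. \<integral>\<^sup>+ p. ennreal ((s i p)\<^sup>2) \<partial>\<Lambda>) \<longlonglongrightarrow> (\<integral>\<^sup>+ p. ennreal ((\<phi> p)\<^sup>2) \<partial>\<Lambda>)"
  proof (rule nn_integral_dominated_convergence[where w="\<lambda>p. ennreal (4 * (\<phi> p)\<^sup>2)"])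
    show "AE p in \<Lambda>. ennreal ((s i p)\<^sup>2) \<le> ennreal (4 * (\<phi> p)\<^sup>2)" for i
    proof (intro AE_I2 ennreal_leI)
      fix p assume "p \<in> space \<Lambda>"
      then have "\<bar>s i p\<bar>\<^sup>2 \<le> (2 * \<bar>\<phi> p\<bar>)\<^sup>2" using bd[of p i] by (intro power_mono) auto
      then show "(s i p)\<^sup>2 \<le> 4 * (\<phi> p)\<^sup>2" by (simp add: power_mult_distrib)
    qed
    show "(\<integral>\<^sup>+ p. ennreal (4 * (\<phi> p)\<^sup>2) \<partial>\<Lambda>) < \<infinity>"
      using \<phi>(2) by (subst nn_integral_eq_integral) auto
    show "AE p in \<Lambda>. (\<lambda>i. ennreal ((s i p)\<^sup>2)) \<longlonglongrightarrow> ennreal ((\<phi> p)\<^sup>2)"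
      using lim by (intro AE_I2 tendsto_ennrealI tendsto_power) auto
  qed auto
  then have "liminf (\<lambda>i. \<integral>\<^sup>+ p. ennreal ((s i p)\<^sup>2) \<partial>\<Lambda>) = (\<integral>\<^sup>+ p. ennreal ((\<phi> p)\<^sup>2) \<partial>\<Lambda>)"
    by (intro lim_imp_Liminf) auto
  finally show ?thesis .
qed

text \<open>The squared norm is the sum of the squared coordinates, so the scalar bound is summed
  over the basis.\<close>

lemma compensated_isometry_le_euclidean:
  fixes \<phi> :: "'e \<Rightarrow> 'b :: euclidean_space"
  assumes \<phi>: "integrable \<Lambda> \<phi>" "integrable \<Lambda> (\<lambda>p. (norm (\<phi> p))\<^sup>2)"
  shows "(\<integral>\<^sup>+ \<omega>. ennreal ((norm ((\<integral>p. \<phi> p \<partial>N \<omega>) - (\<integral>p. \<phi> p \<partial>\<Lambda>)))\<^sup>2) \<partial>M)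
    \<le> (\<integral>\<^sup>+ p. ennreal ((norm (\<phi> p))\<^sup>2) \<partial>\<Lambda>)"
proof -
  have [measurable]: "\<phi> \<in> borel_measurable \<Lambda>" using \<phi>(1) by simp
  have nsq: "(norm x)\<^sup>2 = (\<Sum>b\<in>Basis. (x \<bullet> b)\<^sup>2)" for x :: 'b
    by (subst power2_norm_eq_inner, subst euclidean_inner) (simp add: power2_eq_square)
  have i2: "integrable \<Lambda> (\<lambda>p. (\<phi> p \<bullet> b)\<^sup>2)" if "b \<in> Basis" for b
  proof (rule Bochner_Integration.integrable_bound[OF \<phi>(2)])
    show "AE p in \<Lambda>. norm ((\<phi> p \<bullet> b)\<^sup>2) \<le> norm ((norm (\<phi> p))\<^sup>2)"
      using Basis_le_norm[OF that] by (intro AE_I2) (auto simp: power2_le_iff_abs_le)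
  qed auto
  have "(\<integral>\<^sup>+ \<omega>. ennreal ((norm ((\<integral>p. \<phi> p \<partial>N \<omega>) - (\<integral>p. \<phi> p \<partial>\<Lambda>)))\<^sup>2) \<partial>M)
      = (\<integral>\<^sup>+ \<omega>. (\<Sum>b\<in>Basis. ennreal (((\<integral>p. \<phi> p \<bullet> b \<partial>N \<omega>) - (\<integral>p. \<phi> p \<bullet> b \<partial>\<Lambda>))\<^sup>2)) \<partial>M)"
  proof (rule nn_integral_cong_AE)
    show "AE \<omega> in M. ennreal ((norm ((\<integral>p. \<phi> p \<partial>N \<omega>) - (\<integral>p. \<phi> p \<partial>\<Lambda>)))\<^sup>2)
        = (\<Sum>b\<in>Basis. ennreal (((\<integral>p. \<phi> p \<bullet> b \<partial>N \<omega>) - (\<integral>p. \<phi> p \<bullet> b \<partial>\<Lambda>))\<^sup>2))"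
      using AE_integrable_N[OF \<phi>(1)] by eventually_elim (simp add: nsq \<phi>(1) inner_diff_left)
  qed
  also have "\<dots> = (\<Sum>b\<in>Basis. \<integral>\<^sup>+ \<omega>. ennreal (((\<integral>p. \<phi> p \<bullet> b \<partial>N \<omega>) - (\<integral>p. \<phi> p \<bullet> b \<partial>\<Lambda>))\<^sup>2) \<partial>M)"
    using measurable_integral_N[of "\<lambda>p. \<phi> p \<bullet> _"] by (intro nn_integral_sum) auto
  also have "\<dots> \<le> (\<Sum>b\<in>Basis. \<integral>\<^sup>+ p. ennreal ((\<phi> p \<bullet> b)\<^sup>2) \<partial>\<Lambda>)"
    using \<phi>(1) i2 by (intro sum_mono compensated_isometry_le) auto
  also have "\<dots> = (\<integral>\<^sup>+ p. ennreal ((norm (\<phi> p))\<^sup>2) \<partial>\<Lambda>)"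
    by (subst nn_integral_sum[symmetric]) (auto simp: nsq)
  finally show ?thesis .
qed

end

section \<open>The Skorokhod space\<close>

text \<open>The form in which cadlag paths enter the two bisection arguments below: on each side of
  \<open>c\<close>, within one common radius, the path is nearly constant. Left of \<open>c\<close>
  the constant is the left limit.\<close>

lemma cadlag_local:
  fixes x :: "real \<Rightarrow> real"
  assumes x: "cadlag T x" and c: "c \<in> {0..T}" and e: "0 < e"
  obtains d l where "0 < d" "\<And>t. 0 \<le> t \<Longrightarrow> c - d < t \<Longrightarrow> t < c \<Longrightarrow> \<bar>x t - l\<bar> < e"
    "\<And>t. c \<le> t \<Longrightarrow> t < c + d \<Longrightarrow> t \<le> T \<Longrightarrow> \<bar>x t - x c\<bar> < e"
proof -
  have "\<exists>d>0. \<exists>l. \<forall>t. 0 \<le> t \<longrightarrow> c - d < t \<longrightarrow> t < c \<longrightarrow> \<bar>x t - l\<bar> < e"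
  proof (cases "c = 0")
    case True
    \<comment> \<open>No admissible time lies to the left of 0, so radius and limit are arbitrary
      here.\<close>
    then show ?thesis by (intro exI[of _ 1]) auto
  next
    case False
    then have "c \<in> {0<..T}" using c by auto
    then obtain l where "(x \<longlongrightarrow> l) (at_left c)" using x unfolding cadlag_def by blast
    then have "eventually (\<lambda>t. \<bar>x t - l\<bar> < e) (at_left c)"
      using e by (simp add: tendsto_iff dist_real_def)
    then obtain b where "b < c" "\<And>t. b < t \<Longrightarrow> t < c \<Longrightarrow> \<bar>x t - l\<bar> < e"
      using eventually_at_left[of "c - 1" c] by auto
    then show ?thesis by (intro exI[of _ "c - b"]) auto
  qed
  then obtain d1 l where d1: "d1 > 0" "\<And>t. 0 \<le> t \<Longrightarrow> c - d1 < t \<Longrightarrow> t < c \<Longrightarrow> \<bar>x t - l\<bar> < e"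
    by blast
  have "\<exists>d>0. \<forall>t. c \<le> t \<longrightarrow> t < c + d \<longrightarrow> t \<le> T \<longrightarrow> \<bar>x t - x c\<bar> < e"
  proof (cases "c = T")
    case True
    then show ?thesis using e by (intro exI[of _ 1]) auto
  next
    case False
    then have "(x \<longlongrightarrow> x c) (at_right c)" using x c by (auto simp: cadlag_def)
    then have "eventually (\<lambda>t. \<bar>x t - x c\<bar> < e) (at_right c)"
      using e by (simp add: tendsto_iff dist_real_def)
    then obtain b where "b > c" "\<And>t. c < t \<Longrightarrow> t < b \<Longrightarrow> \<bar>x t - x c\<bar> < e"
      using eventually_at_right[of c "c + 1"] by auto
    then have "\<bar>x t - x c\<bar> < e" if "c \<le> t" "t < c + (b - c)" for t
      using e that by (cases "t = c") auto
    then show ?thesis using \<open>b > c\<close> by (intro exI[of _ "b - c"]) auto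
  qed
  then obtain d2 where d2: "d2 > 0" "\<And>t. c \<le> t \<Longrightarrow> t < c + d2 \<Longrightarrow> t \<le> T \<Longrightarrow> \<bar>x t - x c\<bar> < e"
    by blast
  show thesis
    by (rule that[of "min d1 d2" l]) (use d1 d2 in auto)
qed

text \<open>By bisection: bounds on adjacent intervals combine, and near each point the path stays
  within 1 of its value there or of its left limit. The intervals of \<open>Bolzano\<close> may
  leave [0,T]; the premises inside \<open>P\<close> make the claim void for those.\<close>

lemma cadlag_bounded:
  fixes x :: "real \<Rightarrow> real"
  assumes x: "cadlag T x" and T: "0 \<le> T"
  obtains B where "\<And>t. t \<in> {0..T} \<Longrightarrow> \<bar>x t\<bar> \<le> B"
proof -
  define P where "P a b \<longleftrightarrow> (0 \<le> a \<longrightarrow> b \<le> T \<longrightarrow> (\<exists>B. \<forall>t\<in>{a..b}. \<bar>x t\<bar> \<le> B))" for a b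
  from T have "P 0 T"
  proof (induction rule: Bolzano)
    case (trans a b c)
    show ?case unfolding P_def
    proof (intro impI)
      assume "0 \<le> a" "c \<le> T"
      then obtain B B' where "\<forall>t\<in>{a..b}. \<bar>x t\<bar> \<le> B" "\<forall>t\<in>{b..c}. \<bar>x t\<bar> \<le> B'"
        using trans by (auto simp: P_def)
      then have "\<forall>t\<in>{a..c}. \<bar>x t\<bar> \<le> max B B'"
        by (metis atLeastAtMost_iff le_cases max.coboundedI1 max.coboundedI2)
      then show "\<exists>B. \<forall>t\<in>{a..c}. \<bar>x t\<bar> \<le> B" by blast
    qed
  next
    case (local c)
    then obtain d l where d: "0 < d" "\<And>t. 0 \<le> t \<Longrightarrow> c - d < t \<Longrightarrow> t < c \<Longrightarrow> \<bar>x t - l\<bar> < 1"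
      "\<And>t. c \<le> t \<Longrightarrow> t < c + d \<Longrightarrow> t \<le> T \<Longrightarrow> \<bar>x t - x c\<bar> < 1"
      using cadlag_local[OF x, of c 1] by auto
    show ?case
    proof (intro exI[of _ d] conjI allI impI)
      fix a b assume ab: "a \<le> c \<and> c \<le> b \<and> b - a < d"
      show "P a b" unfolding P_def
      proof (intro impI exI[of _ "max \<bar>l\<bar> \<bar>x c\<bar> + 1"] ballI)
        fix t assume t: "0 \<le> a" "b \<le> T" "t \<in> {a..b}"
        show "\<bar>x t\<bar> \<le> max \<bar>l\<bar> \<bar>x c\<bar> + 1"
        proof (cases "t < c")
          case True
          then show ?thesis using d(2)[of t] t ab by auto
        next
          case False
          then show ?thesis using d(3)[of t] t ab by auto
        qed
      qed
    qed (use d in auto)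
  qed
  then obtain B where "\<forall>t\<in>{0..T}. \<bar>x t\<bar> \<le> B" by (auto simp: P_def)
  then show thesis using that[of B] by blast
qed

lemma cadlag_restrict:
  assumes "cadlag T x"
  shows "cadlag T (restrict x {0..T})"
  unfolding cadlag_def
proof (intro conjI ballI)
  fix t assume t: "t \<in> {0..<T}"
  have *: "eventually (\<lambda>s. x s = restrict x {0..T} s) (at_right t)"
    using t by (subst eventually_at_right[of t T]) (auto intro!: exI[of _ T])
  have "(x \<longlongrightarrow> x t) (at_right t)" using assms t unfolding cadlag_def by blast
  from Lim_transform_eventually[OF this *]
  moreover have "restrict x {0..T} t = x t" using t by simp
  ultimately show "(restrict x {0..T} \<longlongrightarrow> restrict x {0..T} t) (at_right t)" by (simp only:)
next
  fix t assume t: "t \<in> {0<..T}"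
  have *: "eventually (\<lambda>s. x s = restrict x {0..T} s) (at_left t)"
    using t by (subst eventually_at_left[of 0 t]) (auto intro!: exI[of _ 0])
  obtain l where "(x \<longlongrightarrow> l) (at_left t)" using assms t unfolding cadlag_def by blast
  from Lim_transform_eventually[OF this *]
  show "\<exists>l. (restrict x {0..T} \<longlongrightarrow> l) (at_left t)" by blast
qed

text \<open>Keeps the witness apart from the infimum, so that symmetry and triangle inequality of
  the distance become inversion and composition of witnesses.\<close>

definition time_warp :: "real \<Rightarrow> (real \<Rightarrow> real) \<Rightarrow> (real \<Rightarrow> real) \<Rightarrow> real \<Rightarrow> (real \<Rightarrow> real) \<Rightarrow> bool" where
  "time_warp T x y e l \<longleftrightarrow> time_change T l \<and> (\<forall>t\<in>{0..T}. \<bar>l t - t\<bar> \<le> e \<and> \<bar>x t - y (l t)\<bar> \<le> e)"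

lemma skorokhod_dist_alt: "skorokhod_dist T x y = Inf {e. 0 < e \<and> (\<exists>l. time_warp T x y e l)}"
  by (simp add: skorokhod_dist_def time_warp_def)

lemma skorokhod_dist_le:
  assumes "0 < e" "time_warp T x y e l"
  shows "skorokhod_dist T x y \<le> e"
  unfolding skorokhod_dist_alt using assms by (intro cInf_lower) (auto intro!: bdd_belowI[of _ 0])

lemma time_change_ident: "time_change T (\<lambda>t. t)"
  by (auto simp: time_change_def strict_mono_on_def)

section \<open>The Skorokhod distance as a pseudometric on cadlag paths\<close>

context
  fixes T :: real
  assumes T: "0 \<le> T"
begin

text \<open>An infimum of reals yields a witness only for a nonempty set. Cadlag paths are bounded,
  so the identity is an admissible time change for a large enough error.\<close>

lemma skorokhod_dist_lessD:
  assumes "x \<in> cadlag_paths T" "y \<in> cadlag_paths T" "skorokhod_dist T x y < r"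
  obtains e l where "0 < e" "e < r" "time_warp T x y e l"
proof -
  obtain B where B: "\<And>t. t \<in> {0..T} \<Longrightarrow> \<bar>x t\<bar> \<le> B"
    using assms(1) T cadlag_bounded[of T x] by (auto simp: cadlag_paths_def)
  obtain B' where B': "\<And>t. t \<in> {0..T} \<Longrightarrow> \<bar>y t\<bar> \<le> B'"
    using assms(2) T cadlag_bounded[of T y] by (auto simp: cadlag_paths_def)
  have "0 \<le> B" "0 \<le> B'" using B[of 0] B'[of 0] T by auto
  moreover have "\<bar>x t - y t\<bar> \<le> B + B' + 1" if "t \<in> {0..T}" for t
    using B[OF that] B'[OF that] by linarith
  ultimately have "time_warp T x y (B + B' + 1) (\<lambda>t. t)"
    by (auto simp: time_warp_def time_change_ident)
  then have "{e. 0 < e \<and> (\<exists>l. time_warp T x y e l)} \<noteq> {}"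
    using \<open>0 \<le> B\<close> \<open>0 \<le> B'\<close> by (auto intro!: exI[of _ "B + B' + 1"])
  then show thesis
    using cInf_lessD[of "{e. 0 < e \<and> (\<exists>l. time_warp T x y e l)}" r] assms(3) that
    by (auto simp: skorokhod_dist_alt)
qed

lemma skorokhod_dist_nonneg:
  assumes "x \<in> cadlag_paths T" "y \<in> cadlag_paths T"
  shows "0 \<le> skorokhod_dist T x y"
proof (rule ccontr)
  assume "\<not> ?thesis"
  then obtain e :: real where "0 < e" "e < 0" using skorokhod_dist_lessD[OF assms, of 0] by auto
  then show False by simp
qed

lemma skorokhod_dist_refl:
  assumes "x \<in> cadlag_paths T"
  shows "skorokhod_dist T x x = 0"
proof (rule antisym)
  show "skorokhod_dist T x x \<le> 0"
  proof (rule field_le_epsilon)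
    fix e :: real assume "0 < e"
    then show "skorokhod_dist T x x \<le> 0 + e"
      by (intro order.trans[OF skorokhod_dist_le[of e _ _ _ "\<lambda>t. t"]])
        (auto simp: time_warp_def time_change_ident)
  qed
qed (use skorokhod_dist_nonneg assms in auto)

lemma time_warp_sym:
  assumes "time_warp T x y e l"
  shows "time_warp T y x e (inv_into {0..T} l)"
proof -
  let ?k = "inv_into {0..T} l"
  have l: "strict_mono_on {0..T} l" "l ` {0..T} = {0..T}"
    using assms by (auto simp: time_warp_def time_change_def)
  have inj: "inj_on l {0..T}" using l(1) by (rule strict_mono_on_imp_inj_on)
  have k: "?k t \<in> {0..T}" "l (?k t) = t" if "t \<in> {0..T}" for t
    using that l(2) inv_into_into[of t l "{0..T}"] f_inv_into_f[of t l "{0..T}"] by auto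
  have "strict_mono_on {0..T} ?k"
  proof (rule strict_mono_onI)
    fix r s assume "r \<in> {0..T}" "s \<in> {0..T}" "r < s"
    moreover from this have "\<not> ?k s \<le> ?k r"
      using k[of r] k[of s] strict_mono_on_leD[OF l(1), of "?k s" "?k r"] by auto
    ultimately show "?k r < ?k s" by simp
  qed
  moreover have "?k ` {0..T} = {0..T}"
    using inv_into_image_cancel[OF inj, of "{0..T}"] l(2) by simp
  moreover have "\<bar>?k t - t\<bar> \<le> e" "\<bar>y t - x (?k t)\<bar> \<le> e" if "t \<in> {0..T}" for t
  proof -
    have "\<bar>l (?k t) - ?k t\<bar> \<le> e \<and> \<bar>x (?k t) - y (l (?k t))\<bar> \<le> e"
      using assms k(1)[OF that] unfolding time_warp_def by blast
    then show "\<bar>?k t - t\<bar> \<le> e" "\<bar>y t - x (?k t)\<bar> \<le> e"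
      using k(2)[OF that] by (auto simp: abs_minus_commute)
  qed
  ultimately show ?thesis unfolding time_warp_def time_change_def by blast
qed

lemma skorokhod_dist_sym: "skorokhod_dist T x y = skorokhod_dist T y x"
  unfolding skorokhod_dist_alt by (rule arg_cong[where f = Inf]) (use time_warp_sym in blast)

lemma time_warp_trans:
  assumes 1: "time_warp T x y e l" and 2: "time_warp T y z e' l'"
  shows "time_warp T x z (e + e') (\<lambda>t. l' (l t))"
proof -
  have l: "strict_mono_on {0..T} l" "l ` {0..T} = {0..T}"
    and l': "strict_mono_on {0..T} l'" "l' ` {0..T} = {0..T}"
    using assms by (auto simp: time_warp_def time_change_def)
  have lT: "l t \<in> {0..T}" if "t \<in> {0..T}" for t using l(2) that by blast
  have "strict_mono_on {0..T} (\<lambda>t. l' (l t))"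
    by (intro strict_mono_onI strict_mono_onD[OF l'(1)] strict_mono_onD[OF l(1)] lT)
  moreover have "(\<lambda>t. l' (l t)) ` {0..T} = {0..T}"
    using l(2) l'(2) by (simp flip: image_image)
  moreover have "\<bar>l' (l t) - t\<bar> \<le> e + e'" "\<bar>x t - z (l' (l t))\<bar> \<le> e + e'" if t: "t \<in> {0..T}" for t
  proof -
    have "\<bar>l t - t\<bar> \<le> e" "\<bar>x t - y (l t)\<bar> \<le> e" using 1 t by (auto simp: time_warp_def)
    moreover have "\<bar>l' (l t) - l t\<bar> \<le> e'" "\<bar>y (l t) - z (l' (l t))\<bar> \<le> e'"
      using 2 lT[OF t] unfolding time_warp_def by blast+
    ultimately show "\<bar>l' (l t) - t\<bar> \<le> e + e'" "\<bar>x t - z (l' (l t))\<bar> \<le> e + e'" by linarith+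
  qed
  ultimately show ?thesis unfolding time_warp_def time_change_def by blast
qed

lemma skorokhod_dist_triangle:
  assumes x: "x \<in> cadlag_paths T" and y: "y \<in> cadlag_paths T" and z: "z \<in> cadlag_paths T"
  shows "skorokhod_dist T x z \<le> skorokhod_dist T x y + skorokhod_dist T y z"
proof (rule field_le_epsilon)
  fix r :: real assume r: "0 < r"
  obtain e l where e: "0 < e" "e < skorokhod_dist T x y + r / 2" "time_warp T x y e l"
    using skorokhod_dist_lessD[OF x y, of "skorokhod_dist T x y + r / 2"] r by auto
  obtain e' l' where e': "0 < e'" "e' < skorokhod_dist T y z + r / 2" "time_warp T y z e' l'"
    using skorokhod_dist_lessD[OF y z, of "skorokhod_dist T y z + r / 2"] r by auto
  show "skorokhod_dist T x z \<le> skorokhod_dist T x y + skorokhod_dist T y z + r"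
    using skorokhod_dist_le[OF _ time_warp_trans[OF e(3) e'(3)]] e e' by linarith
qed

end

text \<open>The time changes below move c to this grid point, so that a jump of the path at c becomes
  a jump of its grid approximation.\<close>

definition grid_up :: "real \<Rightarrow> real \<Rightarrow> real" where
  "grid_up h c = h * of_int \<lceil>c / h\<rceil>"

section \<open>Time changes between a path and its grid approximation\<close>

lemma grid_up_bounds:
  assumes "0 < h"
  shows "c \<le> grid_up h c" "grid_up h c < c + h"
proof -
  have "c / h \<le> of_int \<lceil>c / h\<rceil>" "of_int \<lceil>c / h\<rceil> < c / h + 1" by linarith+
  then show "c \<le> grid_up h c" "grid_up h c < c + h"
    using assms mult_left_mono[of "c / h" "of_int \<lceil>c / h\<rceil>" h] by (auto simp: grid_up_def field_simps)
qed

text \<open>One piece of such a time change. Both endpoints go to grid points, so that adjacent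
  pieces fit together. The grid path at time \<open>l t\<close> carries the value of
  \<open>x\<close> at the last grid point up to \<open>l t\<close>, with which \<open>x t\<close> is
  compared; \<open>b\<close> is left out of the comparison because a jump there belongs to the next
  piece.\<close>

definition grid_change ::
  "real \<Rightarrow> (real \<Rightarrow> real) \<Rightarrow> real \<Rightarrow> real \<Rightarrow> real \<Rightarrow> (real \<Rightarrow> real) \<Rightarrow> bool" where
  "grid_change h x e a b l \<longleftrightarrow> strict_mono_on {a..b} l \<and> l ` {a..b} = {grid_up h a..grid_up h b} \<and>
     l a = grid_up h a \<and> l b = grid_up h b \<and> (\<forall>t\<in>{a..b}. \<bar>l t - t\<bar> \<le> h) \<and>
     (\<forall>t\<in>{a..<b}. \<bar>x t - x (h * of_int \<lfloor>l t / h\<rfloor>)\<bar> \<le> e)"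

text \<open>Both pieces send \<open>b\<close> to \<open>grid_up h b\<close>, so the glued map is
  strictly increasing across the seam and its image has no gap; the comparison intervals [a,b) and
  [b,c) join without overlap.\<close>

lemma grid_change_trans:
  assumes ab: "a \<le> b" "b \<le> c" and 1: "grid_change h x e a b l" and 2: "grid_change h x e b c l'"
  shows "grid_change h x e a c (\<lambda>t. if t < b then l t else l' t)" (is "grid_change h x e a c ?k")
proof -
  have l: "strict_mono_on {a..b} l" "l ` {a..b} = {grid_up h a..grid_up h b}"
     "l a = grid_up h a" "l b = grid_up h b" "\<And>t. t \<in> {a..b} \<Longrightarrow> \<bar>l t - t\<bar> \<le> h"
     "\<And>t. t\<in>{a..<b} \<Longrightarrow> \<bar>x t - x (h * of_int \<lfloor>l t / h\<rfloor>)\<bar> \<le> e"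
    using 1 by (auto simp: grid_change_def)
  have l': "strict_mono_on {b..c} l'" "l' ` {b..c} = {grid_up h b..grid_up h c}"
     "l' b = grid_up h b" "l' c = grid_up h c" "\<And>t. t \<in> {b..c} \<Longrightarrow> \<bar>l' t - t\<bar> \<le> h"
     "\<And>t. t\<in>{b..<c} \<Longrightarrow> \<bar>x t - x (h * of_int \<lfloor>l' t / h\<rfloor>)\<bar> \<le> e"
    using 2 by (auto simp: grid_change_def)
  have kl: "?k t = l t" if "t \<le> b" for t using that l(4) l'(3) by (cases "t = b") auto
  have kl': "?k t = l' t" if "b \<le> t" for t using that by auto
  have "strict_mono_on {a..c} ?k"
  proof (rule strict_mono_onI)
    fix r s assume rs: "r \<in> {a..c}" "s \<in> {a..c}" "r < s"
    consider "s \<le> b" | "b \<le> r" | "r < b" "b < s" by linarith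
    then show "?k r < ?k s"
    proof cases
      case 1
      then show ?thesis using strict_mono_onD[OF l(1), of r s] rs kl[of r] kl[of s] by auto
    next
      case 2
      then show ?thesis using strict_mono_onD[OF l'(1), of r s] rs by auto
    next
      case 3
      then show ?thesis
        using strict_mono_onD[OF l(1), of r b] strict_mono_onD[OF l'(1), of b s] rs l(4) l'(3) by auto
    qed
  qed
  moreover have "?k ` {a..c} = {grid_up h a..grid_up h c}"
  proof -
    have u: "grid_up h a \<le> grid_up h b" "grid_up h b \<le> grid_up h c"
      using l(3,4) l'(3,4) ab strict_mono_on_leD[OF l(1), of a b] strict_mono_on_leD[OF l'(1), of b c] by auto
    have "?k ` {a..c} = ?k ` {a..b} \<union> ?k ` {b..c}"
      unfolding image_Un[symmetric] using ab by (simp only: ivl_disj_un_two_touch)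
    also have "?k ` {a..b} = l ` {a..b}" by (intro image_cong refl kl) auto
    also have "?k ` {b..c} = l' ` {b..c}" by (intro image_cong refl kl') auto
    finally show ?thesis using u l(2) l'(2) by (simp add: ivl_disj_un_two_touch)
  qed
  moreover have "?k a = grid_up h a" "?k c = grid_up h c" using kl[of a] kl'[of c] ab l l' by auto
  ultimately show ?thesis
    unfolding grid_change_def using l(5,6) l'(5,6) by auto
qed

text \<open>Where the oscillation on [a,b) is at most \<open>e\<close>, an affine map suffices:
  \<open>l t\<close> lies between \<open>grid_up h a\<close> and, strictly,
  \<open>grid_up h b\<close>, and all grid points in that range belong to [a,b). The condition h < b
  - a keeps the two image endpoints distinct.\<close>

lemma grid_change_affine:
  assumes h: "0 < h" "h < b - a" and osc: "\<And>s t. s \<in> {a..<b} \<Longrightarrow> t \<in> {a..<b} \<Longrightarrow> \<bar>x s - x t\<bar> \<le> e"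
  shows "\<exists>l. grid_change h x e a b l"
proof -
  define u where "u = grid_up h"
  have ua: "a \<le> u a" "u a < a + h" and ub: "b \<le> u b" "u b < b + h"
    using grid_up_bounds[OF h(1)] by (auto simp: u_def)
  define q where "q = (u b - u a) / (b - a)"
  have q: "0 < q" "q * (b - a) = u b - u a" using h ua ub by (auto simp: q_def)
  define l where "l t = q * t + (u a - q * a)" for t
  have la: "l a = u a" by (simp add: l_def)
  have lb: "l b = u b" using q(2) by (simp add: l_def algebra_simps)
  have mono: "l s < l t \<longleftrightarrow> s < t" "l s \<le> l t \<longleftrightarrow> s \<le> t" for s t using q(1) by (auto simp: l_def)
  have "l ` {a..b} = {u a..u b}"
    using h q(1) la lb unfolding l_def by (subst image_affinity_atLeastAtMost) auto
  moreover have "strict_mono_on {a..b} l" by (rule strict_mono_onI) (simp add: mono)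
  moreover have "\<bar>l t - t\<bar> \<le> h" if t: "t \<in> {a..b}" for t
  proof -
    \<comment> \<open>The displacement at t is the average of the displacements at the endpoints,
      weighted by the position of t; both of these lie between 0 and h.\<close>
    have "(l t - t) * (b - a) = (b - t) * (u a - a) + (t - a) * (u b - b)"
    proof -
      have "l t * (b - a) = (t - a) * (q * (b - a)) + u a * (b - a)" by (simp add: l_def algebra_simps)
      then show ?thesis unfolding q(2) by (simp add: algebra_simps)
    qed
    moreover have "(b - t) * (u a - a) \<le> (b - t) * h" "(t - a) * (u b - b) \<le> (t - a) * h"
      "0 \<le> (b - t) * (u a - a)" "0 \<le> (t - a) * (u b - b)"
      using t ua ub by (auto intro!: mult_left_mono)
    ultimately have "0 \<le> (l t - t) * (b - a)" "(l t - t) * (b - a) \<le> h * (b - a)"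
      by (auto simp: algebra_simps)
    then show ?thesis using h by (auto simp: zero_le_mult_iff mult_le_cancel_right)
  qed
  moreover have "\<bar>x t - x (h * of_int \<lfloor>l t / h\<rfloor>)\<bar> \<le> e" if t: "t \<in> {a..<b}" for t
  proof (rule osc[OF t])
    have lt: "u a \<le> l t" "l t < u b" using t mono[of a t] mono[of t b] la lb by auto
    have "of_int \<lceil>a / h\<rceil> \<le> l t / h" using lt(1) h by (simp add: u_def grid_up_def field_simps)
    then have "\<lceil>a / h\<rceil> \<le> \<lfloor>l t / h\<rfloor>" by (simp add: le_floor_iff)
    then have 1: "a / h \<le> of_int \<lfloor>l t / h\<rfloor>" by linarith
    have "l t / h < of_int \<lceil>b / h\<rceil>" using lt(2) h by (simp add: u_def grid_up_def field_simps)
    then have "\<lfloor>l t / h\<rfloor> < \<lceil>b / h\<rceil>" by (simp add: floor_less_iff)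
    then have "of_int \<lfloor>l t / h\<rfloor> < b / h" by linarith
    with 1 show "h * of_int \<lfloor>l t / h\<rfloor> \<in> {a..<b}" using h by (simp add: field_simps)
  qed
  ultimately show ?thesis unfolding grid_change_def u_def[symmetric] using la lb by blast
qed

text \<open>Bisection: a short interval around c is cut at c, which puts a jump there on a
  breakpoint, and on either side the path stays within e/2 of a constant. The bound \<open>d\<close>
  on the mesh comes from the lengths of the pieces.\<close>

lemma cadlag_grid_change:
  fixes x :: "real \<Rightarrow> real"
  assumes x: "cadlag T x" and T: "0 \<le> T" and e: "0 < e"
  obtains d where "0 < d" "\<And>h. 0 < h \<Longrightarrow> h < d \<Longrightarrow> \<exists>l. grid_change h x e 0 T l"
proof -
  define P where "P a b \<longleftrightarrow> (0 \<le> a \<longrightarrow> b \<le> T \<longrightarrow>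
    (\<exists>d>0. \<forall>h. 0 < h \<longrightarrow> h < d \<longrightarrow> (\<exists>l. grid_change h x e a b l)))" for a b
  have trans: "P a c" if P: "P a b" "P b c" and ab: "a \<le> b" "b \<le> c" for a b c
    unfolding P_def
  proof (intro impI)
    assume "0 \<le> a" "c \<le> T"
    then obtain d d' where "0 < d" "\<And>h. 0 < h \<Longrightarrow> h < d \<Longrightarrow> \<exists>l. grid_change h x e a b l"
      "0 < d'" "\<And>h. 0 < h \<Longrightarrow> h < d' \<Longrightarrow> \<exists>l. grid_change h x e b c l"
      using P ab unfolding P_def by (meson order.trans)
    then show "\<exists>d>0. \<forall>h. 0 < h \<longrightarrow> h < d \<longrightarrow> (\<exists>l. grid_change h x e a c l)"
      using grid_change_trans[OF ab] by (intro exI[of _ "min d d'"]) (auto, blast)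
  qed
  have osc: "P a b" if "a \<le> b" "\<And>s t. 0 \<le> a \<Longrightarrow> b \<le> T \<Longrightarrow> s \<in> {a..<b} \<Longrightarrow> t \<in> {a..<b} \<Longrightarrow> \<bar>x s - x t\<bar> \<le> e" for a b
    unfolding P_def
  proof (intro impI)
    assume 0: "0 \<le> a" "b \<le> T"
    show "\<exists>d>0. \<forall>h. 0 < h \<longrightarrow> h < d \<longrightarrow> (\<exists>l. grid_change h x e a b l)"
    proof (cases "a = b")
      case True
      \<comment> \<open>For an interval of one point a constant map will do, and the half-open
        comparison interval is empty.\<close>
      have "grid_change h x e a b (\<lambda>_. grid_up h a)" if "0 < h" for h
        using grid_up_bounds[OF that, of b] True by (auto simp: grid_change_def strict_mono_on_def)
      then show ?thesis by (intro exI[of _ 1]) auto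
    next
      case False
      then show ?thesis using grid_change_affine[OF _ _ that(2)[OF 0]] that(1)
        by (intro exI[of _ "b - a"]) auto
    qed
  qed
  from T have "P 0 T"
  proof (induction rule: Bolzano)
    case (trans a b c)
    then show ?case using \<open>\<And>a b c. P a b \<Longrightarrow> P b c \<Longrightarrow> a \<le> b \<Longrightarrow> b \<le> c \<Longrightarrow> P a c\<close> by blast
  next
    case (local c)
    then obtain d l where d: "0 < d" "\<And>t. 0 \<le> t \<Longrightarrow> c - d < t \<Longrightarrow> t < c \<Longrightarrow> \<bar>x t - l\<bar> < e / 2"
      "\<And>t. c \<le> t \<Longrightarrow> t < c + d \<Longrightarrow> t \<le> T \<Longrightarrow> \<bar>x t - x c\<bar> < e / 2"
      using cadlag_local[OF x, of c "e / 2"] e by auto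
    show ?case
    proof (intro exI[of _ d] conjI allI impI)
      fix a b assume ab: "a \<le> c \<and> c \<le> b \<and> b - a < d"
      have "P a c"
      proof (rule osc)
        fix s t assume "0 \<le> a" "s \<in> {a..<c}" "t \<in> {a..<c}"
        then have "\<bar>x s - l\<bar> < e / 2" "\<bar>x t - l\<bar> < e / 2" using d(2)[of s] d(2)[of t] ab by auto
        then show "\<bar>x s - x t\<bar> \<le> e" by linarith
      qed (use ab in auto)
      moreover have "P c b"
      proof (rule osc)
        fix s t assume "b \<le> T" "s \<in> {c..<b}" "t \<in> {c..<b}"
        then have "\<bar>x s - x c\<bar> < e / 2" "\<bar>x t - x c\<bar> < e / 2" using d(3)[of s] d(3)[of t] ab by auto
        then show "\<bar>x s - x t\<bar> \<le> e" by linarith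
      qed (use ab in auto)
      ultimately show "P a b" using trans ab by blast
    qed (use d in auto)
  qed
  then show thesis using that T by (auto simp: P_def)
qed

text \<open>The entry \<open>v n\<close> is read only at t = T. The values are indexed by all
  natural numbers so that openness can be stated in the product topology.\<close>

definition grid_path :: "real \<Rightarrow> nat \<Rightarrow> (nat \<Rightarrow> real) \<Rightarrow> real \<Rightarrow> real" where
  "grid_path T n v = restrict (\<lambda>t. v (nat \<lfloor>real n * t / T\<rfloor>)) {0..T}"

lemma grid_path_cadlag:
  assumes T: "0 < T" and n: "0 < n"
  shows "grid_path T n v \<in> cadlag_paths T"
proof -
  let ?f = "\<lambda>t. real n * t / T"
  have "cadlag T (\<lambda>t. v (nat \<lfloor>?f t\<rfloor>))"
    unfolding cadlag_def
  proof (intro conjI ballI)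
    fix t assume "t \<in> {0..<T}"
    define b where "b = T * (of_int \<lfloor>?f t\<rfloor> + 1) / real n"
    have "?f t < of_int \<lfloor>?f t\<rfloor> + 1" by linarith
    then have tb: "t < b" using T n by (simp add: b_def field_simps)
    have "\<lfloor>?f s\<rfloor> = \<lfloor>?f t\<rfloor>" if "t < s" "s < b" for s
    proof (rule floor_unique)
      have "?f t \<le> ?f s" using that T n by (simp add: divide_right_mono)
      then show "of_int \<lfloor>?f t\<rfloor> \<le> ?f s" by linarith
      show "?f s < of_int \<lfloor>?f t\<rfloor> + 1" using that(2) T n by (simp add: b_def field_simps)
    qed
    then have "eventually (\<lambda>s. v (nat \<lfloor>?f s\<rfloor>) = v (nat \<lfloor>?f t\<rfloor>)) (at_right t)"
      using tb by (subst eventually_at_right[of t b]) (auto intro!: exI[of _ b])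
    then show "((\<lambda>t. v (nat \<lfloor>?f t\<rfloor>)) \<longlongrightarrow> v (nat \<lfloor>?f t\<rfloor>)) (at_right t)"
      by (rule tendsto_eventually)
  next
    fix t assume "t \<in> {0<..T}"
    \<comment> \<open>The grid point strictly before t. It is given by the ceiling minus one rather
      than the floor because t may itself be a grid point, where the left limit is the value of the
      preceding cell.\<close>
    define b where "b = T * (of_int \<lceil>?f t\<rceil> - 1) / real n"
    have "of_int \<lceil>?f t\<rceil> - 1 < ?f t" by linarith
    then have tb: "b < t" using T n by (simp add: b_def field_simps)
    have "\<lfloor>?f s\<rfloor> = \<lceil>?f t\<rceil> - 1" if "b < s" "s < t" for s
    proof (rule floor_unique)
      have "?f s < ?f t" using that T n by (simp add: divide_strict_right_mono)
      then show "?f s < of_int (\<lceil>?f t\<rceil> - 1) + 1" by linarith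
      show "of_int (\<lceil>?f t\<rceil> - 1) \<le> ?f s" using that(1) T n by (simp add: b_def field_simps)
    qed
    then have "eventually (\<lambda>s. v (nat \<lfloor>?f s\<rfloor>) = v (nat (\<lceil>?f t\<rceil> - 1))) (at_left t)"
      using tb by (subst eventually_at_left[of b t]) (auto intro!: exI[of _ b])
    then show "\<exists>l. ((\<lambda>t. v (nat \<lfloor>?f t\<rfloor>)) \<longlongrightarrow> l) (at_left t)"
      by (blast intro: tendsto_eventually)
  qed
  then show ?thesis unfolding grid_path_def cadlag_paths_def using cadlag_restrict by auto
qed

text \<open>Since 0 and T are grid points, the map from \<open>cadlag_grid_change\<close> takes
  [0,T] onto itself, and it moves times by at most the mesh. The minimum with T keeps the sampling
  times in [0,T] for every index.\<close>

lemma grid_path_tendsto: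
  fixes x :: "real \<Rightarrow> real"
  assumes x: "cadlag T x" and T: "0 < T"
  shows "(\<lambda>k. skorokhod_dist T (grid_path T (Suc k) (\<lambda>i. x (min T (real i * T / real (Suc k)))))
    (restrict x {0..T})) \<longlonglongrightarrow> 0"
proof (rule LIMSEQ_I)
  fix r :: real assume r: "0 < r"
  define e where "e = r / 2"
  have e: "0 < e" "e < r" using r by (auto simp: e_def)
  obtain d where d: "0 < d" "\<And>h. 0 < h \<Longrightarrow> h < d \<Longrightarrow> \<exists>l. grid_change h x e 0 T l"
    using cadlag_grid_change[OF x _ e(1)] T by auto
  \<comment> \<open>Makes the mesh smaller than \<open>d\<close>, for the time change to exist, and
    smaller than \<open>e\<close>, for its displacement to be admissible.\<close>
  obtain K where K: "T / min d e < real K" using reals_Archimedean2 by blast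
  have rx: "restrict x {0..T} \<in> cadlag_paths T" using x by (auto simp: cadlag_paths_def cadlag_restrict)
  show "\<exists>K. \<forall>k\<ge>K. norm (skorokhod_dist T (grid_path T (Suc k) (\<lambda>i. x (min T (real i * T / real (Suc k)))))
    (restrict x {0..T}) - 0) < r"
  proof (intro exI[of _ K] allI impI)
    fix k assume k: "K \<le> k"
    define n where "n = Suc k"
    define h where "h = T / real n"
    define y where "y = grid_path T n (\<lambda>i. x (min T (real i * T / real n)))"
    have n: "0 < n" by (simp add: n_def)
    have "T / min d e < real n" using K k by (simp add: n_def)
    then have "h < min d e" using e d(1) n unfolding h_def by (subst pos_divide_less_eq; subst (asm) pos_divide_less_eq) (auto simp: mult.commute)
    then have h: "0 < h" "h < d" "h \<le> e" using T n by (auto simp: h_def)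
    have y: "y t = x (h * of_int \<lfloor>t / h\<rfloor>)" if t: "t \<in> {0..T}" for t
    proof -
      have f: "real n * t / T = t / h" using T n by (simp add: h_def)
      have 0: "0 \<le> \<lfloor>t / h\<rfloor>" using t h by simp
      have "of_int \<lfloor>t / h\<rfloor> \<le> t / h" by linarith
      then have "h * of_int \<lfloor>t / h\<rfloor> \<le> T"
        using t h mult_left_mono[of "of_int \<lfloor>t / h\<rfloor>" "t / h" h] by simp
      then show ?thesis using t 0 by (simp add: y_def grid_path_def f h_def[symmetric] min_absorb2)
        (simp add: h_def field_simps)
    qed
    have u: "grid_up h 0 = 0" "grid_up h T = T" using T n by (auto simp: grid_up_def h_def)
    obtain l where l: "grid_change h x e 0 T l" using d(2) h by auto
    have "time_warp T (restrict x {0..T}) y e l"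
      unfolding time_warp_def
    proof (intro conjI ballI)
      show "time_change T l" using l u by (simp add: grid_change_def time_change_def)
      fix t assume t: "t \<in> {0..T}"
      have "\<bar>l t - t\<bar> \<le> h" using l t unfolding grid_change_def by blast
      then show "\<bar>l t - t\<bar> \<le> e" using h by linarith
      have "l ` {0..T} = {0..T}" using l u by (simp add: grid_change_def)
      then have lt: "l t \<in> {0..T}" using t by blast
      show "\<bar>restrict x {0..T} t - y (l t)\<bar> \<le> e"
      proof (cases "t = T")
        case True
        \<comment> \<open>The comparison in \<open>grid_change\<close> stops short of T; there both
          paths take the value \<open>x T\<close>, since T is the last grid point.\<close>
        then have "l t = T" using l u by (simp add: grid_change_def)
        then have "y (l t) = x T" using y[OF lt] T n by (simp add: h_def)
        then show ?thesis using True t e by simp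
      next
        case False
        then have "t \<in> {0..<T}" using t by auto
        then have "\<bar>x t - x (h * of_int \<lfloor>l t / h\<rfloor>)\<bar> \<le> e" using l unfolding grid_change_def by blast
        then show ?thesis using t y[OF lt] by simp
      qed
    qed
    then have "skorokhod_dist T (restrict x {0..T}) y \<le> e" by (rule skorokhod_dist_le[OF e(1)])
    moreover have "0 \<le> skorokhod_dist T (restrict x {0..T}) y"
      using T n rx grid_path_cadlag[OF T n] unfolding y_def by (intro skorokhod_dist_nonneg) auto
    ultimately show "norm (skorokhod_dist T (grid_path T (Suc k) (\<lambda>i. x (min T (real i * T / real (Suc k)))))
      (restrict x {0..T}) - 0) < r"
      using e T skorokhod_dist_sym[of T y "restrict x {0..T}"] by (simp add: y_def n_def)
  qed
qed

text \<open>A grid path reads only the coordinates 0 to n, and with the identity as time change the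
  Skorokhod distance is at most the uniform one. So small changes of finitely many coordinates stay
  inside \<open>V\<close>.\<close>

lemma open_grid_path:
  assumes T: "0 < T" and n: "0 < n" and V: "dist_open (cadlag_paths T) (skorokhod_dist T) V"
  shows "open {v. grid_path T n v \<in> V}"
proof (subst open_subopen, intro ballI)
  fix v assume "v \<in> {v. grid_path T n v \<in> V}"
  then obtain e where e: "0 < e"
    "\<And>y. y \<in> cadlag_paths T \<Longrightarrow> skorokhod_dist T (grid_path T n v) y < e \<Longrightarrow> y \<in> V"
    using V by (auto simp: dist_open_def)
  let ?W = "\<Inter>i\<in>{..n}. {w. \<bar>w i - v i\<bar> < e / 2}"
  have "open ?W"
    by (intro open_INT ballI open_Collect_less continuous_intros continuous_on_product_coordinates) auto
  moreover have "v \<in> ?W" using e by simp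
  moreover have "?W \<subseteq> {v. grid_path T n v \<in> V}"
  proof
    fix w assume w: "w \<in> ?W"
    have "\<bar>grid_path T n v t - grid_path T n w t\<bar> \<le> e / 2" if t: "t \<in> {0..T}" for t
    proof -
      have "real n * t / T \<le> real n" using t T n by (simp add: field_simps)
      then have "nat \<lfloor>real n * t / T\<rfloor> \<le> n" by linarith
      then have "\<bar>w (nat \<lfloor>real n * t / T\<rfloor>) - v (nat \<lfloor>real n * t / T\<rfloor>)\<bar> < e / 2" using w by blast
      then have "\<bar>v (nat \<lfloor>real n * t / T\<rfloor>) - w (nat \<lfloor>real n * t / T\<rfloor>)\<bar> \<le> e / 2" by linarith
      then show ?thesis using t by (simp add: grid_path_def)
    qed
    then have "time_warp T (grid_path T n v) (grid_path T n w) (e / 2) (\<lambda>t. t)"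
      using e by (auto simp: time_warp_def time_change_ident)
    then have "skorokhod_dist T (grid_path T n v) (grid_path T n w) \<le> e / 2"
      using e by (intro skorokhod_dist_le) auto
    then show "w \<in> {v. grid_path T n v \<in> V}"
      using e grid_path_cadlag[OF T n, of w] by auto
  qed
  ultimately show "\<exists>W. open W \<and> v \<in> W \<and> W \<subseteq> {v. grid_path T n v \<in> V}" by blast
qed

lemma measurable_path:
  fixes Y :: "real \<Rightarrow> 'w \<Rightarrow> real"
  assumes M: "complete_measure M" and T: "0 < T"
    and cad: "\<And>\<omega>. \<omega> \<in> space M \<Longrightarrow> cadlag T (\<lambda>t. Y t \<omega>)"
    and Y: "\<And>t. t \<in> {0..T} \<Longrightarrow> Y t \<in> borel_measurable M"
  shows "(\<lambda>\<omega>. restrict (\<lambda>t. Y t \<omega>) {0..T}) \<in> measurable M (skorokhod_borel T)"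
  unfolding skorokhod_borel_def
proof (rule measurable_borel_of_dist_limit[OF M])
  define F where "F k \<omega> = grid_path T (Suc k) (\<lambda>i. Y (min T (real i * T / real (Suc k))) \<omega>)" for k \<omega>
  show "F k \<in> measurable M (borel_of_dist (cadlag_paths T) (skorokhod_dist T))" for k
  proof (rule measurable_borel_of_distI)
    fix V assume V: "dist_open (cadlag_paths T) (skorokhod_dist T) V"
    \<comment> \<open>The sampled values form a random sequence for the product Borel sets, and
      \<open>open_grid_path\<close> makes the preimage of \<open>V\<close> one of its
      events.\<close>
    have "(\<lambda>\<omega> i. Y (min T (real i * T / real (Suc k))) \<omega>) \<in> borel_measurable M"
      using T by (intro measurable_coordinatewise_then_product Y) auto
    from measurable_sets[OF this borel_open[OF open_grid_path[OF T _ V, of "Suc k"]]]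
    show "F k -` V \<inter> space M \<in> sets M" by (simp add: F_def vimage_def)
  qed (use T in \<open>auto simp: F_def intro!: grid_path_cadlag\<close>)
  show "AE \<omega> in M. (\<lambda>k. skorokhod_dist T (F k \<omega>) (restrict (\<lambda>t. Y t \<omega>) {0..T})) \<longlonglongrightarrow> 0"
    unfolding F_def using cad T by (intro AE_I2 grid_path_tendsto) auto
  show "restrict (\<lambda>t. Y t \<omega>) {0..T} \<in> cadlag_paths T" if "\<omega> \<in> space M" for \<omega>
    using cad[OF that] by (auto simp: cadlag_paths_def cadlag_restrict)
qed (use T skorokhod_dist_triangle skorokhod_dist_sym skorokhod_dist_refl in auto)

section \<open>Random elements of L2\<close>

lemma L2_spaceD:
  assumes "h \<in> L2_space N"
  shows "h \<in> borel_measurable N" "integrable N (\<lambda>x. (h x)\<^sup>2)"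
  using assms by (auto simp: L2_space_def)

lemma power2_add_le: "(a + b)\<^sup>2 \<le> 2 * a\<^sup>2 + 2 * (b :: real)\<^sup>2"
  using sum_squares_bound[of a b] by (simp add: power2_sum)

lemma power2_diff_le: "(a - b)\<^sup>2 \<le> 2 * a\<^sup>2 + 2 * (b :: real)\<^sup>2"
  using power2_add_le[of a "- b"] by simp

lemma L2_space_diff:
  assumes h: "h \<in> L2_space N" and g: "g \<in> L2_space N"
  shows "(\<lambda>x. h x - g x) \<in> L2_space N"
proof -
  note [measurable] = L2_spaceD(1)[OF h] L2_spaceD(1)[OF g]
  have "integrable N (\<lambda>x. 2 * (h x)\<^sup>2 + 2 * (g x)\<^sup>2)"
    using L2_spaceD(2)[OF h] L2_spaceD(2)[OF g] by simp
  then have "integrable N (\<lambda>x. (h x - g x)\<^sup>2)"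
    by (rule Bochner_Integration.integrable_bound) (auto intro!: AE_I2 power2_diff_le)
  then show ?thesis by (simp add: L2_space_def)
qed

text \<open>The weighted inequality (a+b)^2 <= (1+t) a^2 + (1+1/t) b^2, with the weight t close to
  the ratio of the norms of b and a.\<close>

lemma sqrt_integral_add_le:
  fixes a b :: "'e \<Rightarrow> real"
  assumes a: "integrable N (\<lambda>x. (a x)\<^sup>2)" and b: "integrable N (\<lambda>x. (b x)\<^sup>2)"
    and ab: "integrable N (\<lambda>x. (a x + b x)\<^sup>2)"
  shows "sqrt (LINT x|N. (a x + b x)\<^sup>2) \<le> sqrt (LINT x|N. (a x)\<^sup>2) + sqrt (LINT x|N. (b x)\<^sup>2)"
proof (rule field_le_epsilon)
  fix e :: real assume e: "0 < e"
  define A where "A = sqrt (LINT x|N. (a x)\<^sup>2)"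
  define B where "B = sqrt (LINT x|N. (b x)\<^sup>2)"
  have A: "0 \<le> A" "A\<^sup>2 = (LINT x|N. (a x)\<^sup>2)" and B: "0 \<le> B" "B\<^sup>2 = (LINT x|N. (b x)\<^sup>2)"
    by (auto simp: A_def B_def)
  \<comment> \<open>Close to the optimal weight B/A; the added \<open>e\<close> keeps numerator and
    denominator positive when a norm vanishes.\<close>
  define t where "t = (B + e) / (A + e)"
  have t: "0 < t" using A B e by (simp add: t_def)
  have "(a x + b x)\<^sup>2 \<le> (1 + t) * (a x)\<^sup>2 + (1 + 1 / t) * (b x)\<^sup>2" for x
  proof -
    have "0 \<le> (t * a x - b x)\<^sup>2 / t" using t by simp
    also have "\<dots> = t * (a x)\<^sup>2 - 2 * a x * b x + (1 / t) * (b x)\<^sup>2"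
      using t by (simp add: power2_eq_square field_simps)
    finally show ?thesis by (simp add: power2_sum algebra_simps)
  qed
  then have "(LINT x|N. (a x + b x)\<^sup>2) \<le> (LINT x|N. (1 + t) * (a x)\<^sup>2 + (1 + 1 / t) * (b x)\<^sup>2)"
    using a b ab by (intro integral_mono) auto
  also have "\<dots> = (1 + t) * A\<^sup>2 + (1 + 1 / t) * B\<^sup>2" using a b A B by simp
  also have "\<dots> \<le> (A + B + e)\<^sup>2"
  proof -
    have "t * A\<^sup>2 = (B + e) * A * (A / (A + e))" by (simp add: t_def power2_eq_square)
    also have "\<dots> \<le> (B + e) * A * 1" using A B e by (intro mult_left_mono) auto
    finally have 1: "t * A\<^sup>2 \<le> (B + e) * A" by simp
    have "1 / t * B\<^sup>2 = (A + e) * B * (B / (B + e))" by (simp add: t_def power2_eq_square)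
    also have "\<dots> \<le> (A + e) * B * 1" using A B e by (intro mult_left_mono) auto
    finally have 2: "1 / t * B\<^sup>2 \<le> (A + e) * B" by simp
    have "0 \<le> e * A" "0 \<le> e * B" "0 \<le> e * e" using A B e by auto
    then have "A\<^sup>2 + (B + e) * A + (B\<^sup>2 + (A + e) * B) \<le> (A + B + e)\<^sup>2"
      by (simp add: power2_eq_square algebra_simps)
    moreover have "A\<^sup>2 + t * A\<^sup>2 + (B\<^sup>2 + 1 / t * B\<^sup>2) \<le> A\<^sup>2 + (B + e) * A + (B\<^sup>2 + (A + e) * B)"
      by (intro add_mono 1 2 order_refl)
    ultimately have "A\<^sup>2 + t * A\<^sup>2 + (B\<^sup>2 + 1 / t * B\<^sup>2) \<le> (A + B + e)\<^sup>2" by (rule order.trans[rotated])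
    then show ?thesis by (simp add: distrib_right)
  qed
  finally have "sqrt (LINT x|N. (a x + b x)\<^sup>2) \<le> A + B + e"
    using A B e by (intro real_le_lsqrt) auto
  then show "sqrt (LINT x|N. (a x + b x)\<^sup>2) \<le> sqrt (LINT x|N. (a x)\<^sup>2) + sqrt (LINT x|N. (b x)\<^sup>2) + e"
    by (simp add: A_def B_def)
qed

lemma l2_dist_triangle:
  assumes "x \<in> L2_space N" "y \<in> L2_space N" "z \<in> L2_space N"
  shows "l2_dist N x z \<le> l2_dist N x y + l2_dist N y z"
  using sqrt_integral_add_le[of N "\<lambda>p. x p - y p" "\<lambda>p. y p - z p"]
    L2_spaceD(2)[OF L2_space_diff[OF assms(1,2)]] L2_spaceD(2)[OF L2_space_diff[OF assms(2,3)]]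
    L2_spaceD(2)[OF L2_space_diff[OF assms(1,3)]]
  by (simp add: l2_dist_def)

text \<open>Chosen because the section at \<omega> takes only finitely many values, so its
  measurability needs no structure on L2. Finite measure of \<open>B\<close> makes the sections
  square integrable.\<close>

inductive elementary :: "'w measure \<Rightarrow> 'e measure \<Rightarrow> ('w \<times> 'e \<Rightarrow> real) \<Rightarrow> bool"
  for M :: "'w measure" and L :: "'e measure" where
  zero: "elementary M L (\<lambda>_. 0)"
| step: "elementary M L S \<Longrightarrow> A \<in> sets M \<Longrightarrow> B \<in> sets L \<Longrightarrow> emeasure L B < \<infinity> \<Longrightarrow>
    elementary M L (\<lambda>p. c * (indicator A (fst p) * indicator B (snd p)) + S p)"

lemma elementary_add:
  assumes "elementary M L S" "elementary M L S'"
  shows "elementary M L (\<lambda>p. S p + S' p)"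
  using assms by (induction) (auto simp: add.assoc intro: elementary.step)

lemma elementary_cmult:
  assumes "elementary M L S"
  shows "elementary M L (\<lambda>p. c * S p)"
  using assms
proof induction
  case zero
  show ?case by (simp add: elementary.zero)
next
  case (step S A B c')
  from elementary.step[OF step.IH step.hyps(2-4), of "c * c'"]
  show ?case by (simp add: distrib_left mult.assoc)
qed

lemma elementary_measurable:
  assumes "elementary M L S"
  shows "S \<in> borel_measurable (M \<Otimes>\<^sub>M L)"
  using assms by (induction) auto

lemma elementary_section_L2:
  assumes "elementary M L S"
  shows "(\<lambda>p. S (\<omega>, p)) \<in> L2_space L"
  using assms
proof induction
  case zero
  show ?case by (simp add: L2_space_def)
next
  case (step S A B c)
  \<comment> \<open>The new term carries a minus sign so that \<open>L2_space_diff\<close> adds it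
    to the section.\<close>
  have "(\<lambda>p. (- (c * indicator A \<omega>) * indicator B p)\<^sup>2)
      = (\<lambda>p. (c * indicator A \<omega>)\<^sup>2 * (indicator B p :: real))"
    by (auto simp: fun_eq_iff indicator_def)
  then have "(\<lambda>p. - (c * indicator A \<omega>) * indicator B p) \<in> L2_space L"
    using step unfolding L2_space_def by (auto simp: integrable_indicator_iff intro!: integrable_mult_right)
  from L2_space_diff[OF step.IH this] show ?case by (simp add: algebra_simps)
qed

text \<open>\<open>V\<close> is an arbitrary set of functions: the section map has finitely many
  values, each attained on a measurable event. In the induction the term added on \<open>A\<close>
  is moved into \<open>V\<close>, hence the generalisation over \<open>V\<close>.\<close>

lemma elementary_section_sets:
  assumes "elementary M L S"
  shows "{\<omega> \<in> space M. (\<lambda>p. S (\<omega>, p)) \<in> V} \<in> sets M"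
  using assms
proof (induction arbitrary: V)
  case zero
  show ?case by auto
next
  case (step S A B c)
  have "{\<omega> \<in> space M. (\<lambda>p. c * (indicator A (fst (\<omega>, p)) * indicator B (snd (\<omega>, p))) + S (\<omega>, p)) \<in> V}
     = (A \<inter> {\<omega> \<in> space M. (\<lambda>p. S (\<omega>, p)) \<in> {f. (\<lambda>p. c * indicator B p + f p) \<in> V}})
       \<union> ({\<omega> \<in> space M. (\<lambda>p. S (\<omega>, p)) \<in> V} - A)"
    using sets.sets_into_space[OF step.hyps(2)] by (auto simp: indicator_def split: if_splits)
  also have "\<dots> \<in> sets M" by (intro sets.Un sets.Int sets.Diff step.hyps step.IH)
  finally show ?case .
qed

text \<open>The mean-square closure of the elementary fields. The tolerance bounds the squared
  distance, which is why a sum of two errors is split into quarters below.\<close>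

definition approximable :: "'w measure \<Rightarrow> 'e measure \<Rightarrow> ('w \<times> 'e \<Rightarrow> real) \<Rightarrow> bool" where
  "approximable M L H \<longleftrightarrow> H \<in> borel_measurable (M \<Otimes>\<^sub>M L) \<and>
    (\<forall>e>0. \<exists>S. elementary M L S \<and> (\<integral>\<^sup>+ p. ennreal ((H p - S p)\<^sup>2) \<partial>(M \<Otimes>\<^sub>M L)) \<le> ennreal e)"

section \<open>Density of elementary fields among square-integrable fields\<close>

lemma nn_integral_power2_add_le:
  fixes f g :: "'e \<Rightarrow> real"
  assumes [measurable]: "f \<in> borel_measurable N" "g \<in> borel_measurable N"
  shows "(\<integral>\<^sup>+ p. ennreal ((f p + g p)\<^sup>2) \<partial>N)
    \<le> 2 * (\<integral>\<^sup>+ p. ennreal ((f p)\<^sup>2) \<partial>N) + 2 * (\<integral>\<^sup>+ p. ennreal ((g p)\<^sup>2) \<partial>N)"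
proof -
  have "ennreal ((f p + g p)\<^sup>2) \<le> 2 * ennreal ((f p)\<^sup>2) + 2 * ennreal ((g p)\<^sup>2)" for p
  proof -
    have "ennreal ((f p + g p)\<^sup>2) \<le> ennreal (2 * (f p)\<^sup>2 + 2 * (g p)\<^sup>2)"
      by (intro ennreal_leI power2_add_le)
    also have "\<dots> = 2 * ennreal ((f p)\<^sup>2) + 2 * ennreal ((g p)\<^sup>2)"
      by (subst ennreal_plus) (auto simp: ennreal_mult')
    finally show ?thesis .
  qed
  then have "(\<integral>\<^sup>+ p. ennreal ((f p + g p)\<^sup>2) \<partial>N)
      \<le> (\<integral>\<^sup>+ p. 2 * ennreal ((f p)\<^sup>2) + 2 * ennreal ((g p)\<^sup>2) \<partial>N)"
    by (intro nn_integral_mono)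
  also have "\<dots> = 2 * (\<integral>\<^sup>+ p. ennreal ((f p)\<^sup>2) \<partial>N) + 2 * (\<integral>\<^sup>+ p. ennreal ((g p)\<^sup>2) \<partial>N)"
    by (simp add: nn_integral_add nn_integral_cmult)
  finally show ?thesis .
qed

lemma ennreal_quarter_sum:
  assumes "0 \<le> e"
  shows "2 * ennreal (e / 4) + 2 * ennreal (e / 4) = ennreal e"
proof -
  have "2 * ennreal (e / 4) = ennreal (2 * (e / 4))" using assms by (subst ennreal_mult') auto
  then show ?thesis using assms by (simp flip: ennreal_plus)
qed

lemma approximable_limit:
  assumes [measurable]: "H \<in> borel_measurable (M \<Otimes>\<^sub>M L)"
    and H': "\<And>e. 0 < e \<Longrightarrow> \<exists>H'. approximable M L H' \<and>
      (\<integral>\<^sup>+ p. ennreal ((H p - H' p)\<^sup>2) \<partial>(M \<Otimes>\<^sub>M L)) \<le> ennreal e"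
  shows "approximable M L H"
  unfolding approximable_def
proof (intro conjI allI impI)
  fix e :: real assume e: "0 < e"
  obtain H' where H': "approximable M L H'" "(\<integral>\<^sup>+ p. ennreal ((H p - H' p)\<^sup>2) \<partial>(M \<Otimes>\<^sub>M L)) \<le> ennreal (e / 4)"
    using H'[of "e / 4"] e by auto
  then obtain S where S: "elementary M L S"
    "(\<integral>\<^sup>+ p. ennreal ((H' p - S p)\<^sup>2) \<partial>(M \<Otimes>\<^sub>M L)) \<le> ennreal (e / 4)"
    using e by (auto simp: approximable_def dest!: spec[of _ "e / 4"])
  note [measurable] = elementary_measurable[OF S(1)]
  have [measurable]: "H' \<in> borel_measurable (M \<Otimes>\<^sub>M L)" using H' by (simp add: approximable_def)
  have "(\<integral>\<^sup>+ p. ennreal ((H p - S p)\<^sup>2) \<partial>(M \<Otimes>\<^sub>M L))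
      \<le> 2 * (\<integral>\<^sup>+ p. ennreal ((H p - H' p)\<^sup>2) \<partial>(M \<Otimes>\<^sub>M L)) + 2 * (\<integral>\<^sup>+ p. ennreal ((H' p - S p)\<^sup>2) \<partial>(M \<Otimes>\<^sub>M L))"
    using nn_integral_power2_add_le[of "\<lambda>p. H p - H' p" "M \<Otimes>\<^sub>M L" "\<lambda>p. H' p - S p"] by simp
  also have "\<dots> \<le> 2 * ennreal (e / 4) + 2 * ennreal (e / 4)"
    using H'(2) S(2) by (intro add_mono mult_left_mono) auto
  also have "\<dots> = ennreal e"
    using e by (intro ennreal_quarter_sum) simp
  finally show "\<exists>S. elementary M L S \<and> (\<integral>\<^sup>+ p. ennreal ((H p - S p)\<^sup>2) \<partial>(M \<Otimes>\<^sub>M L)) \<le> ennreal e"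
    using S(1) e by auto
qed simp

lemma elementary_approximable: "elementary M L S \<Longrightarrow> approximable M L S"
  unfolding approximable_def by (auto intro: elementary_measurable)

lemma approximable_add:
  assumes "approximable M L H" "approximable M L H'"
  shows "approximable M L (\<lambda>p. H p + H' p)"
  unfolding approximable_def
proof (intro conjI allI impI)
  have [measurable]: "H \<in> borel_measurable (M \<Otimes>\<^sub>M L)" "H' \<in> borel_measurable (M \<Otimes>\<^sub>M L)"
    using assms by (auto simp: approximable_def)
  show "(\<lambda>p. H p + H' p) \<in> borel_measurable (M \<Otimes>\<^sub>M L)" by simp
  fix e :: real assume e: "0 < e"
  obtain S where S: "elementary M L S"
    "(\<integral>\<^sup>+ p. ennreal ((H p - S p)\<^sup>2) \<partial>(M \<Otimes>\<^sub>M L)) \<le> ennreal (e / 4)"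
    using e assms(1) by (auto simp: approximable_def dest!: spec[of _ "e / 4"])
  obtain S' where S': "elementary M L S'"
    "(\<integral>\<^sup>+ p. ennreal ((H' p - S' p)\<^sup>2) \<partial>(M \<Otimes>\<^sub>M L)) \<le> ennreal (e / 4)"
    using e assms(2) by (auto simp: approximable_def dest!: spec[of _ "e / 4"])
  note [measurable] = elementary_measurable[OF S(1)] elementary_measurable[OF S'(1)]
  have "(\<integral>\<^sup>+ p. ennreal (((H p + H' p) - (S p + S' p))\<^sup>2) \<partial>(M \<Otimes>\<^sub>M L))
      \<le> 2 * (\<integral>\<^sup>+ p. ennreal ((H p - S p)\<^sup>2) \<partial>(M \<Otimes>\<^sub>M L)) + 2 * (\<integral>\<^sup>+ p. ennreal ((H' p - S' p)\<^sup>2) \<partial>(M \<Otimes>\<^sub>M L))"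
    using nn_integral_power2_add_le[of "\<lambda>p. H p - S p" "M \<Otimes>\<^sub>M L" "\<lambda>p. H' p - S' p"]
    by (simp add: algebra_simps)
  also have "\<dots> \<le> 2 * ennreal (e / 4) + 2 * ennreal (e / 4)"
    using S'(2) S(2) by (intro add_mono mult_left_mono) auto
  also have "\<dots> = ennreal e"
    using e by (intro ennreal_quarter_sum) simp
  finally show "\<exists>S. elementary M L S \<and> (\<integral>\<^sup>+ p. ennreal ((H p + H' p - S p)\<^sup>2) \<partial>(M \<Otimes>\<^sub>M L)) \<le> ennreal e"
    using elementary_add[OF S(1) S'(1)] e by auto
qed

lemma approximable_cmult:
  assumes "approximable M L H"
  shows "approximable M L (\<lambda>p. c * H p)"
proof (cases "c = 0")
  case True
  then show ?thesis using elementary_approximable[OF elementary.zero] by simp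
next
  case False
  have [measurable]: "H \<in> borel_measurable (M \<Otimes>\<^sub>M L)"
    using assms by (auto simp: approximable_def)
  show ?thesis unfolding approximable_def
  proof (intro conjI allI impI)
    fix e :: real assume e: "0 < e"
    obtain S where S: "elementary M L S"
      "(\<integral>\<^sup>+ p. ennreal ((H p - S p)\<^sup>2) \<partial>(M \<Otimes>\<^sub>M L)) \<le> ennreal (e / c\<^sup>2)"
      using e False assms(1) by (auto simp: approximable_def dest!: spec[of _ "e / c\<^sup>2"])
    note [measurable] = elementary_measurable[OF S(1)]
    have "(\<integral>\<^sup>+ p. ennreal ((c * H p - c * S p)\<^sup>2) \<partial>(M \<Otimes>\<^sub>M L))
        = (\<integral>\<^sup>+ p. ennreal (c\<^sup>2) * ennreal ((H p - S p)\<^sup>2) \<partial>(M \<Otimes>\<^sub>M L))"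
      by (simp add: power_mult_distrib flip: right_diff_distrib ennreal_mult)
    also have "\<dots> = ennreal (c\<^sup>2) * (\<integral>\<^sup>+ p. ennreal ((H p - S p)\<^sup>2) \<partial>(M \<Otimes>\<^sub>M L))"
      by (simp add: nn_integral_cmult)
    also have "\<dots> \<le> ennreal (c\<^sup>2) * ennreal (e / c\<^sup>2)" using S(2) by (intro mult_left_mono) auto
    also have "\<dots> = ennreal e" using False e by (simp flip: ennreal_mult)
    finally show "\<exists>S. elementary M L S \<and> (\<integral>\<^sup>+ p. ennreal ((c * H p - S p)\<^sup>2) \<partial>(M \<Otimes>\<^sub>M L)) \<le> ennreal e"
      using elementary_cmult[OF S(1), of c] by auto
  qed simp
qed

lemma approximable_sum:
  assumes "finite I" "\<And>i. i \<in> I \<Longrightarrow> approximable M L (H i)"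
  shows "approximable M L (\<lambda>p. \<Sum>i\<in>I. H i p)"
  using assms
proof (induction I rule: finite_induct)
  case empty
  then show ?case using elementary_approximable[OF elementary.zero] by simp
next
  case (insert i I)
  then show ?case by (simp add: approximable_add)
qed

text \<open>The squared distance of two nested indicators is the measure of the difference set,
  which decreases to zero by continuity from above; this is where the union must have finite
  measure.\<close>

lemma approximable_incseq:
  assumes F: "\<And>n :: nat. approximable M L (indicator (F n))" "\<And>n. F n \<in> sets (M \<Otimes>\<^sub>M L)" "incseq F"
    and fin: "emeasure (M \<Otimes>\<^sub>M L) (\<Union>n. F n) < \<infinity>"
  shows "approximable M L (indicator (\<Union>n. F n))"
proof (rule approximable_limit)
  have U: "(\<Union>n. F n) \<in> sets (M \<Otimes>\<^sub>M L)" using F(2) by auto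
  then show "indicator (\<Union>n. F n) \<in> borel_measurable (M \<Otimes>\<^sub>M L)" by simp
  fix e :: real assume e: "0 < e"
  have "(\<lambda>n. emeasure (M \<Otimes>\<^sub>M L) ((\<Union>n. F n) - F n)) \<longlonglongrightarrow> emeasure (M \<Otimes>\<^sub>M L) (\<Inter>n. (\<Union>n. F n) - F n)"
  proof (rule Lim_emeasure_decseq)
    show "range (\<lambda>n. (\<Union>n. F n) - F n) \<subseteq> sets (M \<Otimes>\<^sub>M L)" using U F(2) by auto
    show "decseq (\<lambda>n. (\<Union>n. F n) - F n)" using F(3) by (auto simp: decseq_def incseq_def)
    show "emeasure (M \<Otimes>\<^sub>M L) ((\<Union>n. F n) - F n) \<noteq> \<infinity>" for n
      using emeasure_mono[OF Diff_subset U, of "F n"] fin by (auto simp: top_unique)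
  qed
  moreover have "(\<Inter>n. (\<Union>n. F n) - F n) = {}" by auto
  ultimately have "(\<lambda>n. emeasure (M \<Otimes>\<^sub>M L) ((\<Union>n. F n) - F n)) \<longlonglongrightarrow> 0" by simp
  then have "eventually (\<lambda>n. emeasure (M \<Otimes>\<^sub>M L) ((\<Union>n. F n) - F n) < ennreal e) sequentially"
    using e by (intro order_tendstoD(2)) auto
  then obtain n where n: "emeasure (M \<Otimes>\<^sub>M L) ((\<Union>n. F n) - F n) < ennreal e"
    using eventually_happens[of _ sequentially] by auto
  have "(\<integral>\<^sup>+ p. ennreal ((indicator (\<Union>n. F n) p - indicator (F n) p)\<^sup>2) \<partial>(M \<Otimes>\<^sub>M L))
      = (\<integral>\<^sup>+ p. indicator ((\<Union>n. F n) - F n) p \<partial>(M \<Otimes>\<^sub>M L))"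
    by (intro nn_integral_cong) (auto simp: indicator_def)
  also have "\<dots> = emeasure (M \<Otimes>\<^sub>M L) ((\<Union>n. F n) - F n)"
    using U F(2) by (intro nn_integral_indicator) auto
  finally show "\<exists>H'. approximable M L H' \<and>
      (\<integral>\<^sup>+ p. ennreal ((indicator (\<Union>n. F n) p - H' p)\<^sup>2) \<partial>(M \<Otimes>\<^sub>M L)) \<le> ennreal e"
    using F(1) n by (intro exI[of _ "indicator (F n)"]) auto
qed

context
  fixes M :: "'w measure" and L :: "'e measure"
  assumes M: "prob_space M" and L: "sigma_finite_measure L"
begin

interpretation M: prob_space M by fact
interpretation L: sigma_finite_measure L by fact
interpretation PS: pair_sigma_finite M L ..

text \<open>Dynkin's argument from measurable rectangles. Everything is cut down to the strip over
  \<open>B\<close>, whose measure is finite, so that complements become differences and disjoint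
  unions become limits of finite sums.\<close>

lemma approximable_indicator_finite:
  assumes B: "B \<in> sets L" "emeasure L B < \<infinity>" and E: "E \<in> sets (M \<Otimes>\<^sub>M L)"
  shows "approximable M L (indicator (E \<inter> (space M \<times> B)))"
proof -
  let ?B = "space M \<times> B"
  have Bs: "?B \<in> sets (M \<Otimes>\<^sub>M L)" using B by auto
  have "emeasure (M \<Otimes>\<^sub>M L) ?B = emeasure L B"
    using B by (simp add: L.emeasure_pair_measure_Times M.emeasure_space_1)
  then have Bfin: "emeasure (M \<Otimes>\<^sub>M L) ?B < \<infinity>" using B by simp
  have rect: "approximable M L (indicator (a \<times> (b \<inter> B)))" if "a \<in> sets M" "b \<in> sets L" for a b
  proof -
    have "emeasure L (b \<inter> B) \<le> emeasure L B" using B by (intro emeasure_mono) auto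
    then have "elementary M L (\<lambda>p. 1 * (indicator a (fst p) * indicator (b \<inter> B) (snd p)) + (\<lambda>_. 0) p)"
      using that B by (intro elementary.intros) auto
    moreover have "(\<lambda>p. 1 * (indicator a (fst p) * indicator (b \<inter> B) (snd p)) + (\<lambda>_. 0) p)
        = (indicator (a \<times> (b \<inter> B)) :: 'w \<times> 'e \<Rightarrow> real)"
      by (auto simp: fun_eq_iff indicator_def)
    ultimately show ?thesis by (metis elementary_approximable)
  qed
  from E have "E \<in> sigma_sets (space M \<times> space L) {a \<times> b |a b. a \<in> sets M \<and> b \<in> sets L}"
    by (simp add: sets_pair_measure)
  then show ?thesis
  proof (induction rule: sigma_sets_induct_disjoint[OF Int_stable_pair_measure_generator pair_measure_closed,
        consumes 1, case_names basic empty compl union])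
    case (basic E)
    then obtain a b where ab: "E = a \<times> b" "a \<in> sets M" "b \<in> sets L" by auto
    then have "E \<inter> ?B = a \<times> (b \<inter> B)" using sets.sets_into_space[OF ab(2)] by auto
    then show ?case using rect[OF ab(2,3)] by simp
  next
    case empty
    then show ?case using elementary_approximable[OF elementary.zero] by (simp add: indicator_def[abs_def])
  next
    case (compl E)
    have "approximable M L (indicator (space M \<times> (space L \<inter> B)))" by (intro rect) auto
    then have "approximable M L (\<lambda>p. indicator (space M \<times> (space L \<inter> B)) p + (- 1) * indicator (E \<inter> ?B) p)"
      using compl by (intro approximable_add approximable_cmult)
    also have "(\<lambda>p. indicator (space M \<times> (space L \<inter> B)) p + (- 1) * indicator (E \<inter> ?B) p)
        = (indicator ((space M \<times> space L - E) \<inter> ?B) :: 'w \<times> 'e \<Rightarrow> real)"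
      using sets.sets_into_space[OF B(1)] by (auto simp: fun_eq_iff indicator_def)
    finally show ?case .
  next
    case (union A)
    have A: "A i \<in> sets (M \<Otimes>\<^sub>M L)" for i using union by (auto simp: sets_pair_measure)
    define F where "F n = (\<Union>i<n. A i \<inter> ?B)" for n :: nat
    have Fs: "F n \<in> sets (M \<Otimes>\<^sub>M L)" for n using A Bs by (auto simp: F_def)
    have "approximable M L (indicator (F n))" for n
    proof -
      have "(indicator (F n) :: 'w \<times> 'e \<Rightarrow> real) = (\<lambda>p. \<Sum>i<n. indicator (A i \<inter> ?B) p)"
      proof
        fix p
        have "disjoint_family_on (\<lambda>i. A i \<inter> ?B) {..<n}"
          using union(1) by (auto simp: disjoint_family_on_def)
        from indicator_UN_disjoint[OF _ this]
        show "(indicator (F n) p :: real) = (\<Sum>i<n. indicator (A i \<inter> ?B) p)"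
          unfolding F_def by simp
      qed
      then show ?thesis using union by (simp add: approximable_sum)
    qed
    moreover have "incseq F" by (force simp: incseq_def F_def)
    moreover have UF: "(\<Union>n. F n) = \<Union> (range A) \<inter> ?B" by (auto simp: F_def)
    moreover have "emeasure (M \<Otimes>\<^sub>M L) (\<Union>n. F n) \<le> emeasure (M \<Otimes>\<^sub>M L) ?B"
      using Bs by (intro emeasure_mono) (auto simp: F_def)
    ultimately show ?case using approximable_incseq[of M L F] Fs Bfin by (simp add: le_less_trans)
  qed
qed

text \<open>Strips over sets of finite measure exhaust the product.\<close>

lemma approximable_indicator:
  assumes E: "E \<in> sets (M \<Otimes>\<^sub>M L)" "emeasure (M \<Otimes>\<^sub>M L) E < \<infinity>"
  shows "approximable M L (indicator E)"
proof -
  obtain B :: "nat \<Rightarrow> 'e set" where B: "range B \<subseteq> sets L" "(\<Union>i. B i) = space L"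
      "\<And>i. emeasure L (B i) \<noteq> \<infinity>" "incseq B"
    using L.sigma_finite_incseq by metis
  have U: "(\<Union>n. E \<inter> (space M \<times> B n)) = E"
    using sets.sets_into_space[OF E(1)] B(2) by (auto simp: space_pair_measure)
  have "approximable M L (indicator (\<Union>n. E \<inter> (space M \<times> B n)))"
  proof (rule approximable_incseq)
    show "approximable M L (indicator (E \<inter> (space M \<times> B n)))" for n
      using B E by (intro approximable_indicator_finite) (auto simp: less_top)
    show "E \<inter> (space M \<times> B n) \<in> sets (M \<Otimes>\<^sub>M L)" for n using B(1) E by auto
    show "incseq (\<lambda>n. E \<inter> (space M \<times> B n))" using B(4) by (fastforce simp: incseq_def)
    show "emeasure (M \<Otimes>\<^sub>M L) (\<Union>n. E \<inter> (space M \<times> B n)) < \<infinity>" using E by (simp only: U)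
  qed
  then show ?thesis by (simp only: U)
qed

lemma approximable_simple:
  assumes s: "simple_function (M \<Otimes>\<^sub>M L) s" "(\<integral>\<^sup>+ p. ennreal ((s p)\<^sup>2) \<partial>(M \<Otimes>\<^sub>M L)) < \<infinity>"
  shows "approximable M L s"
proof -
  let ?P = "M \<Otimes>\<^sub>M L"
  have [measurable]: "s \<in> borel_measurable ?P" using s(1) by (rule borel_measurable_simple_function)
  define A where "A y = s -` {y} \<inter> space ?P" for y
  have A [measurable]: "A y \<in> sets ?P" for y using s(1) by (auto simp: A_def intro: simple_functionD)
  \<comment> \<open>Chebyshev: on its level set \<open>s\<close> has square y^2, so a
    square-integrable \<open>s\<close> takes each nonzero value on a set of finite measure.\<close>
  have fin: "emeasure ?P (A y) < \<infinity>" if "y \<noteq> 0" for y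
  proof -
    have "ennreal (y\<^sup>2) * emeasure ?P (A y) = (\<integral>\<^sup>+ p. ennreal (y\<^sup>2) * indicator (A y) p \<partial>?P)"
      by (simp add: nn_integral_cmult_indicator)
    also have "\<dots> \<le> (\<integral>\<^sup>+ p. ennreal ((s p)\<^sup>2) \<partial>?P)"
      by (intro nn_integral_mono) (auto simp: A_def indicator_def)
    finally have "ennreal (y\<^sup>2) * emeasure ?P (A y) < \<infinity>" using s(2) by (rule le_less_trans)
    then show ?thesis using that by (auto simp: ennreal_mult_less_top)
  qed
  let ?t = "\<lambda>p. \<Sum>y\<in>s ` space ?P - {0}. y * indicator (A y) p"
  have f: "finite (s ` space ?P - {0})" using s(1) by (simp add: simple_function_def)
  have t: "approximable M L ?t"
    using f fin by (intro approximable_sum approximable_cmult approximable_indicator) auto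
  have eq: "s p = ?t p" if p: "p \<in> space ?P" for p
  proof (cases "s p = 0")
    case True
    then have "?t p = 0" by (intro sum.neutral) (auto simp: A_def indicator_def)
    then show ?thesis using True by simp
  next
    case False
    have "?t p = (\<Sum>y\<in>s ` space ?P - {0}. if y = s p then s p else 0)"
      using p by (intro sum.cong) (auto simp: A_def indicator_def)
    then show ?thesis using False p f by simp
  qed
  \<comment> \<open>\<open>s\<close> and the sum agree only on the space of the product, not as
    functions, so the step passes through \<open>approximable_limit\<close> with distance
    zero.\<close>
  show ?thesis
  proof (rule approximable_limit)
    fix e :: real assume "0 < e"
    have "(\<integral>\<^sup>+ p. ennreal ((s p - ?t p)\<^sup>2) \<partial>?P) = (\<integral>\<^sup>+ p. 0 \<partial>?P)"
    proof (rule nn_integral_cong)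
      fix p assume "p \<in> space ?P"
      from eq[OF this] show "ennreal ((s p - ?t p)\<^sup>2) = 0" by (metis diff_self ennreal_0 zero_power2)
    qed
    then have "(\<integral>\<^sup>+ p. ennreal ((s p - ?t p)\<^sup>2) \<partial>?P) \<le> ennreal e" by (simp only: nn_integral_const) simp
    with t show "\<exists>H'. approximable M L H' \<and> (\<integral>\<^sup>+ p. ennreal ((s p - H' p)\<^sup>2) \<partial>?P) \<le> ennreal e"
      by (intro exI[of _ ?t] conjI)
  qed simp
qed

lemma approximable_square_integrable:
  assumes [measurable]: "H \<in> borel_measurable (M \<Otimes>\<^sub>M L)"
    and fin: "(\<integral>\<^sup>+ p. ennreal ((H p)\<^sup>2) \<partial>(M \<Otimes>\<^sub>M L)) < \<infinity>"
  shows "approximable M L H"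
proof (rule approximable_limit)
  let ?P = "M \<Otimes>\<^sub>M L"
  fix e :: real assume e: "0 < e"
  obtain s where s: "\<And>i. simple_function ?P (s i)"
    and lim: "\<And>p. p \<in> space ?P \<Longrightarrow> (\<lambda>i. s i p) \<longlonglongrightarrow> H p"
    and bd: "\<And>i p. p \<in> space ?P \<Longrightarrow> \<bar>s i p\<bar> \<le> 2 * \<bar>H p\<bar>"
    using borel_measurable_implies_sequence_metric[of H ?P 0] by simp metis
  have [measurable]: "s i \<in> borel_measurable ?P" for i using s by (rule borel_measurable_simple_function)
  \<comment> \<open>9 = 3^2 comes from |H - s| <= |H| + |s| <= 3 |H|; it dominates the error as well
    as \<open>s\<close> itself.\<close>
  have H9: "(\<integral>\<^sup>+ p. ennreal (9 * (H p)\<^sup>2) \<partial>?P) < \<infinity>"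
    using fin by (simp add: ennreal_mult' nn_integral_cmult ennreal_mult_less_top)
  have le: "\<bar>H p - s i p\<bar>\<^sup>2 \<le> 9 * (H p)\<^sup>2" "\<bar>s i p\<bar>\<^sup>2 \<le> 9 * (H p)\<^sup>2" if "p \<in> space ?P" for i p
  proof -
    have 1: "\<bar>H p - s i p\<bar> \<le> 3 * \<bar>H p\<bar>" and 2: "\<bar>s i p\<bar> \<le> 3 * \<bar>H p\<bar>"
      using bd[OF that, of i] by linarith+
    show "\<bar>H p - s i p\<bar>\<^sup>2 \<le> 9 * (H p)\<^sup>2" "\<bar>s i p\<bar>\<^sup>2 \<le> 9 * (H p)\<^sup>2"
      using power_mono[OF 1 abs_ge_zero, of 2] power_mono[OF 2 abs_ge_zero, of 2]
      by (auto simp: power_mult_distrib)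
  qed
  have ap: "approximable M L (s i)" for i
  proof (rule approximable_simple[OF s])
    have "(\<integral>\<^sup>+ p. ennreal ((s i p)\<^sup>2) \<partial>?P) \<le> (\<integral>\<^sup>+ p. ennreal (9 * (H p)\<^sup>2) \<partial>?P)"
      using le(2) by (intro nn_integral_mono ennreal_leI) simp
    then show "(\<integral>\<^sup>+ p. ennreal ((s i p)\<^sup>2) \<partial>?P) < \<infinity>" using H9 by (rule le_less_trans)
  qed
  have "(\<lambda>i. \<integral>\<^sup>+ p. ennreal ((H p - s i p)\<^sup>2) \<partial>?P) \<longlonglongrightarrow> (\<integral>\<^sup>+ p. 0 \<partial>?P)"
  proof (rule nn_integral_dominated_convergence[where w="\<lambda>p. ennreal (9 * (H p)\<^sup>2)"])
    show "AE p in ?P. ennreal ((H p - s i p)\<^sup>2) \<le> ennreal (9 * (H p)\<^sup>2)" for i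
      using le(1) by (intro AE_I2 ennreal_leI) simp
    show "AE p in ?P. (\<lambda>i. ennreal ((H p - s i p)\<^sup>2)) \<longlonglongrightarrow> 0"
    proof (rule AE_I2)
      fix p assume "p \<in> space ?P"
      then have "(\<lambda>i. ennreal ((H p - s i p)\<^sup>2)) \<longlonglongrightarrow> ennreal ((H p - H p)\<^sup>2)"
        using lim by (intro tendsto_ennrealI tendsto_power tendsto_diff) auto
      then show "(\<lambda>i. ennreal ((H p - s i p)\<^sup>2)) \<longlonglongrightarrow> 0" by simp
    qed
  qed (use H9 in auto)
  then have "eventually (\<lambda>i. (\<integral>\<^sup>+ p. ennreal ((H p - s i p)\<^sup>2) \<partial>?P) < ennreal e) sequentially"
    using e by (intro order_tendstoD(2)) auto
  then obtain i where "(\<integral>\<^sup>+ p. ennreal ((H p - s i p)\<^sup>2) \<partial>?P) < ennreal e"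
    using eventually_happens[of _ sequentially] by auto
  then show "\<exists>H'. approximable M L H' \<and> (\<integral>\<^sup>+ p. ennreal ((H p - H' p)\<^sup>2) \<partial>?P) \<le> ennreal e"
    using ap by (intro exI[of _ "s i"]) auto
qed simp

text \<open>Squared errors of (1/2)^k are summable, so the squared distances of the sections have an
  almost surely finite sum and tend to zero along the whole sequence. \<open>G\<close> has to lie in
  L2 for every \<omega> but to match \<open>H\<close> only almost surely, which is what
  \<open>field_path\<close> offers.\<close>

lemma measurable_field:
  assumes M: "complete_measure M"
    and H [measurable]: "H \<in> borel_measurable (M \<Otimes>\<^sub>M L)"
    and fin: "(\<integral>\<^sup>+ p. ennreal ((H p)\<^sup>2) \<partial>(M \<Otimes>\<^sub>M L)) < \<infinity>"
    and G: "\<And>\<omega>. \<omega> \<in> space M \<Longrightarrow> G \<omega> \<in> L2_space L"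
    and GH: "AE \<omega> in M. \<forall>p\<in>space L. G \<omega> p = H (\<omega>, p)"
  shows "G \<in> measurable M (borel_of_dist (L2_space L) (l2_dist L))"
proof -
  have "\<exists>S. elementary M L S \<and>
      (\<integral>\<^sup>+ p. ennreal ((H p - S p)\<^sup>2) \<partial>(M \<Otimes>\<^sub>M L)) \<le> ennreal ((1 / 2) ^ k)" for k :: nat
    using approximable_square_integrable[OF H fin] by (auto simp: approximable_def)
  then obtain S where S: "\<And>k. elementary M L (S k)"
    "\<And>k :: nat. (\<integral>\<^sup>+ p. ennreal ((H p - S k p)\<^sup>2) \<partial>(M \<Otimes>\<^sub>M L)) \<le> ennreal ((1 / 2) ^ k)"
    by metis
  have [measurable]: "S k \<in> borel_measurable (M \<Otimes>\<^sub>M L)" for k by (rule elementary_measurable[OF S(1)])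
  define r where "r k \<omega> = (\<integral>\<^sup>+ p. ennreal ((H (\<omega>, p) - S k (\<omega>, p))\<^sup>2) \<partial>L)" for k \<omega>
  have [measurable]: "r k \<in> borel_measurable M" for k unfolding r_def by measurable
  have "(\<integral>\<^sup>+ \<omega>. r k \<omega> \<partial>M) \<le> ennreal ((1 / 2) ^ k)" for k
    unfolding r_def using S(2)[of k] by (subst L.nn_integral_fst) auto
  then have "(\<integral>\<^sup>+ \<omega>. (\<Sum>k. r k \<omega>) \<partial>M) \<le> (\<Sum>k. ennreal ((1 / 2) ^ k))"
    by (subst nn_integral_suminf) (auto intro: suminf_le)
  also have "\<dots> = ennreal (\<Sum>k. (1 / 2) ^ k)" by (intro suminf_ennreal2) (auto intro: summable_geometric)
  finally have "(\<integral>\<^sup>+ \<omega>. (\<Sum>k. r k \<omega>) \<partial>M) \<noteq> \<infinity>" by (auto simp: top_unique)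
  then have "AE \<omega> in M. (\<Sum>k. r k \<omega>) \<noteq> \<infinity>" by (intro nn_integral_noteq_infinite) auto
  then have lim: "AE \<omega> in M. (\<lambda>k. enn2real (r k \<omega>)) \<longlonglongrightarrow> 0 \<and> (\<forall>k. r k \<omega> \<noteq> \<infinity>)"
  proof eventually_elim
    case (elim \<omega>)
    have fin: "r k \<omega> \<noteq> \<infinity>" for k
    proof
      assume "r k \<omega> = \<infinity>"
      moreover have "r k \<omega> \<le> (\<Sum>k. r k \<omega>)"
        using sum_le_suminf[of "\<lambda>k. r k \<omega>" "{k}"] by simp
      ultimately show False using elim by (simp add: top_unique)
    qed
    then have "(\<Sum>k. ennreal (enn2real (r k \<omega>))) \<noteq> \<infinity>" using elim by (simp add: less_top)
    then have "summable (\<lambda>k. enn2real (r k \<omega>))" by (intro summable_suminf_not_top) auto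
    then show ?case using fin summable_LIMSEQ_zero by blast
  qed
  show ?thesis
  proof (rule measurable_borel_of_dist_limit[OF M l2_dist_triangle _ _ _ G])
    show "(\<lambda>\<omega> p. S k (\<omega>, p)) \<in> measurable M (borel_of_dist (L2_space L) (l2_dist L))" for k
    proof (rule measurable_borel_of_distI)
      show "(\<lambda>\<omega> p. S k (\<omega>, p)) -` V \<inter> space M \<in> sets M" for V
        using elementary_section_sets[OF S(1), of k V] by (simp add: vimage_def Collect_conj_eq Int_commute)
    qed (rule elementary_section_L2[OF S(1)])
    show "AE \<omega> in M. (\<lambda>k. l2_dist L (\<lambda>p. S k (\<omega>, p)) (G \<omega>)) \<longlonglongrightarrow> 0"
      using lim GH AE_space
    proof eventually_elim
      case (elim \<omega>)
      have "l2_dist L (\<lambda>p. S k (\<omega>, p)) (G \<omega>) = sqrt (enn2real (r k \<omega>))" for k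
      proof -
        have "(LINT p|L. \<bar>S k (\<omega>, p) - G \<omega> p\<bar>\<^sup>2) = (LINT p|L. (H (\<omega>, p) - S k (\<omega>, p))\<^sup>2)"
          using elim by (intro Bochner_Integration.integral_cong) (auto simp: power2_commute)
        also have "\<dots> = enn2real (r k \<omega>)"
          unfolding r_def using elim(3) by (intro integral_eq_nn_integral) auto
        finally show ?thesis by (simp add: l2_dist_def)
      qed
      then show ?case using elim(1) tendsto_real_sqrt[of "\<lambda>k. enn2real (r k \<omega>)" 0] by simp
    qed
  qed (auto simp: l2_dist_def abs_minus_commute)
qed

end

section \<open>Predictable fields\<close>

lemma sets_time_measure [simp, measurable_cong]: "sets (time_measure T) = sets borel"
  by (simp add: time_measure_def)

lemma space_time_measure [simp]: "space (time_measure T) = UNIV"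
  by (simp add: time_measure_def)

lemma nn_integral_time_measure:
  assumes "f \<in> borel_measurable borel"
  shows "(\<integral>\<^sup>+ t. f t \<partial>time_measure T) = (\<integral>\<^sup>+ t\<in>{0..T}. f t \<partial>lborel)"
  using assms unfolding time_measure_def by (subst nn_integral_density) (auto simp: mult.commute)

lemma finite_time_measure: "finite_measure (time_measure T)"
proof (rule finite_measureI)
  have "emeasure (time_measure T) (space (time_measure T)) = emeasure lborel {0..T}"
    unfolding time_measure_def by (subst emeasure_density) auto
  then show "emeasure (time_measure T) (space (time_measure T)) \<noteq> \<infinity>"
    using emeasure_lborel_Icc_eq[of 0 T] by (simp split: if_splits)
qed

lemma sigma_finite_time_measure: "sigma_finite_measure (time_measure T)"
  using finite_time_measure by (simp add: finite_measure_def)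

text \<open>Puts \<omega> first and continues the field by 0 outside [0,T], so that the random
  element of L2 becomes the section at \<omega> of one function on a product space.\<close>

definition joint_field ::
  "real \<Rightarrow> (real \<Rightarrow> 'w \<Rightarrow> 'a \<Rightarrow> real) \<Rightarrow> 'w \<times> (real \<times> 'a) \<Rightarrow> real" where
  "joint_field T U = (\<lambda>(\<omega>, t, x). if t \<in> {0..T} then U t \<omega> x else 0)"

context
  fixes \<nu> :: "'a::euclidean_space measure" and T :: real
  assumes \<nu>: "sigma_finite_measure \<nu>" "sets \<nu> = sets borel"
begin

interpretation \<nu>: sigma_finite_measure \<nu> by fact
interpretation tm: sigma_finite_measure "time_measure T" by (rule sigma_finite_time_measure)
interpretation tn: pair_sigma_finite "time_measure T" \<nu> ..

lemma sets_time_space: "sets (time_measure T \<Otimes>\<^sub>M \<nu>) = sets (borel \<Otimes>\<^sub>M borel)"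
  using \<nu>(2) by (intro sets_pair_measure_cong) auto

lemma sigma_finite_time_space: "sigma_finite_measure (time_measure T \<Otimes>\<^sub>M \<nu>)"
  by (rule tn.sigma_finite_measure_axioms)

lemma nn_integral_time_space:
  assumes k [measurable]: "k \<in> borel_measurable (time_measure T \<Otimes>\<^sub>M \<nu>)"
  shows "(\<integral>\<^sup>+ p. k p \<partial>(time_measure T \<Otimes>\<^sub>M \<nu>)) = (\<integral>\<^sup>+ t\<in>{0..T}. (\<integral>\<^sup>+ x. k (t, x) \<partial>\<nu>) \<partial>lborel)"
proof -
  have "(\<lambda>t. \<integral>\<^sup>+ x. k (t, x) \<partial>\<nu>) \<in> borel_measurable (time_measure T)" by measurable
  then have "(\<lambda>t. \<integral>\<^sup>+ x. k (t, x) \<partial>\<nu>) \<in> borel_measurable borel"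
    by (simp cong: measurable_cong_sets)
  then show ?thesis
    unfolding \<nu>.nn_integral_fst[OF k, symmetric] by (rule nn_integral_time_measure)
qed

lemma nn_integral_time_space_swap:
  assumes M: "prob_space M" and k [measurable]: "k \<in> borel_measurable (M \<Otimes>\<^sub>M (time_measure T \<Otimes>\<^sub>M \<nu>))"
  shows "(\<integral>\<^sup>+ \<omega>. (\<integral>\<^sup>+ p. k (\<omega>, p) \<partial>(time_measure T \<Otimes>\<^sub>M \<nu>)) \<partial>M)
    = (\<integral>\<^sup>+ t\<in>{0..T}. (\<integral>\<^sup>+ x. (\<integral>\<^sup>+ \<omega>. k (\<omega>, (t, x)) \<partial>M) \<partial>\<nu>) \<partial>lborel)"
proof -
  interpret M: prob_space M by fact
  interpret P: pair_sigma_finite M "time_measure T \<Otimes>\<^sub>M \<nu>"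
    using tn.sigma_finite_measure_axioms by (simp add: pair_sigma_finite_def M.sigma_finite_measure_axioms)
  have "(\<integral>\<^sup>+ \<omega>. (\<integral>\<^sup>+ p. k (\<omega>, p) \<partial>(time_measure T \<Otimes>\<^sub>M \<nu>)) \<partial>M)
      = (\<integral>\<^sup>+ p. (\<integral>\<^sup>+ \<omega>. k (\<omega>, p) \<partial>M) \<partial>(time_measure T \<Otimes>\<^sub>M \<nu>))"
    by (rule P.Fubini'[symmetric]) simp
  also have "\<dots> = (\<integral>\<^sup>+ t\<in>{0..T}. (\<integral>\<^sup>+ x. (\<integral>\<^sup>+ \<omega>. k (\<omega>, (t, x)) \<partial>M) \<partial>\<nu>) \<partial>lborel)"
  proof (rule nn_integral_time_space)
    have "(\<lambda>a. k (snd a, fst a)) \<in> borel_measurable ((time_measure T \<Otimes>\<^sub>M \<nu>) \<Otimes>\<^sub>M M)"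
      by measurable
    from M.borel_measurable_nn_integral_fst[OF this]
    show "(\<lambda>p. \<integral>\<^sup>+ \<omega>. k (\<omega>, p) \<partial>M) \<in> borel_measurable (time_measure T \<Otimes>\<^sub>M \<nu>)" by simp
  qed
  finally show ?thesis .
qed

text \<open>The generators of the predictable sigma-algebra are measurable rectangles of the
  product, each with its event in some \<open>F s\<close> with s < T. That sigma-algebra lives on
  [0,T] times the sample space, so the map into it is considered on the part of the product with
  time in [0,T].\<close>

lemma joint_field_measurable:
  fixes M :: "'w measure"
  assumes T: "0 < T" and F: "\<And>t. t \<in> {0..<T} \<Longrightarrow> sets (F t) \<subseteq> sets M"
    and U: "predictable_field M T F U"
  shows "joint_field T U \<in> borel_measurable (M \<Otimes>\<^sub>M (time_measure T \<Otimes>\<^sub>M \<nu>))"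
proof -
  let ?Q = "M \<Otimes>\<^sub>M (time_measure T \<Otimes>\<^sub>M \<nu>)"
  let ?P = "\<lambda>p::'w \<times> (real \<times> 'a). fst (snd p) \<in> {0..T}"
  let ?G = "{{0} \<times> A | A. A \<in> sets (F 0)} \<union>
      {{s<..t} \<times> A | s t A. 0 \<le> s \<and> s < t \<and> t \<le> T \<and> A \<in> sets (F s)}"
  have [measurable]: "(\<lambda>p::'w \<times> (real \<times> 'a). fst (snd p)) \<in> borel_measurable ?Q"
    by (rule measurable_compose[OF measurable_snd]) (simp cong: measurable_cong_sets)
  have P: "{p \<in> space ?Q. ?P p} \<in> sets ?Q" by measurable
  let ?R = "restrict_space ?Q {p. ?P p}"
  have R: "A \<inter> {p. ?P p} \<in> sets ?R" if "A \<in> sets ?Q" for A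
    using that by (auto simp: sets_restrict_space)
  have 1: "(\<lambda>p::'w \<times> (real \<times> 'a). (fst (snd p), fst p)) \<in> measurable ?R (predictable_sigma M T F)"
    unfolding predictable_sigma_def
  proof (rule measurable_measure_of)
    have "A \<subseteq> space M" if "A \<in> sets (F t)" "t \<in> {0..<T}" for A t
      using F[OF that(2)] that(1) sets.sets_into_space by blast
    then show "?G \<subseteq> Pow ({0..T} \<times> space M)" using T by fastforce
    show "(\<lambda>p::'w \<times> (real \<times> 'a). (fst (snd p), fst p)) \<in> space ?R \<rightarrow> {0..T} \<times> space M"
      by (auto simp: space_restrict_space space_pair_measure)
    fix B assume "B \<in> ?G"
    then have "\<exists>I A. B = I \<times> A \<and> A \<in> sets M \<and> I \<in> sets borel"
    proof (elim UnE CollectE exE conjE)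
      fix A assume "B = {0} \<times> A" "A \<in> sets (F 0)"
      then show ?thesis using F[of 0] T by (intro exI[of _ "{0}"] exI[of _ A]) auto
    next
      fix s t A assume "B = {s<..t} \<times> A" "0 \<le> s" "s < t" "t \<le> T" "A \<in> sets (F s)"
      then show ?thesis using F[of s] by (intro exI[of _ "{s<..t}"] exI[of _ A]) auto
    qed
    then obtain I A where B: "B = I \<times> A" and A: "A \<in> sets M" and I: "I \<in> sets borel"
      by blast
    have "{p \<in> space ?Q. fst (snd p) \<in> I \<and> fst p \<in> A} \<in> sets ?Q"
      using A I by measurable
    from R[OF this]
    show "(\<lambda>p::'w \<times> (real \<times> 'a). (fst (snd p), fst p)) -` B \<inter> space ?R \<in> sets ?R"
      by (rule back_subst[of "\<lambda>A. A \<in> sets ?R"]) (auto simp: B space_restrict_space)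
  qed
  have 2: "(\<lambda>p::'w \<times> (real \<times> 'a). snd (snd p)) \<in> borel_measurable ?R"
    using \<nu>(2) by (intro measurable_restrict_space1 measurable_compose[OF measurable_snd])
      (simp cong: measurable_cong_sets)
  from measurable_compose[OF measurable_Pair[OF 1 2] U[unfolded predictable_field_def]]
  have "(\<lambda>p. U (fst (snd p)) (fst p) (snd (snd p))) \<in> borel_measurable ?R" by simp
  then have "(\<lambda>p. if ?P p then U (fst (snd p)) (fst p) (snd (snd p)) else 0) \<in> borel_measurable ?Q"
    using P by (subst measurable_If_restrict_space_iff) auto
  then show ?thesis by (simp add: joint_field_def case_prod_beta)
qed

lemma nn_integral_joint_field:
  assumes [measurable]: "joint_field T U \<in> borel_measurable (M \<Otimes>\<^sub>M (time_measure T \<Otimes>\<^sub>M \<nu>))" and \<omega>: "\<omega> \<in> space M"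
  shows "(\<integral>\<^sup>+ p. ennreal ((joint_field T U (\<omega>, p))\<^sup>2) \<partial>(time_measure T \<Otimes>\<^sub>M \<nu>))
    = (\<integral>\<^sup>+ t\<in>{0..T}. (\<integral>\<^sup>+ x. ennreal (\<bar>U t \<omega> x\<bar>\<^sup>2) \<partial>\<nu>) \<partial>lborel)"
proof -
  have "(\<lambda>p. ennreal ((joint_field T U (\<omega>, p))\<^sup>2)) \<in> borel_measurable (time_measure T \<Otimes>\<^sub>M \<nu>)"
    using \<omega> by measurable
  then show ?thesis
    by (subst nn_integral_time_space) (auto simp: joint_field_def indicator_def intro!: nn_integral_cong)
qed

lemma field_path_measurable:
  assumes M: "prob_space M" "complete_measure M"
    and U: "joint_field T U \<in> borel_measurable (M \<Otimes>\<^sub>M (time_measure T \<Otimes>\<^sub>M \<nu>))"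
    and fin: "(\<integral>\<^sup>+ \<omega>. (\<integral>\<^sup>+ t\<in>{0..T}. (\<integral>\<^sup>+ x. ennreal (\<bar>U t \<omega> x\<bar>\<^sup>2) \<partial>\<nu>) \<partial>lborel) \<partial>M) < \<infinity>"
  shows "field_path T \<nu> U \<in> measurable M (borel_of_dist (L2_space (time_measure T \<Otimes>\<^sub>M \<nu>)) (l2_dist (time_measure T \<Otimes>\<^sub>M \<nu>)))"
    and "AE \<omega> in M. \<forall>p. field_path T \<nu> U \<omega> p = joint_field T U (\<omega>, p)"
proof -
  interpret M: prob_space M by fact
  let ?L = "time_measure T \<Otimes>\<^sub>M \<nu>"
  note [measurable] = U
  define r where "r \<omega> = (\<integral>\<^sup>+ p. ennreal ((joint_field T U (\<omega>, p))\<^sup>2) \<partial>?L)" for \<omega>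
  have [measurable]: "r \<in> borel_measurable M" unfolding r_def by measurable
  have "(\<integral>\<^sup>+ \<omega>. r \<omega> \<partial>M) = (\<integral>\<^sup>+ \<omega>. (\<integral>\<^sup>+ t\<in>{0..T}. (\<integral>\<^sup>+ x. ennreal (\<bar>U t \<omega> x\<bar>\<^sup>2) \<partial>\<nu>) \<partial>lborel) \<partial>M)"
    unfolding r_def by (intro nn_integral_cong nn_integral_joint_field[OF U])
  then have rfin: "(\<integral>\<^sup>+ \<omega>. r \<omega> \<partial>M) < \<infinity>" using fin by simp
  then have "AE \<omega> in M. r \<omega> \<noteq> \<infinity>" by (intro nn_integral_noteq_infinite) auto
  then show ae: "AE \<omega> in M. \<forall>p. field_path T \<nu> U \<omega> p = joint_field T U (\<omega>, p)"
    using AE_space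
  proof eventually_elim
    case (elim \<omega>)
    have h: "(\<lambda>(t, x). if t \<in> {0..T} then U t \<omega> x else 0) = (\<lambda>p. joint_field T U (\<omega>, p))"
      by (auto simp: joint_field_def)
    have "(\<lambda>p. joint_field T U (\<omega>, p)) \<in> borel_measurable ?L" using elim by measurable
    moreover from this have "integrable ?L (\<lambda>p. (joint_field T U (\<omega>, p))\<^sup>2)"
      using elim(1) by (intro integrableI_nonneg) (auto simp: r_def less_top)
    ultimately have "(\<lambda>p. joint_field T U (\<omega>, p)) \<in> L2_space ?L" by (simp add: L2_space_def)
    then show ?case unfolding field_path_def Let_def h by simp
  qed
  show "field_path T \<nu> U \<in> measurable M (borel_of_dist (L2_space ?L) (l2_dist ?L))"
  proof (rule measurable_field[OF M(1) sigma_finite_time_space M(2) U])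
    show "(\<integral>\<^sup>+ p. ennreal ((joint_field T U p)\<^sup>2) \<partial>(M \<Otimes>\<^sub>M ?L)) < \<infinity>"
      using rfin unfolding r_def by (subst (asm) sigma_finite_measure.nn_integral_fst[OF sigma_finite_time_space]) auto
    show "field_path T \<nu> U \<omega> \<in> L2_space ?L" for \<omega>
    proof -
      have "(\<lambda>_. 0) \<in> L2_space ?L" by (simp add: L2_space_def)
      then show ?thesis by (simp add: field_path_def Let_def)
    qed
    show "AE \<omega> in M. \<forall>p\<in>space ?L. field_path T \<nu> U \<omega> p = joint_field T U (\<omega>, p)"
      using ae by eventually_elim auto
  qed
qed

text \<open>After coupling by the joint law, Tonelli moves the expectation innermost, the order of
  integration used in \<open>stability_constant\<close>. The replacement by 0 in
  \<open>field_path\<close> affects only a null event.\<close>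

lemma wasserstein_field_law_le:
  assumes M: "prob_space M" "complete_measure M"
    and U: "joint_field T U \<in> borel_measurable (M \<Otimes>\<^sub>M (time_measure T \<Otimes>\<^sub>M \<nu>))"
      "(\<integral>\<^sup>+ \<omega>. (\<integral>\<^sup>+ t\<in>{0..T}. (\<integral>\<^sup>+ x. ennreal (\<bar>U t \<omega> x\<bar>\<^sup>2) \<partial>\<nu>) \<partial>lborel) \<partial>M) < \<infinity>"
    and V: "joint_field T V \<in> borel_measurable (M \<Otimes>\<^sub>M (time_measure T \<Otimes>\<^sub>M \<nu>))"
      "(\<integral>\<^sup>+ \<omega>. (\<integral>\<^sup>+ t\<in>{0..T}. (\<integral>\<^sup>+ x. ennreal (\<bar>V t \<omega> x\<bar>\<^sup>2) \<partial>\<nu>) \<partial>lborel) \<partial>M) < \<infinity>"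
  shows "wasserstein (l2_edist (time_measure T \<Otimes>\<^sub>M \<nu>)) (field_law M T \<nu> V) (field_law M T \<nu> U)
    \<le> ennreal_sqrt (\<integral>\<^sup>+ t\<in>{0..T}. (\<integral>\<^sup>+ x. (\<integral>\<^sup>+ \<omega>. ennreal (\<bar>V t \<omega> x - U t \<omega> x\<bar>\<^sup>2) \<partial>M) \<partial>\<nu>) \<partial>lborel)"
proof -
  let ?L = "time_measure T \<Otimes>\<^sub>M \<nu>"
  note [measurable] = U(1) V(1)
  note fU = field_path_measurable[OF M U] and fV = field_path_measurable[OF M V]
  have "wasserstein (l2_edist ?L) (field_law M T \<nu> V) (field_law M T \<nu> U)
      \<le> ennreal_sqrt (\<integral>\<^sup>+ \<omega>. (l2_edist ?L (field_path T \<nu> V \<omega>) (field_path T \<nu> U \<omega>))\<^sup>2 \<partial>M)"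
    unfolding field_law_def by (rule wasserstein_distr_le[OF M(1) fV(1) fU(1)])
  also have "(\<integral>\<^sup>+ \<omega>. (l2_edist ?L (field_path T \<nu> V \<omega>) (field_path T \<nu> U \<omega>))\<^sup>2 \<partial>M)
      = (\<integral>\<^sup>+ \<omega>. (\<integral>\<^sup>+ p. ennreal ((joint_field T V (\<omega>, p) - joint_field T U (\<omega>, p))\<^sup>2) \<partial>?L) \<partial>M)"
  proof (rule nn_integral_cong_AE)
    show "AE \<omega> in M. (l2_edist ?L (field_path T \<nu> V \<omega>) (field_path T \<nu> U \<omega>))\<^sup>2
        = (\<integral>\<^sup>+ p. ennreal ((joint_field T V (\<omega>, p) - joint_field T U (\<omega>, p))\<^sup>2) \<partial>?L)"
      using fU(2) fV(2) by eventually_elim (simp add: l2_edist_def power2_commute del: split_paired_All)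
  qed
  also have "\<dots> = (\<integral>\<^sup>+ t\<in>{0..T}. (\<integral>\<^sup>+ x. (\<integral>\<^sup>+ \<omega>. ennreal ((joint_field T V (\<omega>, (t, x)) - joint_field T U (\<omega>, (t, x)))\<^sup>2) \<partial>M) \<partial>\<nu>) \<partial>lborel)"
    by (rule nn_integral_time_space_swap[OF M(1),
      of "\<lambda>p. ennreal ((joint_field T V p - joint_field T U p)\<^sup>2)"]) measurable
  also have "\<dots> = (\<integral>\<^sup>+ t\<in>{0..T}. (\<integral>\<^sup>+ x. (\<integral>\<^sup>+ \<omega>. ennreal (\<bar>V t \<omega> x - U t \<omega> x\<bar>\<^sup>2) \<partial>M) \<partial>\<nu>) \<partial>lborel)"
    by (intro nn_integral_cong) (auto simp: joint_field_def indicator_def)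
  finally show ?thesis .
qed

end

section \<open>The Levy process and its truncations\<close>

lemma sets_natural_filtration:
  "sets (natural_filtration M X t) =
    sigma_sets (space M) (\<Union>s\<in>{0..t}. {X s -` A \<inter> space M | A. A \<in> sets borel})"
  unfolding natural_filtration_def by (rule sets_measure_of) auto

lemma space_natural_filtration [simp]: "space (natural_filtration M X t) = space M"
  unfolding natural_filtration_def by (rule space_measure_of) auto

lemma measurable_natural_filtration:
  assumes "s \<in> {0..t}"
  shows "X s \<in> borel_measurable (natural_filtration M X t)"
proof (rule measurableI)
  fix A :: "'b set" assume "A \<in> sets borel"
  then have "X s -` A \<inter> space M \<in> (\<Union>s\<in>{0..t}. {X s -` A \<inter> space M | A. A \<in> sets borel})"
    using assms by blast
  then show "X s -` A \<inter> space (natural_filtration M X t) \<in> sets (natural_filtration M X t)"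
    by (simp add: sets_natural_filtration)
qed simp

lemma sets_natural_filtration_subset:
  assumes "\<And>s. s \<in> {0..t} \<Longrightarrow> X s \<in> borel_measurable M"
  shows "sets (natural_filtration M X t) \<subseteq> sets M"
  unfolding sets_natural_filtration using assms
  by (intro sets.sigma_sets_subset) (auto intro: measurable_sets)

lemma sets_usual_augmentation:
  assumes "\<And>s. sets (F s) \<subseteq> Pow (space M)"
  shows "sets (usual_augmentation M T F t) = sigma_sets (space M)
    (\<Inter>s\<in>insert T {t<..<T}. sigma_sets (space M) (sets (F s) \<union> null_sets M))"
  unfolding usual_augmentation_def
proof (rule sets_measure_of)
  have "sets (F T) \<union> null_sets M \<subseteq> Pow (space M)"
    using assms[of T] sets.sets_into_space[of _ M] by auto
  then have "sigma_sets (space M) (sets (F T) \<union> null_sets M) \<subseteq> Pow (space M)"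
    using sigma_sets_into_sp by blast
  then show "(\<Inter>s\<in>insert T {t<..<T}. sigma_sets (space M) (sets (F s) \<union> null_sets M)) \<subseteq> Pow (space M)"
    by blast
qed

lemma space_usual_augmentation [simp]:
  assumes "\<And>s. sets (F s) \<subseteq> Pow (space M)"
  shows "space (usual_augmentation M T F t) = space M"
  unfolding usual_augmentation_def
proof (rule space_measure_of)
  have "sets (F T) \<union> null_sets M \<subseteq> Pow (space M)"
    using assms[of T] sets.sets_into_space[of _ M] by auto
  then have "sigma_sets (space M) (sets (F T) \<union> null_sets M) \<subseteq> Pow (space M)"
    using sigma_sets_into_sp by blast
  then show "(\<Inter>s\<in>insert T {t<..<T}. sigma_sets (space M) (sets (F s) \<union> null_sets M)) \<subseteq> Pow (space M)"
    by blast
qed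

lemma natural_filtration_Pow: "sets (natural_filtration M X s) \<subseteq> Pow (space M)"
  using sets.space_closed[of "natural_filtration M X s"] by simp

text \<open>The index T takes part in every intersection that defines the augmentation, so each is
  contained in the sigma-algebra of T enlarged by null sets, which are events of
  \<open>M\<close>.\<close>

lemma sets_levy_filtration_subset:
  assumes "\<And>s. s \<in> {0..T} \<Longrightarrow> X s \<in> borel_measurable M"
  shows "sets (levy_filtration M T X t) \<subseteq> sets M"
  unfolding levy_filtration_def sets_usual_augmentation[OF natural_filtration_Pow]
proof (rule sets.sigma_sets_subset)
  have "sigma_sets (space M) (sets (natural_filtration M X T) \<union> null_sets M) \<subseteq> sets M"
    using sets_natural_filtration_subset[of T X M] assms by (intro sets.sigma_sets_subset) auto
  then show "(\<Inter>s\<in>insert T {t<..<T}. sigma_sets (space M) (sets (natural_filtration M X s) \<union> null_sets M)) \<subseteq> sets M"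
    by blast
qed

lemma space_levy_filtration [simp]: "space (levy_filtration M T X t) = space M"
  unfolding levy_filtration_def by (rule space_usual_augmentation[OF natural_filtration_Pow])

lemma measurable_levy_filtration:
  assumes "0 \<le> T"
  shows "X T \<in> borel_measurable (levy_filtration M T X T)"
proof -
  \<comment> \<open>At the terminal time the intersection has T as its only index, because no s
    satisfies T < s < T.\<close>
  have "sets (natural_filtration M X T) \<subseteq> sets (levy_filtration M T X T)"
    unfolding levy_filtration_def sets_usual_augmentation[OF natural_filtration_Pow]
    by (auto intro!: sigma_sets.Basic)
  then have "subalgebra (levy_filtration M T X T) (natural_filtration M X T)"
    by (simp add: subalgebra_def)
  then show ?thesis
    by (rule measurable_from_subalg) (use assms in \<open>simp add: measurable_natural_filtration\<close>)
qed

lemma subalgebra_borel_measurable: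
  assumes "sets F \<subseteq> sets M" "space F = space M" "f \<in> borel_measurable F"
  shows "f \<in> borel_measurable M"
  using assms by (intro measurable_from_subalg[of M F]) (auto simp: subalgebra_def)

text \<open>Carries the restrictions on time and jump size in the integrand, so that integrals over
  cut measures become integrals against the full random measure and \<open>\<Lambda>\<close>, to
  which the isometry applies.\<close>

definition jump_field :: "real \<Rightarrow> real \<Rightarrow> real \<times> 'a::real_normed_vector \<Rightarrow> 'a" where
  "jump_field e t p = (if 0 < fst p \<and> fst p \<le> t \<and> e \<le> norm (snd p) then snd p else 0)"

section \<open>Moments of the Levy measure and compensated sums of large jumps\<close>

locale levy =
  fixes M :: "'w measure" and T :: real and X :: "real \<Rightarrow> 'w \<Rightarrow> 'a::euclidean_space" and \<nu> :: "'a measure"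
  assumes setting: "levy_setting M T X \<nu>" and T_pos: "0 < T"
begin

abbreviation "\<Lambda> \<equiv> time_measure T \<Otimes>\<^sub>M \<nu>"

lemma prob: "prob_space M" and complete: "complete_measure M"
  using setting by (auto simp: levy_setting_def)

sublocale N: poisson_measure M "jumps_of T X" \<Lambda>
  using setting by (simp add: poisson_measure_def poisson_measure_axioms_def levy_setting_def)

lemma sets_\<nu>: "sets \<nu> = sets borel"
  using setting by (simp add: levy_setting_def levy_measure_def)

lemma measurable_\<nu> [simp]: "borel_measurable \<nu> = borel_measurable borel"
  using sets_\<nu> by (rule measurable_cong_sets) simp

lemma X_measurable: "t \<in> {0..T} \<Longrightarrow> X t \<in> borel_measurable M"
  using setting by (simp add: levy_setting_def levy_process_def)

text \<open>Jumps below 1 are controlled by the Levy property of the measure, the others by the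
  square integrability in \<open>levy_setting\<close>.\<close>

lemma second_moment_finite: "(\<integral>\<^sup>+ x. ennreal ((norm x)\<^sup>2) \<partial>\<nu>) < \<infinity>"
proof -
  have "(\<integral>\<^sup>+ x. ennreal ((norm x)\<^sup>2) \<partial>\<nu>)
      \<le> (\<integral>\<^sup>+ x. ennreal (min 1 ((norm x)\<^sup>2)) + ennreal ((norm x)\<^sup>2) * indicator {x. 1 \<le> norm x} x \<partial>\<nu>)"
  proof (intro nn_integral_mono)
    fix x :: 'a
    show "ennreal ((norm x)\<^sup>2) \<le> ennreal (min 1 ((norm x)\<^sup>2)) + ennreal ((norm x)\<^sup>2) * indicator {x. 1 \<le> norm x} x"
    proof (cases "1 \<le> norm x")
      case False
      then have "(norm x)\<^sup>2 \<le> 1" by (simp add: power_le_one)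
      then show ?thesis using False by simp
    qed simp
  qed
  also have "\<dots> = (\<integral>\<^sup>+ x. ennreal (min 1 ((norm x)\<^sup>2)) \<partial>\<nu>) + (\<integral>\<^sup>+ x\<in>{x. 1 \<le> norm x}. ennreal ((norm x)\<^sup>2) \<partial>\<nu>)"
    by (rule nn_integral_add) simp_all
  also have "\<dots> < \<infinity>"
    using setting by (simp add: levy_setting_def levy_measure_def)
  finally show ?thesis .
qed

text \<open>Chebyshev's inequality with the second moment.\<close>

lemma emeasure_large_jumps:
  assumes "0 < e"
  shows "emeasure \<nu> {x. e \<le> norm x} < \<infinity>"
proof -
  have [simp]: "{x. e \<le> norm x} \<in> sets \<nu>" by (simp add: sets_\<nu>)
  have "ennreal (e\<^sup>2) * emeasure \<nu> {x. e \<le> norm x} = (\<integral>\<^sup>+ x. ennreal (e\<^sup>2) * indicator {x. e \<le> norm x} x \<partial>\<nu>)"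
    by (simp add: nn_integral_cmult_indicator)
  also have "\<dots> \<le> (\<integral>\<^sup>+ x. ennreal ((norm x)\<^sup>2) \<partial>\<nu>)"
    using assms by (intro nn_integral_mono) (auto simp: indicator_def intro!: ennreal_leI power_mono)
  finally have "ennreal (e\<^sup>2) * emeasure \<nu> {x. e \<le> norm x} < \<infinity>"
    using second_moment_finite by (rule le_less_trans)
  then show ?thesis using assms by (auto simp: ennreal_mult_less_top)
qed

text \<open>The origin is a null set, and the rest is exhausted by the sets of jumps of size at
  least 1/(n+1), which have finite mass.\<close>

lemma sigma_finite_\<nu>: "sigma_finite_measure \<nu>"
proof
  let ?A = "insert {0} (range (\<lambda>n::nat. {x::'a. 1 / real (Suc n) \<le> norm x}))"
  have "x \<in> \<Union> ?A" for x :: 'a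
  proof (cases "x = 0")
    case False
    then obtain n :: nat where "1 / real (Suc n) < norm x" using nat_approx_posE[of "norm x"] by auto
    then have "x \<in> {x. 1 / real (Suc n) \<le> norm x}" by simp
    then show ?thesis by blast
  qed simp
  moreover have "space \<nu> = UNIV" using sets_eq_imp_space_eq[OF sets_\<nu>] by simp
  ultimately have "\<Union> ?A = space \<nu>" by blast
  moreover have "?A \<subseteq> sets \<nu>" by (auto simp: sets_\<nu>)
  moreover have "emeasure \<nu> a \<noteq> \<infinity>" if "a \<in> ?A" for a
  proof (cases "a = {0}")
    case True
    then show ?thesis using setting by (simp add: levy_setting_def levy_measure_def)
  next
    case False
    then have "a \<in> range (\<lambda>n::nat. {x::'a. 1 / real (Suc n) \<le> norm x})"
      using that by (simp only: insert_iff simp_thms)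
    then obtain n :: nat where "a = {x::'a. 1 / real (Suc n) \<le> norm x}" by (rule rangeE)
    then show ?thesis using emeasure_large_jumps[of "1 / real (Suc n)"] by auto
  qed
  ultimately show "\<exists>A. countable A \<and> A \<subseteq> sets \<nu> \<and> \<Union> A = space \<nu> \<and> (\<forall>a\<in>A. emeasure \<nu> a \<noteq> \<infinity>)"
    by (intro exI[of _ ?A]) auto
qed

lemma sets_\<Lambda>: "sets \<Lambda> = sets borel"
  using sets_time_space[OF sigma_finite_\<nu> sets_\<nu>, of T] by (simp only: borel_prod)

lemma measurable_\<Lambda> [simp]: "borel_measurable \<Lambda> = borel_measurable borel"
  using sets_\<Lambda> by (rule measurable_cong_sets) simp

lemma nn_integral_\<Lambda>_space:
  assumes [measurable]: "g \<in> borel_measurable borel"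
  shows "(\<integral>\<^sup>+ p. g (snd p) \<partial>\<Lambda>) = ennreal T * (\<integral>\<^sup>+ x. g x \<partial>\<nu>)"
proof -
  have "(\<lambda>p. g (snd p)) \<in> borel_measurable (borel :: (real \<times> 'a) measure)"
    unfolding borel_prod[symmetric] by measurable
  then have "(\<integral>\<^sup>+ p. g (snd p) \<partial>\<Lambda>) = (\<integral>\<^sup>+ t\<in>{0..T}. (\<integral>\<^sup>+ x. g x \<partial>\<nu>) \<partial>lborel)"
    by (subst nn_integral_time_space[OF sigma_finite_\<nu> sets_\<nu>]) simp_all
  also have "\<dots> = (\<integral>\<^sup>+ x. g x \<partial>\<nu>) * ennreal T"
    using T_pos by (simp add: nn_integral_cmult_indicator)
  finally show ?thesis by (simp add: mult.commute)
qed

lemma jump_field_measurable [measurable]: "jump_field e t \<in> borel_measurable (borel :: (real \<times> 'a) measure)"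
  unfolding jump_field_def[abs_def] borel_prod[symmetric] by measurable

lemma second_moment_\<Lambda>: "integrable \<Lambda> (\<lambda>p. (norm (snd p))\<^sup>2)"
proof (rule integrableI_nonneg)
  show "(\<integral>\<^sup>+ p. ennreal ((norm (snd p))\<^sup>2) \<partial>\<Lambda>) < \<infinity>"
    using second_moment_finite
    by (subst nn_integral_\<Lambda>_space) (auto simp: ennreal_mult_less_top)
qed (simp_all add: borel_prod[symmetric])

text \<open>Where |x| >= e one has |x| <= |x|^2 / e, so truncation lets the second moment control
  the first.\<close>

lemma jump_field_integrable:
  assumes e: "0 < e"
  shows "integrable \<Lambda> (jump_field e t)" "integrable \<Lambda> (\<lambda>p. (norm (jump_field e t p))\<^sup>2)"
proof -
  have "integrable \<Lambda> (\<lambda>p. (norm (snd p))\<^sup>2 / e)" using second_moment_\<Lambda> by simp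
  then show "integrable \<Lambda> (jump_field e t)"
  proof (rule Bochner_Integration.integrable_bound)
    have "norm x \<le> (norm x)\<^sup>2 / e" if "e \<le> norm x" for x :: 'a
      using that e mult_right_mono[OF that norm_ge_zero[of x]] by (simp add: field_simps power2_eq_square)
    then show "AE p in \<Lambda>. norm (jump_field e t p) \<le> norm ((norm (snd p))\<^sup>2 / e)"
      using e by (intro AE_I2) (simp add: jump_field_def)
  qed simp
  show "integrable \<Lambda> (\<lambda>p. (norm (jump_field e t p))\<^sup>2)"
  proof (rule Bochner_Integration.integrable_bound[OF second_moment_\<Lambda>])
    show "AE p in \<Lambda>. norm ((norm (jump_field e t p))\<^sup>2) \<le> norm ((norm (snd p))\<^sup>2)"
      by (intro AE_I2) (simp add: jump_field_def)
  qed simp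
qed

text \<open>The cut measures are densities, so the cuts become factors of the integrand. The
  compensator uses Lebesgue measure on the whole line while \<open>\<Lambda>\<close> carries only
  [0,T]; for t <= T the integrand vanishes outside [0,T].\<close>

lemma compensated_eq:
  assumes e: "0 < e" and t: "t \<in> {0..T}" and \<omega>: "\<omega> \<in> space M"
  shows "pathwise_compensated_integral (cut_jumps e (jumps_of T X \<omega>)) (cut_levy e \<nu>) (\<lambda>s x. x) 0 t
    = (\<integral>p. jump_field e t p \<partial>jumps_of T X \<omega>) - (\<integral>p. jump_field e t p \<partial>\<Lambda>)"
proof -
  let ?I = "\<lambda>p::real \<times> 'a. indicator ({0<..t} \<times> UNIV) p *\<^sub>R snd p"
  have I [measurable]: "?I \<in> borel_measurable (borel :: (real \<times> 'a) measure)"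
    unfolding borel_prod[symmetric] by measurable
  have J: "indicat_real {p. e \<le> norm (snd p)} \<in> borel_measurable (borel :: (real \<times> 'a) measure)"
    unfolding borel_prod[symmetric] by measurable
  have ji: "indicat_real {p. e \<le> norm (snd p)} p *\<^sub>R ?I p = jump_field e t p" for p
    by (cases p) (auto simp: jump_field_def indicator_def)
  have bN: "borel_measurable (jumps_of T X \<omega>) = borel_measurable borel"
    using N.measurable_N[OF \<omega>] by simp
  have "(LINT p:{0<..t} \<times> UNIV|cut_jumps e (jumps_of T X \<omega>). snd p)
      = (\<integral>p. ?I p \<partial>density (jumps_of T X \<omega>) (\<lambda>p. ennreal (indicat_real {p. e \<le> norm (snd p)} p)))"
    by (simp add: cut_jumps_def set_lebesgue_integral_def ennreal_indicator)
  also have "\<dots> = (\<integral>p. indicat_real {p. e \<le> norm (snd p)} p *\<^sub>R ?I p \<partial>jumps_of T X \<omega>)"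
    using J I by (intro integral_density) (auto simp: bN)
  also have "\<dots> = (\<integral>p. jump_field e t p \<partial>jumps_of T X \<omega>)" by (simp only: ji)
  finally have 1: "(LINT p:{0<..t} \<times> UNIV|cut_jumps e (jumps_of T X \<omega>). snd p)
      = (\<integral>p. jump_field e t p \<partial>jumps_of T X \<omega>)" .
  have em: "(indicator {x. e \<le> norm x} :: 'a \<Rightarrow> ennreal) \<in> borel_measurable \<nu>" by simp
  \<comment> \<open>\<open>pair_measure_density\<close> asks for this; the truncated Levy measure is
    even finite.\<close>
  have "sigma_finite_measure (cut_levy e \<nu>)"
  proof -
    have "emeasure (cut_levy e \<nu>) (space (cut_levy e \<nu>)) = emeasure \<nu> {x. e \<le> norm x}"
      unfolding cut_levy_def using sets_eq_imp_space_eq[OF sets_\<nu>]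
      by (subst emeasure_density) (auto simp: sets_\<nu>)
    then have "finite_measure (cut_levy e \<nu>)"
      using emeasure_large_jumps[OF e] by (intro finite_measureI) auto
    then show ?thesis by (simp add: finite_measure_def)
  qed
  then have cut: "lborel \<Otimes>\<^sub>M cut_levy e \<nu> = density (lborel \<Otimes>\<^sub>M \<nu>) (\<lambda>(s, x). 1 * indicator {x. e \<le> norm x} x)"
    using pair_measure_density[of "\<lambda>_. 1" lborel "indicator {x. e \<le> norm x}" \<nu>] sigma_finite_\<nu>
    by (simp add: cut_levy_def density_1)
  have wt: "(\<lambda>(s, x). 1 * indicator {x. e \<le> norm x} x)
      = (\<lambda>p :: real \<times> 'a. ennreal (indicat_real {p. e \<le> norm (snd p)} p))"
    by (auto simp: fun_eq_iff indicator_def)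
  have "\<Lambda> = density lborel (indicator {0..T}) \<Otimes>\<^sub>M density \<nu> (\<lambda>_. 1)"
    by (simp add: time_measure_def density_1)
  also have "\<dots> = density (lborel \<Otimes>\<^sub>M \<nu>) (\<lambda>(s, x). indicator {0..T} s * 1)"
    using sigma_finite_\<nu> by (intro pair_measure_density) (simp_all add: density_1)
  finally have L: "\<Lambda> = density (lborel \<Otimes>\<^sub>M \<nu>) (\<lambda>p. ennreal (indicat_real ({0..T} \<times> UNIV) p))"
    by (simp add: ennreal_indicator case_prod_beta' indicator_times)
  have b2: "borel_measurable (lborel \<Otimes>\<^sub>M \<nu>) = borel_measurable (borel :: (real \<times> 'a) measure)"
    unfolding borel_prod[symmetric] by (intro measurable_cong_sets sets_pair_measure_cong) (auto simp: sets_\<nu>)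
  have "(LINT p:{0<..t} \<times> UNIV|(lborel \<Otimes>\<^sub>M cut_levy e \<nu>). snd p)
      = (\<integral>p. ?I p \<partial>density (lborel \<Otimes>\<^sub>M \<nu>) (\<lambda>p. ennreal (indicat_real {p. e \<le> norm (snd p)} p)))"
    unfolding cut wt set_lebesgue_integral_def by (rule refl)
  also have "\<dots> = (\<integral>p. indicat_real {p. e \<le> norm (snd p)} p *\<^sub>R ?I p \<partial>(lborel \<Otimes>\<^sub>M \<nu>))"
    using J I by (intro integral_density) (auto simp: b2)
  also have "\<dots> = (\<integral>p. jump_field e t p \<partial>(lborel \<Otimes>\<^sub>M \<nu>))" by (simp only: ji)
  also have "\<dots> = (\<integral>p. indicat_real ({0..T} \<times> UNIV) p *\<^sub>R jump_field e t p \<partial>(lborel \<Otimes>\<^sub>M \<nu>))"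
    using t by (intro Bochner_Integration.integral_cong) (auto simp: jump_field_def indicator_def)
  also have "\<dots> = (\<integral>p. jump_field e t p \<partial>\<Lambda>)"
  proof -
    have "indicat_real ({0..T} \<times> UNIV) \<in> borel_measurable (lborel \<Otimes>\<^sub>M \<nu>)"
      unfolding b2 by (simp add: borel_prod[symmetric])
    then have "(\<integral>p. jump_field e t p \<partial>density (lborel \<Otimes>\<^sub>M \<nu>) (\<lambda>p. ennreal (indicat_real ({0..T} \<times> UNIV) p)))
        = (\<integral>p. indicat_real ({0..T} \<times> UNIV) p *\<^sub>R jump_field e t p \<partial>(lborel \<Otimes>\<^sub>M \<nu>))"
      by (intro integral_density) (simp_all add: b2)
    then show ?thesis using arg_cong[OF L, of "\<lambda>m. \<integral>p. jump_field e t p \<partial>m"] by (simp only:)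
  qed
  finally show ?thesis using 1 by (simp add: pathwise_compensated_integral_def)
qed

text \<open>The truncation in the form to which the isometry applies. It coincides with
  \<open>truncated_levy\<close> for n at least 1 and times in [0,T], and is measurable without these
  restrictions.\<close>

definition compensated_jumps :: "nat \<Rightarrow> real \<Rightarrow> 'w \<Rightarrow> 'a" where
  "compensated_jumps n t \<omega> = (\<integral>p. jump_field (1 / real n) t p \<partial>jumps_of T X \<omega>) - (\<integral>p. jump_field (1 / real n) t p \<partial>\<Lambda>)"

lemma truncated_levy_eq:
  assumes "1 \<le> n" "t \<in> {0..T}" "\<omega> \<in> space M"
  shows "truncated_levy T X \<nu> n t \<omega> = compensated_jumps n t \<omega>"
  using compensated_eq[OF _ assms(2,3), of "1 / real n"] assms(1) by (simp add: truncated_levy_def compensated_jumps_def)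

lemma compensated_jumps_measurable: "compensated_jumps n t \<in> borel_measurable M"
  unfolding compensated_jumps_def[abs_def] by (intro borel_measurable_diff N.measurable_integral_N) simp_all

lemma truncated_levy_measurable:
  assumes "1 \<le> n" "t \<in> {0..T}"
  shows "truncated_levy T X \<nu> n t \<in> borel_measurable M"
  using compensated_jumps_measurable[of n t] truncated_levy_eq[OF assms] by (simp cong: measurable_cong)

section \<open>Mean-square distance of the truncations from the process\<close>

lemma compensated_jumps_second_moment:
  assumes "1 \<le> n"
  shows "(\<integral>\<^sup>+ \<omega>. ennreal ((norm (compensated_jumps n t \<omega>))\<^sup>2) \<partial>M) < \<infinity>"
proof -
  have i: "integrable \<Lambda> (jump_field (1 / real n) t)" "integrable \<Lambda> (\<lambda>p. (norm (jump_field (1 / real n) t p))\<^sup>2)"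
    using assms by (auto intro!: jump_field_integrable)
  have "(\<integral>\<^sup>+ \<omega>. ennreal ((norm (compensated_jumps n t \<omega>))\<^sup>2) \<partial>M) \<le> (\<integral>\<^sup>+ p. ennreal ((norm (jump_field (1 / real n) t p))\<^sup>2) \<partial>\<Lambda>)"
    unfolding compensated_jumps_def by (rule N.compensated_isometry_le_euclidean[OF i])
  also have "\<dots> < \<infinity>" using i(2) by (simp add: integrable_iff_bounded)
  finally show ?thesis .
qed

text \<open>Both terms integrate against the same random measure, so their difference is the
  compensated integral of the jumps of size between 1/m and 1/n. The lower cut 1/m keeps the
  integrand integrable, as the isometry requires.\<close>

lemma compensated_jumps_diff_le:
  assumes n: "1 \<le> n" "n \<le> m" and b: "0 < b" "b < 2"
  shows "(\<integral>\<^sup>+ \<omega>. ennreal ((norm (compensated_jumps m t \<omega> - compensated_jumps n t \<omega>))\<^sup>2) \<partial>M)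
    \<le> ennreal (T * (1 / real n) powr (2 - b)) * (\<integral>\<^sup>+ x. ennreal (norm x powr b) \<partial>\<nu>)"
proof -
  let ?m = "jump_field (1 / real m) t :: real \<times> 'a \<Rightarrow> 'a" and ?n = "jump_field (1 / real n) t :: real \<times> 'a \<Rightarrow> 'a"
  have m: "integrable \<Lambda> ?m" and n': "integrable \<Lambda> ?n" using n by (auto intro!: jump_field_integrable)
  have mn: "1 / real m \<le> 1 / real n" using n by (intro divide_left_mono) auto
  have diff: "?m p - ?n p = (if 1 / real n \<le> norm (snd p) then 0 else ?m p)" for p
    using mn by (auto simp: jump_field_def)
  have i2: "integrable \<Lambda> (\<lambda>p. (norm (?m p - ?n p))\<^sup>2)"
  proof (rule Bochner_Integration.integrable_bound[OF second_moment_\<Lambda>])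
    show "AE p in \<Lambda>. norm ((norm (?m p - ?n p))\<^sup>2) \<le> norm ((norm (snd p))\<^sup>2)"
      by (intro AE_I2) (simp add: jump_field_def)
  qed simp
  have "(\<integral>\<^sup>+ \<omega>. ennreal ((norm (compensated_jumps m t \<omega> - compensated_jumps n t \<omega>))\<^sup>2) \<partial>M)
      = (\<integral>\<^sup>+ \<omega>. ennreal ((norm ((\<integral>p. ?m p - ?n p \<partial>jumps_of T X \<omega>) - (\<integral>p. ?m p - ?n p \<partial>\<Lambda>)))\<^sup>2) \<partial>M)"
  proof (rule nn_integral_cong_AE)
    show "AE \<omega> in M. ennreal ((norm (compensated_jumps m t \<omega> - compensated_jumps n t \<omega>))\<^sup>2)
        = ennreal ((norm ((\<integral>p. ?m p - ?n p \<partial>jumps_of T X \<omega>) - (\<integral>p. ?m p - ?n p \<partial>\<Lambda>)))\<^sup>2)"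
      using N.AE_integrable_N[OF m] N.AE_integrable_N[OF n']
      by eventually_elim (simp add: compensated_jumps_def m n' algebra_simps)
  qed
  also have "\<dots> \<le> (\<integral>\<^sup>+ p. ennreal ((norm (?m p - ?n p))\<^sup>2) \<partial>\<Lambda>)"
    by (rule N.compensated_isometry_le_euclidean[OF Bochner_Integration.integrable_diff[OF m n'] i2])
  also have "\<dots> \<le> (\<integral>\<^sup>+ p. ennreal ((1 / real n) powr (2 - b) * norm (snd p) powr b) \<partial>\<Lambda>)"
  proof (intro nn_integral_mono ennreal_leI)
    fix p :: "real \<times> 'a"
    show "(norm (?m p - ?n p))\<^sup>2 \<le> (1 / real n) powr (2 - b) * norm (snd p) powr b"
    proof (cases "1 / real n \<le> norm (snd p)")
      case True
      then show ?thesis by (simp add: diff)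
    next
      case False
      have "(norm (?m p - ?n p))\<^sup>2 \<le> (norm (snd p))\<^sup>2"
        by (intro power_mono) (auto simp: diff jump_field_def)
      also have "\<dots> = norm (snd p) powr (2 - b) * norm (snd p) powr b"
        by (simp flip: powr_add)
      \<comment> \<open>Here b < 2 enters: the power with exponent 2 - b is increasing, and the norm
        is below 1/n.\<close>
      also have "\<dots> \<le> (1 / real n) powr (2 - b) * norm (snd p) powr b"
        using False b by (intro mult_right_mono powr_mono2) auto
      finally show ?thesis .
    qed
  qed
  also have "\<dots> = ennreal T * (\<integral>\<^sup>+ x. ennreal ((1 / real n) powr (2 - b) * norm x powr b) \<partial>\<nu>)"
    by (rule nn_integral_\<Lambda>_space) simp
  also have "\<dots> = ennreal (T * (1 / real n) powr (2 - b)) * (\<integral>\<^sup>+ x. ennreal (norm x powr b) \<partial>\<nu>)"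
    using T_pos by (simp add: ennreal_mult nn_integral_cmult mult.assoc)
  finally show ?thesis .
qed

text \<open>The cut-offs 1/(j+1) in \<open>has_compensated_integral\<close> are those of the
  truncations with n = j + 1.\<close>

lemma X_limit:
  "(\<lambda>j. \<integral>\<^sup>+ \<omega>. ennreal ((norm (X T \<omega> - compensated_jumps (Suc j) T \<omega>))\<^sup>2) \<partial>M) \<longlonglongrightarrow> 0"
proof -
  have "has_compensated_integral M (jumps_of T X) \<nu> (\<lambda>s \<omega> x. x) 0 T (X T)"
    using setting T_pos by (simp add: levy_setting_def)
  then have "(\<lambda>j. \<integral>\<^sup>+ \<omega>. ennreal ((norm (X T \<omega> - truncated_levy T X \<nu> (Suc j) T \<omega>))\<^sup>2) \<partial>M) \<longlonglongrightarrow> 0"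
    by (simp add: has_compensated_integral_def Let_def truncated_levy_def)
  moreover have "(\<integral>\<^sup>+ \<omega>. ennreal ((norm (X T \<omega> - truncated_levy T X \<nu> (Suc j) T \<omega>))\<^sup>2) \<partial>M)
      = (\<integral>\<^sup>+ \<omega>. ennreal ((norm (X T \<omega> - compensated_jumps (Suc j) T \<omega>))\<^sup>2) \<partial>M)" for j
    using T_pos by (intro nn_integral_cong) (simp add: truncated_levy_eq)
  ultimately show ?thesis by simp
qed

lemma nn_integral_norm_add_le:
  fixes f g :: "'w \<Rightarrow> 'a"
  assumes [measurable]: "f \<in> borel_measurable M" "g \<in> borel_measurable M"
  shows "(\<integral>\<^sup>+ \<omega>. ennreal ((norm (f \<omega> + g \<omega>))\<^sup>2) \<partial>M)
    \<le> 2 * (\<integral>\<^sup>+ \<omega>. ennreal ((norm (f \<omega>))\<^sup>2) \<partial>M) + 2 * (\<integral>\<^sup>+ \<omega>. ennreal ((norm (g \<omega>))\<^sup>2) \<partial>M)"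
proof -
  have "(\<integral>\<^sup>+ \<omega>. ennreal ((norm (f \<omega> + g \<omega>))\<^sup>2) \<partial>M) \<le> (\<integral>\<^sup>+ \<omega>. ennreal ((norm (f \<omega>) + norm (g \<omega>))\<^sup>2) \<partial>M)"
    by (intro nn_integral_mono ennreal_leI power_mono norm_triangle_ineq) simp
  also have "\<dots> \<le> 2 * (\<integral>\<^sup>+ \<omega>. ennreal ((norm (f \<omega>))\<^sup>2) \<partial>M) + 2 * (\<integral>\<^sup>+ \<omega>. ennreal ((norm (g \<omega>))\<^sup>2) \<partial>M)"
    by (rule nn_integral_power2_add_le) simp_all
  finally show ?thesis .
qed

text \<open>Some truncation lies within mean-square distance 1 and has a finite second
  moment.\<close>

lemma X_second_moment: "(\<integral>\<^sup>+ \<omega>. ennreal ((norm (X T \<omega>))\<^sup>2) \<partial>M) < \<infinity>"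
proof -
  have [measurable]: "X T \<in> borel_measurable M" using X_measurable T_pos by simp
  note [measurable] = compensated_jumps_measurable
  have "eventually (\<lambda>j. (\<integral>\<^sup>+ \<omega>. ennreal ((norm (X T \<omega> - compensated_jumps (Suc j) T \<omega>))\<^sup>2) \<partial>M) < 1) sequentially"
    using X_limit by (rule order_tendstoD) simp
  then obtain j where j: "(\<integral>\<^sup>+ \<omega>. ennreal ((norm (X T \<omega> - compensated_jumps (Suc j) T \<omega>))\<^sup>2) \<partial>M) < 1"
    using eventually_happens[of _ sequentially] by auto
  have "(\<integral>\<^sup>+ \<omega>. ennreal ((norm (X T \<omega>))\<^sup>2) \<partial>M)
      \<le> 2 * (\<integral>\<^sup>+ \<omega>. ennreal ((norm (X T \<omega> - compensated_jumps (Suc j) T \<omega>))\<^sup>2) \<partial>M)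
        + 2 * (\<integral>\<^sup>+ \<omega>. ennreal ((norm (compensated_jumps (Suc j) T \<omega>))\<^sup>2) \<partial>M)"
    using nn_integral_norm_add_le[of "\<lambda>\<omega>. X T \<omega> - compensated_jumps (Suc j) T \<omega>" "compensated_jumps (Suc j) T"] by simp
  also have "\<dots> < \<infinity>"
    using order.strict_trans[OF j ennreal_one_less_top] compensated_jumps_second_moment[of "Suc j" T]
    by (auto simp: ennreal_mult_less_top)
  finally show ?thesis .
qed

text \<open>Passes through a truncation so fine that its mean squared distance to \<open>X T\<close>
  is below e/2; (a + b)^2 <= 2 a^2 + 2 b^2 doubles this to e and doubles the bound between
  truncations.\<close>

lemma X_diff_le:
  assumes n: "1 \<le> n" and b: "0 < b" "b < 2"
  shows "(\<integral>\<^sup>+ \<omega>. ennreal ((norm (X T \<omega> - compensated_jumps n T \<omega>))\<^sup>2) \<partial>M)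
    \<le> 2 * (ennreal (T * (1 / real n) powr (2 - b)) * (\<integral>\<^sup>+ x. ennreal (norm x powr b) \<partial>\<nu>))" (is "_ \<le> 2 * ?B")
proof (rule ennreal_le_epsilon)
  have [measurable]: "X T \<in> borel_measurable M" using X_measurable T_pos by simp
  note [measurable] = compensated_jumps_measurable
  fix e :: real assume e: "0 < e"
  then have "eventually (\<lambda>j. (\<integral>\<^sup>+ \<omega>. ennreal ((norm (X T \<omega> - compensated_jumps (Suc j) T \<omega>))\<^sup>2) \<partial>M) < ennreal (e / 2)) sequentially"
    by (intro order_tendstoD(2)[OF X_limit]) simp
  then have "eventually (\<lambda>j. n \<le> j \<and> (\<integral>\<^sup>+ \<omega>. ennreal ((norm (X T \<omega> - compensated_jumps (Suc j) T \<omega>))\<^sup>2) \<partial>M) < ennreal (e / 2)) sequentially"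
    using eventually_ge_at_top[of n] by eventually_elim simp
  then obtain j where j: "n \<le> j" "(\<integral>\<^sup>+ \<omega>. ennreal ((norm (X T \<omega> - compensated_jumps (Suc j) T \<omega>))\<^sup>2) \<partial>M) < ennreal (e / 2)"
    using eventually_happens[of _ sequentially] by auto
  have "(\<integral>\<^sup>+ \<omega>. ennreal ((norm (X T \<omega> - compensated_jumps n T \<omega>))\<^sup>2) \<partial>M)
      \<le> 2 * (\<integral>\<^sup>+ \<omega>. ennreal ((norm (X T \<omega> - compensated_jumps (Suc j) T \<omega>))\<^sup>2) \<partial>M)
        + 2 * (\<integral>\<^sup>+ \<omega>. ennreal ((norm (compensated_jumps (Suc j) T \<omega> - compensated_jumps n T \<omega>))\<^sup>2) \<partial>M)"
    using nn_integral_norm_add_le[of "\<lambda>\<omega>. X T \<omega> - compensated_jumps (Suc j) T \<omega>" "\<lambda>\<omega>. compensated_jumps (Suc j) T \<omega> - compensated_jumps n T \<omega>"] by simp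
  also have "\<dots> \<le> 2 * ennreal (e / 2) + 2 * ?B"
    using j compensated_jumps_diff_le[of n "Suc j" b T] n b by (intro add_mono mult_left_mono) auto
  also have "2 * ennreal (e / 2) = ennreal (2 * (e / 2))" using e by (subst ennreal_mult') auto
  finally show "(\<integral>\<^sup>+ \<omega>. ennreal ((norm (X T \<omega> - compensated_jumps n T \<omega>))\<^sup>2) \<partial>M) \<le> 2 * ?B + ennreal e"
    by (simp add: add.commute)
qed

text \<open>As the index is an infimum, some exponent c < b belongs to its set, and |x|^b <= |x|^c
  for |x| <= 1. Larger jumps are covered by the second moment because b < 2.\<close>

lemma beta_moment:
  assumes b: "blumenthal_getoor \<nu> < b" "b < 2"
  shows "0 < b" "integrable \<nu> (\<lambda>x. norm x powr b)"
proof -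
  let ?S = "{\<beta>. 0 < \<beta> \<and> (\<integral>\<^sup>+ x\<in>{x. norm x \<le> 1}. ennreal (norm x powr \<beta>) \<partial>\<nu>) < \<infinity>}"
  have "(\<integral>\<^sup>+ x\<in>{x. norm x \<le> 1}. ennreal (norm x powr 2) \<partial>\<nu>) \<le> (\<integral>\<^sup>+ x. ennreal ((norm x)\<^sup>2) \<partial>\<nu>)"
    by (intro nn_integral_mono) (auto simp: indicator_def)
  \<comment> \<open>The infimum of an empty set of reals would carry no information; the exponent 2
    shows that the set is nonempty.\<close>
  then have "2 \<in> ?S" using second_moment_finite by auto
  then have "?S \<noteq> {}" by blast
  then obtain c where c: "c \<in> ?S" "c < b"
    using cInf_lessD[of ?S b] b(1) unfolding blumenthal_getoor_def by blast
  then have c: "c < b" "0 < c" "(\<integral>\<^sup>+ x\<in>{x. norm x \<le> 1}. ennreal (norm x powr c) \<partial>\<nu>) < \<infinity>" by auto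
  then show "0 < b" by simp
  have "(\<integral>\<^sup>+ x. ennreal (norm x powr b) \<partial>\<nu>)
      \<le> (\<integral>\<^sup>+ x. ennreal (norm x powr c) * indicator {x. norm x \<le> 1} x + ennreal ((norm x)\<^sup>2) \<partial>\<nu>)"
  proof (intro nn_integral_mono)
    fix x :: 'a
    show "ennreal (norm x powr b) \<le> ennreal (norm x powr c) * indicator {x. norm x \<le> 1} x + ennreal ((norm x)\<^sup>2)"
    proof (cases "norm x \<le> 1")
      case True
      then have "norm x powr b \<le> norm x powr c" using c by (intro powr_mono') auto
      then have "ennreal (norm x powr b) \<le> ennreal (norm x powr c)" by (rule ennreal_leI)
      then show ?thesis using True by (simp add: add_increasing2)
    next
      case False
      then have "norm x powr b \<le> norm x powr 2" using b by (intro powr_mono) auto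
      then show ?thesis using False by (simp add: ennreal_leI)
    qed
  qed
  also have "\<dots> = (\<integral>\<^sup>+ x\<in>{x. norm x \<le> 1}. ennreal (norm x powr c) \<partial>\<nu>) + (\<integral>\<^sup>+ x. ennreal ((norm x)\<^sup>2) \<partial>\<nu>)"
    by (rule nn_integral_add) simp_all
  also have "\<dots> < \<infinity>" using c second_moment_finite by simp
  finally show "integrable \<nu> (\<lambda>x. norm x powr b)" by (intro integrableI_nonneg) auto
qed

end

section \<open>The Wasserstein bounds\<close>

text \<open>The square of a supremum is the supremum of products over pairs of times, and each
  product is at most the larger of the two squares.\<close>

lemma sup_dist_power2_le:
  "(sup_dist T y y')\<^sup>2 \<le> (SUP t\<in>{0..T}. ennreal (\<bar>y t - y' t\<bar>\<^sup>2))" (is "_ \<le> ?S")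
proof (cases "0 \<le> T")
  case True
  define a where "a t = ennreal \<bar>y t - y' t\<bar>" for t
  have a2: "a t * a t \<le> ?S" if "t \<in> {0..T}" for t
  proof -
    have "a t * a t = ennreal (\<bar>y t - y' t\<bar>\<^sup>2)"
      unfolding a_def power2_eq_square by (rule ennreal_mult[symmetric]) auto
    then show ?thesis using that by (intro SUP_upper2[of t]) auto
  qed
  have "a s * a t \<le> ?S" if "s \<in> {0..T}" "t \<in> {0..T}" for s t
  proof (cases "a s \<le> a t")
    case True
    then have "a s * a t \<le> a t * a t" by (rule mult_right_mono) simp
    also have "\<dots> \<le> ?S" by (rule a2[OF that(2)])
    finally show ?thesis .
  next
    case False
    then have "a s * a t \<le> a s * a s" by (intro mult_left_mono) auto
    also have "\<dots> \<le> ?S" by (rule a2[OF that(1)])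
    finally show ?thesis .
  qed
  then have "(SUP s\<in>{0..T}. a s) * a t \<le> ?S" if "t \<in> {0..T}" for t
    using that by (subst SUP_mult_right_ennreal) (auto intro: SUP_least)
  then have "(SUP s\<in>{0..T}. a s) * (SUP t\<in>{0..T}. a t) \<le> ?S"
    by (subst SUP_mult_left_ennreal) (auto intro: SUP_least)
  then show ?thesis by (simp add: sup_dist_def a_def power2_eq_square)
\<comment> \<open>For negative T the supremum runs over the empty set and is 0.\<close>
qed (simp add: sup_dist_def bot_ennreal)

lemma wasserstein_path_law_le:
  assumes M: "prob_space M" "complete_measure M" and T: "0 < T"
    and Y: "\<And>\<omega>. \<omega> \<in> space M \<Longrightarrow> cadlag T (\<lambda>t. Y t \<omega>)" "\<And>t. t \<in> {0..T} \<Longrightarrow> Y t \<in> borel_measurable M"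
    and Z: "\<And>\<omega>. \<omega> \<in> space M \<Longrightarrow> cadlag T (\<lambda>t. Z t \<omega>)" "\<And>t. t \<in> {0..T} \<Longrightarrow> Z t \<in> borel_measurable M"
  shows "wasserstein (sup_dist T) (path_law M T Y) (path_law M T Z)
    \<le> ennreal_sqrt (\<integral>\<^sup>+ \<omega>. (SUP t\<in>{0..T}. ennreal (\<bar>Y t \<omega> - Z t \<omega>\<bar>\<^sup>2)) \<partial>M)"
proof -
  have "wasserstein (sup_dist T) (path_law M T Y) (path_law M T Z)
      \<le> ennreal_sqrt (\<integral>\<^sup>+ \<omega>. (sup_dist T (restrict (\<lambda>t. Y t \<omega>) {0..T}) (restrict (\<lambda>t. Z t \<omega>) {0..T}))\<^sup>2 \<partial>M)"
    unfolding path_law_def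
    by (intro wasserstein_distr_le M(1) measurable_path[OF M(2) T] Y Z)
  also have "\<dots> \<le> ennreal_sqrt (\<integral>\<^sup>+ \<omega>. (SUP t\<in>{0..T}. ennreal (\<bar>Y t \<omega> - Z t \<omega>\<bar>\<^sup>2)) \<partial>M)"
    by (intro ennreal_sqrt_mono nn_integral_mono order.trans[OF sup_dist_power2_le]) (auto intro!: eq_refl SUP_cong)
  finally show ?thesis .
qed

lemma predictable_field_cut:
  fixes U :: "real \<Rightarrow> 'w \<Rightarrow> 'a::euclidean_space \<Rightarrow> real"
  assumes "predictable_field M T F U"
  shows "predictable_field M T F (\<lambda>t \<omega>. cut_fun e (U t \<omega>))"
proof -
  have "(\<lambda>p. indicat_real {x::'a. e \<le> norm x} (snd p)) \<in> borel_measurable (predictable_sigma M T F \<Otimes>\<^sub>M borel)"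
    by (intro measurable_compose[OF measurable_snd] borel_measurable_indicator) simp
  from borel_measurable_times[OF assms[unfolded predictable_field_def] this]
  show ?thesis by (simp add: predictable_field_def cut_fun_def case_prod_beta')
qed

section \<open>Terminal values of the two equations\<close>

context levy
begin

lemma nn_integral_cut_fun:
  assumes h: "h \<in> borel_measurable borel"
  shows "(\<integral>\<^sup>+ x. ennreal (\<bar>cut_fun e h x\<bar>\<^sup>2) \<partial>\<nu>) = (\<integral>\<^sup>+ x. ennreal (\<bar>h x\<bar>\<^sup>2) \<partial>cut_levy e \<nu>)"
proof -
  note [measurable] = h
  have "(\<integral>\<^sup>+ x. ennreal (\<bar>h x\<bar>\<^sup>2) \<partial>cut_levy e \<nu>)
      = (\<integral>\<^sup>+ x. indicator {x. e \<le> norm x} x * ennreal (\<bar>h x\<bar>\<^sup>2) \<partial>\<nu>)"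
    unfolding cut_levy_def by (rule nn_integral_density) simp_all
  also have "\<dots> = (\<integral>\<^sup>+ x. ennreal (\<bar>cut_fun e h x\<bar>\<^sup>2) \<partial>\<nu>)"
    by (intro nn_integral_cong) (auto simp: cut_fun_def indicator_def)
  finally show ?thesis ..
qed

text \<open>The factor 2 in the constant of the theorem pays for passing from X to a finer truncation first, as X is only
  given as the limit of its truncations.\<close>

lemma terminal_value_bound:
  fixes g :: "'a \<Rightarrow> real"
  assumes n: "1 \<le> n" and g: "\<And>x x'. \<bar>g x - g x'\<bar> \<le> Lg * norm (x - x')" and Lg: "0 \<le> Lg"
    and b: "blumenthal_getoor \<nu> < b" "b < 2"
  shows "ennreal_sqrt (\<integral>\<^sup>+ \<omega>. ennreal (\<bar>g (truncated_levy T X \<nu> n T \<omega>) - g (X T \<omega>)\<bar>\<^sup>2) \<partial>M)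
    \<le> ennreal (Lg * (2 * sqrt (LINT x|\<nu>. norm x powr b) * sqrt T / real n powr (1 - b / 2)))"
proof -
  have b0: "0 < b" and int: "integrable \<nu> (\<lambda>x. norm x powr b)" by (rule beta_moment[OF b])+
  define I where "I = (LINT x|\<nu>. norm x powr b)"
  have I: "0 \<le> I" "(\<integral>\<^sup>+ x. ennreal (norm x powr b) \<partial>\<nu>) = ennreal I"
    using int by (auto simp: I_def nn_integral_eq_integral)
  \<comment> \<open>The rate of the theorem; its square is the power of 1/n in
    \<open>X_diff_le\<close>.\<close>
  define q where "q = 1 / real n powr (1 - b / 2)"
  have q: "0 \<le> q" by (simp add: q_def)
  have "q\<^sup>2 = (1 / real n) powr (2 - b)"
  proof -
    have "q = (1 / real n) powr (1 - b / 2)" using n by (simp add: q_def powr_divide)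
    then have "q\<^sup>2 = (1 / real n) powr (1 - b / 2) * (1 / real n) powr (1 - b / 2)"
      by (simp add: power2_eq_square)
    also have "\<dots> = (1 / real n) powr (2 - b)" by (simp flip: powr_add)
    finally show ?thesis .
  qed
  then have q2: "(1 / real n) powr (2 - b) = q\<^sup>2" by simp
  have [measurable]: "X T \<in> borel_measurable M" using X_measurable T_pos by simp
  note [measurable] = compensated_jumps_measurable
  have "(\<integral>\<^sup>+ \<omega>. ennreal (\<bar>g (truncated_levy T X \<nu> n T \<omega>) - g (X T \<omega>)\<bar>\<^sup>2) \<partial>M)
      \<le> (\<integral>\<^sup>+ \<omega>. ennreal (Lg\<^sup>2) * ennreal ((norm (X T \<omega> - compensated_jumps n T \<omega>))\<^sup>2) \<partial>M)"
  proof (rule nn_integral_mono)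
    fix \<omega> assume \<omega>: "\<omega> \<in> space M"
    have "\<bar>g (truncated_levy T X \<nu> n T \<omega>) - g (X T \<omega>)\<bar> \<le> Lg * norm (X T \<omega> - compensated_jumps n T \<omega>)"
      using g[of "compensated_jumps n T \<omega>" "X T \<omega>"] T_pos truncated_levy_eq[OF n _ \<omega>, of T] by (simp add: norm_minus_commute)
    then have "\<bar>g (truncated_levy T X \<nu> n T \<omega>) - g (X T \<omega>)\<bar>\<^sup>2 \<le> (Lg * norm (X T \<omega> - compensated_jumps n T \<omega>))\<^sup>2"
      by (intro power_mono) auto
    then have "ennreal (\<bar>g (truncated_levy T X \<nu> n T \<omega>) - g (X T \<omega>)\<bar>\<^sup>2) \<le> ennreal (Lg\<^sup>2 * (norm (X T \<omega> - compensated_jumps n T \<omega>))\<^sup>2)"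
      unfolding power_mult_distrib by (rule ennreal_leI)
    then show "ennreal (\<bar>g (truncated_levy T X \<nu> n T \<omega>) - g (X T \<omega>)\<bar>\<^sup>2)
        \<le> ennreal (Lg\<^sup>2) * ennreal ((norm (X T \<omega> - compensated_jumps n T \<omega>))\<^sup>2)"
      by (simp add: ennreal_mult)
  qed
  also have "\<dots> = ennreal (Lg\<^sup>2) * (\<integral>\<^sup>+ \<omega>. ennreal ((norm (X T \<omega> - compensated_jumps n T \<omega>))\<^sup>2) \<partial>M)"
    by (simp add: nn_integral_cmult)
  also have "\<dots> \<le> ennreal (Lg\<^sup>2) * (2 * (ennreal (T * q\<^sup>2) * ennreal I))"
    using X_diff_le[OF n b0 b(2)] unfolding I(2) q2 by (intro mult_left_mono) auto
  also have "\<dots> = ennreal (Lg\<^sup>2 * (2 * (T * q\<^sup>2 * I)))"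
    using T_pos I q by (simp add: ennreal_mult)
  \<comment> \<open>The factor 2 of the constant squares to 4, while \<open>X_diff_le\<close> costs
    only 2, so there is room to spare.\<close>
  also have "\<dots> \<le> ennreal ((Lg * (2 * sqrt I * sqrt T * q))\<^sup>2)"
  proof (rule ennreal_leI)
    have "0 \<le> Lg\<^sup>2 * (T * q\<^sup>2 * I)" using T_pos I by simp
    moreover have "(Lg * (2 * sqrt I * sqrt T * q))\<^sup>2 = 4 * (Lg\<^sup>2 * (T * q\<^sup>2 * I))"
      using T_pos I by (simp add: power_mult_distrib)
    ultimately show "Lg\<^sup>2 * (2 * (T * q\<^sup>2 * I)) \<le> (Lg * (2 * sqrt I * sqrt T * q))\<^sup>2" by linarith
  qed
  finally have "ennreal_sqrt (\<integral>\<^sup>+ \<omega>. ennreal (\<bar>g (truncated_levy T X \<nu> n T \<omega>) - g (X T \<omega>)\<bar>\<^sup>2) \<partial>M)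
      \<le> ennreal_sqrt (ennreal ((Lg * (2 * sqrt I * sqrt T * q))\<^sup>2))"
    by (rule ennreal_sqrt_mono)
  also have "\<dots> = ennreal (Lg * (2 * sqrt I * sqrt T * q))"
    using Lg I T_pos q by (subst ennreal_sqrt_ennreal) auto
  finally show ?thesis by (simp add: I_def q_def)
qed

text \<open>A Lipschitz function grows at most linearly: |g z| <= |g 0| + Lg |z|.\<close>

lemma lipschitz_square_integrable:
  fixes g :: "'a \<Rightarrow> real"
  assumes g: "\<And>x x'. \<bar>g x - g x'\<bar> \<le> Lg * norm (x - x')" and [measurable]: "g \<in> borel_measurable borel"
    and [measurable]: "Z \<in> borel_measurable M" and Z: "(\<integral>\<^sup>+ \<omega>. ennreal ((norm (Z \<omega>))\<^sup>2) \<partial>M) < \<infinity>"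
  shows "integrable M (\<lambda>\<omega>. (g (Z \<omega>))\<^sup>2)"
proof -
  have "integrable M (\<lambda>\<omega>. (norm (Z \<omega>))\<^sup>2)" using Z by (intro integrableI_nonneg) auto
  then have "integrable M (\<lambda>\<omega>. 2 * (Lg\<^sup>2 * (norm (Z \<omega>))\<^sup>2) + 2 * (g 0)\<^sup>2)" by simp
  then show ?thesis
  proof (rule Bochner_Integration.integrable_bound)
    have "(g z)\<^sup>2 \<le> 2 * (Lg\<^sup>2 * (norm z)\<^sup>2) + 2 * (g 0)\<^sup>2" for z
    proof -
      have "\<bar>g z - g 0\<bar>\<^sup>2 \<le> (Lg * norm z)\<^sup>2" using g[of z 0] by (intro power_mono) auto
      then show ?thesis using power2_add_le[of "g z - g 0" "g 0"] by (simp add: power_mult_distrib)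
    qed
    then show "AE \<omega> in M. norm ((g (Z \<omega>))\<^sup>2) \<le> norm (2 * (Lg\<^sup>2 * (norm (Z \<omega>))\<^sup>2) + 2 * (g 0)\<^sup>2)"
      by (intro AE_I2) (simp add: abs_of_nonneg)
  qed simp
qed

end

theorem corollary3p7:
  fixes M :: "'w measure"
    and X :: "real \<Rightarrow> 'w \<Rightarrow> real ^ 'd"
    and \<nu> :: "(real ^ 'd) measure"
    and f :: "real \<Rightarrow> real \<Rightarrow> (real ^ 'd \<Rightarrow> real) \<Rightarrow> real"
    and g :: "real ^ 'd \<Rightarrow> real"
    and Y :: "real \<Rightarrow> 'w \<Rightarrow> real"
    and U :: "real \<Rightarrow> 'w \<Rightarrow> real ^ 'd \<Rightarrow> real"
    and Y' :: "nat \<Rightarrow> real \<Rightarrow> 'w \<Rightarrow> real"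
    and U' :: "nat \<Rightarrow> real \<Rightarrow> 'w \<Rightarrow> real ^ 'd \<Rightarrow> real"
    and T Lf Lg C\<^sub>L\<^sub>T \<beta> :: real
  assumes "0 < T"
    and "levy_setting M T X \<nu>"
    and "lipschitz_driver T \<nu> Lf f"
    and "square_integrable_at_zero T f"
    and "\<forall>x x'. \<bar>g x - g x'\<bar> \<le> Lg * norm (x - x')"
    and "bsde M T X \<nu> f (\<lambda>\<omega>. g (X T \<omega>)) Y U"
    and "\<forall>n\<ge>1. truncated_bsde M T X \<nu> f n (\<lambda>\<omega>. g (truncated_levy T X \<nu> n T \<omega>)) (Y' n) (U' n)"
    and "stability_constant TYPE('w) TYPE('d) Lf T C\<^sub>L\<^sub>T"
    and "blumenthal_getoor \<nu> < 2"
    and "blumenthal_getoor \<nu> < \<beta>" and "\<beta> < 2"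
  shows "\<exists>C'. C' = C\<^sub>L\<^sub>T * Lg \<and>
    (let C\<^sub>\<beta> = 2 * sqrt (LINT x|\<nu>. norm x powr \<beta>) in
     \<forall>n\<ge>1.
       wasserstein (sup_dist T) (path_law M T (Y' n)) (path_law M T Y)
         \<le> ennreal (C' * (C\<^sub>\<beta> * sqrt T / real n powr (1 - \<beta> / 2))) \<and>
       wasserstein (l2_edist (time_measure T \<Otimes>\<^sub>M \<nu>))
           (field_law M T \<nu> (\<lambda>t \<omega>. cut_fun (1 / real n) (U' n t \<omega>))) (field_law M T \<nu> U)
         \<le> ennreal (C' * (C\<^sub>\<beta> * sqrt T / real n powr (1 - \<beta> / 2))))"
proof -
  interpret levy M T X \<nu> using assms by (simp add: levy_def)
  have g: "\<bar>g x - g x'\<bar> \<le> Lg * norm (x - x')" for x x' using assms by blast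
  \<comment> \<open>The Lipschitz inequality between a basis vector and the origin forces this; a
    basis vector exists because the dimension is positive.\<close>
  have Lg: "0 \<le> Lg"
  proof -
    obtain e :: "real ^ 'd" where "e \<in> Basis" using nonempty_Basis by blast
    then show ?thesis using order.trans[OF abs_ge_zero g[of e 0]] by simp
  qed
  have "continuous_on UNIV g"
  proof (rule lipschitz_on_continuous_on)
    show "Lg-lipschitz_on UNIV g" using g Lg by (auto simp: lipschitz_on_def dist_norm)
  qed
  then have g_meas: "g \<in> borel_measurable borel" by (rule borel_measurable_continuous_onI)
  have C: "0 \<le> C\<^sub>L\<^sub>T" using assms(8) unfolding stability_constant_def by (rule conjunct1)
  note bsde = assms(6)[unfolded bsde_def bsde_solution_def]
  have levy_F: "sets (levy_filtration M T X t) \<subseteq> sets M" for t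
    using X_measurable by (rule sets_levy_filtration_subset)
  have Y_meas: "Y t \<in> borel_measurable M" if "t \<in> {0..T}" for t
    using bsde that by (intro subalgebra_borel_measurable[OF levy_F[of t]]) auto
  have U_meas: "joint_field T U \<in> borel_measurable (M \<Otimes>\<^sub>M \<Lambda>)"
    using bsde by (intro joint_field_measurable[OF sigma_finite_\<nu> sets_\<nu> T_pos levy_F]) auto
  have U_fin: "(\<integral>\<^sup>+ \<omega>. (\<integral>\<^sup>+ t\<in>{0..T}. (\<integral>\<^sup>+ x. ennreal (\<bar>U t \<omega> x\<bar>\<^sup>2) \<partial>\<nu>) \<partial>lborel) \<partial>M) < \<infinity>"
    using bsde by auto
  define K where "K n = 2 * sqrt (LINT x|\<nu>. norm x powr \<beta>) * sqrt T / real n powr (1 - \<beta> / 2)" for n :: nat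
  have main: "wasserstein (sup_dist T) (path_law M T (Y' n)) (path_law M T Y) \<le> ennreal (C\<^sub>L\<^sub>T * Lg * K n) \<and>
      wasserstein (l2_edist \<Lambda>) (field_law M T \<nu> (\<lambda>t \<omega>. cut_fun (1 / real n) (U' n t \<omega>))) (field_law M T \<nu> U)
        \<le> ennreal (C\<^sub>L\<^sub>T * Lg * K n)" if n: "1 \<le> n" for n
  proof -
    let ?F = "truncated_filtration M T X \<nu> n" and ?V = "\<lambda>t \<omega>. cut_fun (1 / real n) (U' n t \<omega>)"
    define \<xi>' where "\<xi>' \<omega> = g (truncated_levy T X \<nu> n T \<omega>)" for \<omega>
    define R where "R = ennreal_sqrt (\<integral>\<^sup>+ \<omega>. ennreal (\<bar>\<xi>' \<omega> - g (X T \<omega>)\<bar>\<^sup>2) \<partial>M)"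
    have "truncated_bsde M T X \<nu> f n \<xi>' (Y' n) (U' n)" using assms(7) n unfolding \<xi>'_def by blast
    note tbsde = this and tb = this[unfolded truncated_bsde_def bsde_solution_def]
    have XT: "truncated_levy T X \<nu> n T \<in> borel_measurable M"
      using n T_pos by (intro truncated_levy_measurable) auto
    have XT2: "(\<integral>\<^sup>+ \<omega>. ennreal ((norm (truncated_levy T X \<nu> n T \<omega>))\<^sup>2) \<partial>M) < \<infinity>"
      using compensated_jumps_second_moment[OF n, of T] T_pos by (simp add: truncated_levy_eq[OF n] cong: nn_integral_cong)
    have F: "sets (?F t) \<subseteq> sets M" if "t \<in> {0..T}" for t
      unfolding truncated_filtration_def using n that
      by (intro sets_natural_filtration_subset truncated_levy_measurable) auto
    have Y'_meas: "Y' n t \<in> borel_measurable M" if "t \<in> {0..T}" for t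
      using tb that by (intro subalgebra_borel_measurable[OF F[OF that]]) (auto simp: truncated_filtration_def)
    have V_meas: "joint_field T ?V \<in> borel_measurable (M \<Otimes>\<^sub>M \<Lambda>)"
      using tb F by (intro joint_field_measurable[OF sigma_finite_\<nu> sets_\<nu> T_pos, of ?F] predictable_field_cut) auto
    \<comment> \<open>Kept apart from the cut field: the sections of \<open>U' n\<close> itself must
      be Borel for its integral against \<open>cut_levy\<close> to be rewritten over
      \<open>\<nu>\<close>.\<close>
    have U'_meas: "joint_field T (U' n) \<in> borel_measurable (M \<Otimes>\<^sub>M \<Lambda>)"
      using tb F by (intro joint_field_measurable[OF sigma_finite_\<nu> sets_\<nu> T_pos, of ?F]) auto
    have V_fin: "(\<integral>\<^sup>+ \<omega>. (\<integral>\<^sup>+ t\<in>{0..T}. (\<integral>\<^sup>+ x. ennreal (\<bar>?V t \<omega> x\<bar>\<^sup>2) \<partial>\<nu>) \<partial>lborel) \<partial>M) < \<infinity>"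
    proof -
      have "(\<integral>\<^sup>+ \<omega>. (\<integral>\<^sup>+ t\<in>{0..T}. (\<integral>\<^sup>+ x. ennreal (\<bar>?V t \<omega> x\<bar>\<^sup>2) \<partial>\<nu>) \<partial>lborel) \<partial>M)
          = (\<integral>\<^sup>+ \<omega>. (\<integral>\<^sup>+ t\<in>{0..T}. (\<integral>\<^sup>+ x. ennreal (\<bar>U' n t \<omega> x\<bar>\<^sup>2) \<partial>cut_levy (1 / real n) \<nu>) \<partial>lborel) \<partial>M)"
      proof (intro nn_integral_cong)
        fix \<omega> t assume \<omega>: "\<omega> \<in> space M"
        show "(\<integral>\<^sup>+ x. ennreal (\<bar>?V t \<omega> x\<bar>\<^sup>2) \<partial>\<nu>) * indicator {0..T} t
            = (\<integral>\<^sup>+ x. ennreal (\<bar>U' n t \<omega> x\<bar>\<^sup>2) \<partial>cut_levy (1 / real n) \<nu>) * indicator {0..T} t"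
        proof (cases "t \<in> {0..T}")
          case True
          have "(\<lambda>x. joint_field T (U' n) (\<omega>, t, x)) \<in> borel_measurable \<nu>"
            using \<omega> by (intro measurable_compose[OF _ U'_meas]) measurable
          then have "U' n t \<omega> \<in> borel_measurable borel"
            using True by (simp add: joint_field_def)
          then show ?thesis by (simp only: nn_integral_cut_fun)
        qed simp
      qed
      also have "\<dots> < \<infinity>" using tb by blast
      finally show ?thesis .
    qed
    \<comment> \<open>What remains to be checked concerns the terminal values: measurability for the
      two filtrations at T, from continuity of \<open>g\<close>, and square integrability, from its
      linear growth.\<close>
    have stab: "ennreal_sqrt (\<integral>\<^sup>+ \<omega>. (SUP t\<in>{0..T}. ennreal (\<bar>Y' n t \<omega> - Y t \<omega>\<bar>\<^sup>2)) \<partial>M) \<le> ennreal C\<^sub>L\<^sub>T * R \<and>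
        ennreal_sqrt (\<integral>\<^sup>+ t\<in>{0..T}. (\<integral>\<^sup>+ x. (\<integral>\<^sup>+ \<omega>.
            ennreal (\<bar>cut_fun (1 / real n) (U' n t \<omega>) x - U t \<omega> x\<bar>\<^sup>2) \<partial>M) \<partial>\<nu>) \<partial>lborel) \<le> ennreal C\<^sub>L\<^sub>T * R"
      unfolding R_def
    proof (rule assms(8)[unfolded stability_constant_def, THEN conjunct2, rule_format,
          OF assms(2,3,4) n _ _ _ _ assms(6) tbsde])
      show "(\<lambda>\<omega>. g (X T \<omega>)) \<in> borel_measurable (levy_filtration M T X T)"
        using T_pos by (intro measurable_compose[OF _ g_meas] measurable_levy_filtration) simp
      show "\<xi>' \<in> borel_measurable (truncated_filtration M T X \<nu> n T)"
        unfolding \<xi>'_def[abs_def] truncated_filtration_def using T_pos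
        by (intro measurable_compose[OF _ g_meas] measurable_natural_filtration) simp
      show "integrable M (\<lambda>\<omega>. (g (X T \<omega>))\<^sup>2)"
        using T_pos by (intro lipschitz_square_integrable[OF g g_meas] X_measurable X_second_moment) simp
      show "integrable M (\<lambda>\<omega>. (\<xi>' \<omega>)\<^sup>2)"
        unfolding \<xi>'_def by (intro lipschitz_square_integrable[OF g g_meas] XT XT2)
    qed
    have "ennreal C\<^sub>L\<^sub>T * R \<le> ennreal C\<^sub>L\<^sub>T * ennreal (Lg * K n)"
      unfolding R_def \<xi>'_def K_def
      by (intro mult_left_mono terminal_value_bound[OF n g Lg assms(10,11)]) simp
    also have "\<dots> = ennreal (C\<^sub>L\<^sub>T * Lg * K n)" using C by (simp add: ennreal_mult' mult.assoc)
    finally have CR: "ennreal C\<^sub>L\<^sub>T * R \<le> ennreal (C\<^sub>L\<^sub>T * Lg * K n)" .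
    have "wasserstein (sup_dist T) (path_law M T (Y' n)) (path_law M T Y) \<le> ennreal C\<^sub>L\<^sub>T * R"
      using bsde tb Y_meas Y'_meas
      by (intro order.trans[OF wasserstein_path_law_le[OF prob complete T_pos] stab[THEN conjunct1]]) auto
    moreover have "wasserstein (l2_edist \<Lambda>) (field_law M T \<nu> ?V) (field_law M T \<nu> U) \<le> ennreal C\<^sub>L\<^sub>T * R"
      by (rule order.trans[OF wasserstein_field_law_le[OF sigma_finite_\<nu> sets_\<nu> prob complete U_meas U_fin V_meas V_fin]
        stab[THEN conjunct2]])
    ultimately show ?thesis using CR by (meson order.trans)
  qed
  then show ?thesis unfolding K_def by (simp add: Let_def)
qed

end
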